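(* Let $n\ge 1$. Sending a noncrossing partition $\pi$ of $[n]$ to the bicolored plane tree $\mathcal T(\pi)$ obtained from its polygon diagram (one yellow vertex for each yellow region, one white vertex for each white region, one edge for each polygon side, as defined in the context) induces a well-defined bijection from the set of rotation classes of noncrossing partitions of $[n]$ to the set of bicolored plane trees with $n$ edges.
   Context: Write $[n]=\{1,2,\dots,n\}$. A partition of $[n]$ is noncrossing if no quadruple $a<b<c<d$ has $a,c$ in one block and $b,d$ in a different block. The rotation operator $R$ on partitions of $[n]$ is induced by the map $i\mapsto i+1 \pmod n$ on $[n]$; it preserves the noncrossing property. The rotation class of $\pi$ is $\{R^{i}(\pi): i\ge 1\}$. A bicolored plane tree is a plane tree (no root, no labels; that is, a finite tree together with a cyclic order of the edges around each vertex, considered up to isomorphisms preserving these cyclic orders) in which each vertex is colored white or yellow so that adjacent vertices get different colors; isomorphisms of bicolored plane trees also preserve colors. Polygon diagram: place points labelled $1,2,\dots,n$ in clockwise order on a circle bounding a disk. Each block of size $k$ of a noncrossing partition $\pi$ is represented by a yellow $k$-sided polygon in the disk whose vertices are the points of the block: for $k\ge 3$ the convex hull; for $k=2$ a thin digon with two sides joining the two points; for $k=1$ a small one-sided polygon (a loop with its interior) attached to the circle at the single point. The polygons are pairwise disjoint and have $n$ sides in total. The yellow regions are the polygons; the white regions are the connected components of the rest of the disk. The tree $\mathcal T(\pi)$ has one vertex in each region, colored with the color of the region, and, for each polygon side, an edge crossing that side and joining the vertices of the two regions (one yellow, one white) adjacent along that side; the cyclic order of edges around vertices is the one coming from the planar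 drawing. Only the bicolored plane tree, not the labels $1,\dots,n$, is retained. *)

theory Defs
  imports "HOL-Analysis.Analysis" "HOL-Library.Disjoint_Sets" "HOL-Combinatorics.Orbits"
begin

section \<open>Noncrossing partitions and rotation\<close>

definition noncrossing :: "nat set set \<Rightarrow> bool" where
  "noncrossing \<pi> \<longleftrightarrow>
     \<not> (\<exists>a b c d. a < b \<and> b < c \<and> c < d \<and>
          (\<exists>A\<in>\<pi>. \<exists>B\<in>\<pi>. A \<noteq> B \<and> a \<in> A \<and> c \<in> A \<and> b \<in> B \<and> d \<in> B))"

definition noncrossing_partitions :: "nat \<Rightarrow> nat set set set" where
  "noncrossing_partitions n = {\<pi>. partition_on {1..n} \<pi> \<and> noncrossing \<pi>}"

text \<open>The map \<open>i \<mapsto> i + 1 (mod n)\<close> with representatives \<open>1, \<dots>, n\<close>; thus \<open>n \<mapsto> 1\<close>.\<close>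

definition rot :: "nat \<Rightarrow> nat \<Rightarrow> nat" where
  "rot n i = i mod n + 1"

definition rotate_partition :: "nat \<Rightarrow> nat set set \<Rightarrow> nat set set" where
  "rotate_partition n \<pi> = (\<lambda>B. rot n ` B) ` \<pi>"

definition rotation_class :: "nat \<Rightarrow> nat set set \<Rightarrow> nat set set set" where
  "rotation_class n \<pi> = {(rotate_partition n ^^ i) \<pi> | i. i \<ge> 1}"

definition rotation_classes :: "nat \<Rightarrow> nat set set set set" where
  "rotation_classes n = rotation_class n ` noncrossing_partitions n"


section \<open>Bicolored plane trees\<close>

datatype color = White | Yellow

text \<open>
  Edges are abstract objects, so parallel edges are not excluded by the data type.  For a vertex
  \<open>v\<close> and an edge \<open>e\<close> at \<open>v\<close>, \<open>next_edge v e\<close> is the edge following \<open>e\<close> clockwise around \<open>v\<close>.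
\<close>

record ('v, 'e) plane_graph =
  vertices :: "'v set"
  edges :: "'e set"
  ends :: "'e \<Rightarrow> 'v set"
  color_of :: "'v \<Rightarrow> color"
  next_edge :: "'v \<Rightarrow> 'e \<Rightarrow> 'e"

definition edges_at :: "('v, 'e) plane_graph \<Rightarrow> 'v \<Rightarrow> 'e set" where
  "edges_at G v = {e \<in> edges G. v \<in> ends G e}"

fun walk :: "('v, 'e) plane_graph \<Rightarrow> 'v \<Rightarrow> 'e list \<Rightarrow> 'v \<Rightarrow> bool" where
  "walk G u [] v \<longleftrightarrow> u \<in> vertices G \<and> u = v"
| "walk G u (e # es) v \<longleftrightarrow> e \<in> edges G \<and> (\<exists>w. ends G e = {u, w} \<and> walk G w es v)"

definition connected_graph :: "('v, 'e) plane_graph \<Rightarrow> bool" where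
  "connected_graph G \<longleftrightarrow> (\<forall>u\<in>vertices G. \<forall>v\<in>vertices G. \<exists>es. walk G u es v)"

text \<open>No nonempty closed walk with pairwise distinct edges; this also rules out parallel edges.\<close>

definition acyclic_graph :: "('v, 'e) plane_graph \<Rightarrow> bool" where
  "acyclic_graph G \<longleftrightarrow> \<not> (\<exists>u es. es \<noteq> [] \<and> distinct es \<and> walk G u es u)"

definition bicolored_plane_tree :: "('v, 'e) plane_graph \<Rightarrow> bool" where
  "bicolored_plane_tree G \<longleftrightarrow>
     finite (vertices G) \<and> vertices G \<noteq> {} \<and> finite (edges G) \<and>
     (\<forall>e\<in>edges G. \<exists>u\<in>vertices G. \<exists>v\<in>vertices G.
        ends G e = {u, v} \<and> color_of G u \<noteq> color_of G v) \<and>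
     connected_graph G \<and> acyclic_graph G \<and>
     (\<forall>v\<in>vertices G. edges_at G v \<noteq> {} \<longrightarrow> cyclic_on (next_edge G v) (edges_at G v))"

definition plane_iso :: "('v, 'e) plane_graph \<Rightarrow> ('w, 'f) plane_graph \<Rightarrow> bool"
    (infix \<open>\<simeq>\<^sub>p\<close> 50) where
  "G \<simeq>\<^sub>p H \<longleftrightarrow>
     (\<exists>\<phi> \<psi>. bij_betw \<phi> (vertices G) (vertices H) \<and> bij_betw \<psi> (edges G) (edges H) \<and>
        (\<forall>e\<in>edges G. ends H (\<psi> e) = \<phi> ` ends G e) \<and>
        (\<forall>v\<in>vertices G. color_of H (\<phi> v) = color_of G v) \<and>
        (\<forall>v\<in>vertices G. \<forall>e\<in>edges_at G v.
           next_edge H (\<phi> v) (\<psi> e) = \<psi> (next_edge G v e)))"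

text \<open>
  Isomorphism classes are represented by their members with vertices and edges in \<open>nat\<close>.
  Since every finite tree has such copies, a class determines and is determined by its
  isomorphism type.
\<close>

definition tree_class :: "('v, 'e) plane_graph \<Rightarrow> (nat, nat) plane_graph set" where
  "tree_class G = {H. bicolored_plane_tree H \<and> G \<simeq>\<^sub>p H}"

definition bicolored_plane_trees :: "nat \<Rightarrow> (nat, nat) plane_graph set set" where
  "bicolored_plane_trees n =
     {tree_class T | T :: (nat, nat) plane_graph. bicolored_plane_tree T \<and> card (edges T) = n}"


section \<open>The polygon diagram\<close>

definition point :: "nat \<Rightarrow> nat \<Rightarrow> complex" where
  "point n i = cis (- 2 * pi * real i / real n)"

text \<open>
  A scale for digons and loops.  It is small enough that they stay inside the disk and that the
  polygons of a noncrossing partition are pairwise disjoint.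
\<close>

definition thinness :: "nat \<Rightarrow> real" where
  "thinness n = 1 / (real n + 1)\<^sup>2"

text \<open>The next element of \<open>B\<close> in clockwise order, which is \<open>i\<close> itself if \<open>B = {i}\<close>.\<close>

definition cyc_next :: "nat set \<Rightarrow> nat \<Rightarrow> nat" where
  "cyc_next B i = (if \<exists>j\<in>B. i < j then Min {j \<in> B. i < j} else Min B)"

text \<open>
  The side of the polygon of \<open>B\<close> leading clockwise from the point \<open>i \<in> B\<close> to the next point of \<open>B\<close>.
  The two sides of a digon are parabolic arcs that bulge to opposite sides of the common chord; the
  side of a monogon is a circle internally tangent to the unit circle.
\<close>

definition side :: "nat \<Rightarrow> nat set \<Rightarrow> nat \<Rightarrow> complex set" where
  "side n B i =
     (let p = point n i; q = point n (cyc_next B i); \<delta> = thinness n in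
      if card B = 1 then sphere (of_real (1 - \<delta>) * p) \<delta>
      else if card B = 2 then
        {p + of_real t * (q - p) + of_real (\<delta> * t * (1 - t)) * \<i> * (q - p) | t. 0 \<le> t \<and> t \<le> 1}
      else closed_segment p q)"

text \<open>
  For \<open>card B \<ge> 3\<close> this is the convex hull of the points of \<open>B\<close>; for \<open>card B = 2\<close> it is the lens
  and for \<open>card B = 1\<close> the closed disk enclosed by the sides.
\<close>

definition polygon :: "nat \<Rightarrow> nat set \<Rightarrow> complex set" where
  "polygon n B = convex hull (\<Union>i\<in>B. side n B i)"

definition yellow_regions :: "nat \<Rightarrow> nat set set \<Rightarrow> complex set set" where
  "yellow_regions n \<pi> = polygon n ` \<pi>"

definition white_regions :: "nat \<Rightarrow> nat set set \<Rightarrow> complex set set" where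
  "white_regions n \<pi> = components (cball 0 1 - \<Union> (yellow_regions n \<pi>))"


section \<open>The tree of a noncrossing partition\<close>

text \<open>
  Every point of \<open>{1..n}\<close> is the initial point of exactly one polygon side, so the sides,
  and hence the edges of the tree, are named by their initial points.
\<close>

definition block_of :: "nat set set \<Rightarrow> nat \<Rightarrow> nat set" where
  "block_of \<pi> i = (THE B. B \<in> \<pi> \<and> i \<in> B)"

definition side_from :: "nat \<Rightarrow> nat set set \<Rightarrow> nat \<Rightarrow> complex set" where
  "side_from n \<pi> i = side n (block_of \<pi> i) i"

definition side_end :: "nat set set \<Rightarrow> nat \<Rightarrow> nat" where
  "side_end \<pi> i = cyc_next (block_of \<pi> i) i"

text \<open>
  A region serves as the vertex placed in it.  A region is adjacent along a side iff its closure
  contains the whole side.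

  The edges leave the vertex of a region in the order in which the sides occur along the boundary
  of the region.  Traversing the boundary of a yellow region clockwise, the side from \<open>i\<close> to \<open>j\<close>
  is followed by the side starting at \<open>j\<close>.  Traversing the boundary of a white region clockwise,
  sides are run through backwards: after the side from \<open>i\<close> to \<open>j\<close> one is at \<open>i\<close>, follows the
  circle clockwise to \<open>rot n i\<close>, and then meets the side ending there.
\<close>

definition polygon_tree :: "nat \<Rightarrow> nat set set \<Rightarrow> (complex set, nat) plane_graph" where
  "polygon_tree n \<pi> =
     \<lparr> vertices = yellow_regions n \<pi> \<union> white_regions n \<pi>,
       edges = {1..n},
       ends = (\<lambda>i. {X \<in> yellow_regions n \<pi> \<union> white_regions n \<pi>. side_from n \<pi> i \<subseteq> closure X}),
       color_of = (\<lambda>X. if X \<in> yellow_regions n \<pi> then Yellow else White),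
       next_edge = (\<lambda>X i. if X \<in> yellow_regions n \<pi> then side_end \<pi> i
                          else (THE j. j \<in> {1..n} \<and> side_end \<pi> j = rot n i)) \<rparr>"

end

theory Submission
  imports Defs
begin

text \<open>
  Let \<open>\<sigma>\<close> send each point to the clockwise next point of its block and let \<open>c\<close> be the rotation
  \<open>i \<mapsto> i + 1\<close>. The sides at a yellow vertex form a cycle of \<open>\<sigma>\<close>. The white regions correspond to the
  cycles of \<open>\<sigma>\<^sup>-\<^sup>1 \<circ> c\<close> (the Kreweras complement): each side \<open>i\<close> cuts off from the disk a convex part
  \<open>F i\<close> containing its polygon, every polygon is the intersection of the parts of its sides, and a
  white region is the disk minus the disjoint parts \<open>F i\<close> of its own sides, hence connected by
  Janiszewski's theorem. So up to isomorphism the tree is the pair of permutations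
  \<open>(\<sigma>, \<sigma>\<^sup>-\<^sup>1 \<circ> c)\<close> of its edges.

  An isomorphism between two such trees conjugates these pairs, so it commutes with their product
  \<open>c\<close> and is a rotation. Conversely, in any bicolored plane tree the product of the two edge rotations is
  a single cycle, the walk around the tree; numbering the edges along it turns the product into \<open>c\<close>.
  Removing an edge \<open>e\<close> shows that the labels between \<open>e\<close> and the next edge at its yellow vertex are those
  of the edges on the white side of \<open>e\<close>, and therefore the yellow vertices form a noncrossing partition.
\<close>

section \<open>Chords and caps of the disk\<close>

text \<open>A polygon may meet the circle in several points, so polygons cannot be removed from the
  disk one by one with Janiszewski's theorem; the larger convex parts \<open>F i\<close> meet the
  circle in a single arc. Their disjointness accounts for the thickness: two parts at one white
  region lie over arcs that are at least one step apart, so each arc may be lengthened by half a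
  step at both ends. This moves its chord by at least 2 / n^2, whereas digons and loops exceed their
  chord or tangent by at most 2 * \<open>thinness n\<close>, and \<open>thinness n\<close> is less
  than 1 / n^2.

  Positions on the circle are real parameters, unrolled so that the clockwise successor of i in its
  block lies in {i<..i + n}; chords passing the label n then follow the same formulas as all others.

  Since a region is adjacent along a side only if its closure contains the whole side, regions that
  merely touch at a vertex do no harm, but every non-adjacency has to be witnessed by a suitable
  point of the side.\<close>

definition circ :: "nat \<Rightarrow> real \<Rightarrow> complex" where
  "circ n x = cis (- 2 * pi * x / real n)"

text \<open>The signed distance of \<open>z\<close> from the chord joining \<open>circ n x\<close> and \<open>circ n y\<close>, positive on the
  side of the clockwise arc from \<open>circ n x\<close> to \<open>circ n y\<close>.\<close>

definition cap_height :: "nat \<Rightarrow> real \<Rightarrow> real \<Rightarrow> complex \<Rightarrow> real" where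
  "cap_height n x y z = Re (z * cnj (circ n ((x + y) / 2))) - cos (pi * (y - x) / real n)"

lemma norm_circ [simp]: "cmod (circ n x) = 1"
  by (simp add: circ_def)

lemma circ_of_nat: "circ n i = point n i"
  by (simp add: circ_def point_def)

lemma circ_add_n: "n \<ge> 1 \<Longrightarrow> circ n (x + real n) = circ n x"
proof -
  assume "n \<ge> 1"
  then have "- 2 * pi * (x + real n) / real n = - 2 * pi * x / real n - 2 * pi"
    by (simp add: field_simps)
  then show ?thesis
    by (simp add: circ_def cis_divide[symmetric])
qed

lemma circ_add_half: "n \<ge> 1 \<Longrightarrow> circ n (x + real n / 2) = - circ n x"
proof -
  assume "n \<ge> 1"
  then have "- 2 * pi * (x + real n / 2) / real n = - 2 * pi * x / real n - pi"
    by (simp add: field_simps)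
  then show ?thesis
    by (simp add: circ_def cis_divide[symmetric])
qed

lemma continuous_on_circ: "continuous_on S (circ n)"
  unfolding circ_def divide_inverse by (intro continuous_intros)

lemma continuous_on_cap_height: "continuous_on S (cap_height n x y)"
  unfolding cap_height_def by (intro continuous_intros)

lemma sin_angle_pos: "0 < t \<Longrightarrow> t < real n \<Longrightarrow> 0 < sin (pi * t / n)"
  by (intro sin_gt_zero) (auto simp: field_simps)

lemma sin_angle_nonneg: "0 \<le> t \<Longrightarrow> t \<le> real n \<Longrightarrow> 0 \<le> sin (pi * t / n)"
  by (cases "n = 0") (auto intro!: sin_ge_zero simp: field_simps)

text \<open>The complementary arc has the same chord and the antipodal centre, so only the sign
  changes.\<close>

lemma cap_height_opposite: "n \<ge> 1 \<Longrightarrow> cap_height n y (x + real n) z = - cap_height n x y z"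
proof -
  assume n: "n \<ge> 1"
  have 1: "(y + (x + real n)) / 2 = (x + y) / 2 + real n / 2"
    by (simp add: field_simps)
  have "pi * (x + real n - y) / real n = pi - pi * (y - x) / real n"
    using n by (simp add: field_simps)
  then show ?thesis
    using circ_add_half[OF n] by (simp only: cap_height_def 1) simp
qed

text \<open>A difference of cosines as a product: the side of the chord on which a point of the
  circle lies is then visible from the signs of two sines.\<close>

lemma cap_height_circ:
  assumes "n \<ge> 1"
  shows "cap_height n x y (circ n v) = 2 * sin (pi * (v - x) / n) * sin (pi * (y - v) / n)"
proof -
  have "circ n v * cnj (circ n ((x + y) / 2)) = cis (2 * pi * ((x + y) / 2 - v) / n)"
    using assms by (simp add: circ_def cis_cnj cis_mult) (rule arg_cong[where f = cis], simp add: divide_simps, simp add: algebra_simps)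
  then have "cap_height n x y (circ n v) = cos (2 * pi * ((x + y) / 2 - v) / n) - cos (pi * (y - x) / n)"
    by (simp add: cap_height_def)
  also have "2 * pi * ((x + y) / 2 - v) / n = pi * (y - v) / n - pi * (v - x) / n"
    using assms by (simp add: field_simps)
  also have "pi * (y - x) / n = pi * (y - v) / n + pi * (v - x) / n"
    using assms by (simp add: field_simps)
  finally show ?thesis
    by (simp add: cos_add cos_diff)
qed

lemma cmod_add_sq: "(cmod (a + b))\<^sup>2 = (cmod a)\<^sup>2 + (cmod b)\<^sup>2 + 2 * Re (a * cnj b)"
  unfolding cmod_power2 by (simp add: power2_eq_square algebra_simps)

lemma Re_mult_cnj_le: "cmod z \<le> 1 \<Longrightarrow> Re (z * cnj w) \<le> cmod w"
  by (metis complex_Re_le_cmod complex_mod_cnj dual_order.trans mult_left_le_one_le norm_ge_zero norm_mult)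

text \<open>With half angles \<open>\<alpha>\<close> and \<open>\<beta>\<close> and centres \<open>u\<close> and \<open>v\<close> of the two arcs, weight the two cap
  inequalities by \<open>sin \<beta>\<close> and \<open>sin \<alpha>\<close>: their sum contradicts \<open>\<bar>sin \<beta> u + sin \<alpha> v\<bar> \<le> sin (\<alpha> + \<beta>)\<close>.\<close>

lemma caps_disjoint:
  assumes n: "n \<ge> 1" and xy: "x < y" "y \<le> x'" "x' < y'" "y' \<le> x + real n"
    and z: "cmod z \<le> 1" "cap_height n x y z > 0" "cap_height n x' y' z > 0"
  shows False
proof -
  define \<alpha> where "\<alpha> = pi * (y - x) / n"
  define \<beta> where "\<beta> = pi * (y' - x') / n"
  \<comment> \<open>The angle between the two centres. That the arcs do not overlap at either end
    gives \<open>g1\<close> and \<open>g2\<close>, which together bound \<alpha> + \<beta> by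
    pi.\<close>
  define \<gamma> where "\<gamma> = 2 * pi * ((x' + y') / 2 - (x + y) / 2) / n"
  define u where "u = circ n ((x + y) / 2)"
  define v where "v = circ n ((x' + y') / 2)"
  have a: "0 < \<alpha>" "0 < \<beta>"
    using n xy by (simp_all add: \<alpha>_def \<beta>_def)
  have "\<gamma> - (\<alpha> + \<beta>) = 2 * pi * (x' - y) / n"
    using n by (simp add: \<alpha>_def \<beta>_def \<gamma>_def field_simps)
  moreover have "0 \<le> 2 * pi * (x' - y) / n"
    using n xy by simp
  ultimately have g1: "\<alpha> + \<beta> \<le> \<gamma>"
    by linarith
  have "2 * pi - \<gamma> - (\<alpha> + \<beta>) = 2 * pi * (x + n - y') / n"
    using n by (simp add: \<alpha>_def \<beta>_def \<gamma>_def field_simps)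
  moreover have "0 \<le> 2 * pi * (x + n - y') / n"
    using n xy by simp
  ultimately have g2: "\<gamma> \<le> 2 * pi - (\<alpha> + \<beta>)"
    by linarith
  have ab: "\<alpha> + \<beta> \<le> pi"
    using g1 g2 by linarith
  have s: "0 < sin \<alpha>" "0 < sin \<beta>" "0 \<le> sin (\<alpha> + \<beta>)"
    using a ab by (auto intro!: sin_gt_zero sin_ge_zero)
  have cg: "cos \<gamma> \<le> cos (\<alpha> + \<beta>)"
  proof (cases "\<gamma> \<le> pi")
    case True
    then show ?thesis using a g1 by (intro cos_monotone_0_pi_le) auto
  next
    case False
    have "cos (2 * pi - \<gamma>) \<le> cos (\<alpha> + \<beta>)"
      using a g1 g2 False by (intro cos_monotone_0_pi_le) auto
    then show ?thesis by simp
  qed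
  have uv: "u * cnj v = cis \<gamma>"
    using n by (simp add: u_def v_def circ_def cis_cnj cis_mult \<gamma>_def) (rule arg_cong[where f = cis], simp add: divide_simps, simp add: algebra_simps)
  have "of_real (sin \<beta>) * u * cnj (of_real (sin \<alpha>) * v) = of_real (sin \<beta> * sin \<alpha>) * (u * cnj v)"
    by simp
  then have "Re (of_real (sin \<beta>) * u * cnj (of_real (sin \<alpha>) * v)) = sin \<beta> * sin \<alpha> * cos \<gamma>"
    by (simp only: uv) simp
  then have "(cmod (of_real (sin \<beta>) * u + of_real (sin \<alpha>) * v))\<^sup>2
      = (sin \<beta>)\<^sup>2 + (sin \<alpha>)\<^sup>2 + 2 * (sin \<beta> * sin \<alpha> * cos \<gamma>)"
    by (subst cmod_add_sq) (simp only: norm_mult norm_of_real u_def v_def norm_circ mult_1_right power2_abs)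
  also have "(sin \<beta>)\<^sup>2 + (sin \<alpha>)\<^sup>2 + 2 * (sin \<beta> * sin \<alpha> * cos \<gamma>)
      \<le> (sin \<beta>)\<^sup>2 + (sin \<alpha>)\<^sup>2 + 2 * (sin \<beta> * sin \<alpha> * cos (\<alpha> + \<beta>))"
    using cg s by (intro add_left_mono mult_left_mono) auto
  also have "\<dots> = (sin (\<alpha> + \<beta>))\<^sup>2"
  proof -
    have "b\<^sup>2 + a\<^sup>2 + 2 * (b * a * (c * d - a * b)) = (a * d + c * b)\<^sup>2"
      if "c\<^sup>2 + a\<^sup>2 = 1" "d\<^sup>2 + b\<^sup>2 = 1" for a b c d :: real
      using that by algebra
    from this[of "cos \<alpha>" "sin \<alpha>" "cos \<beta>" "sin \<beta>"] show ?thesis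
      by (simp add: sin_add cos_add)
  qed
  finally have "(cmod (of_real (sin \<beta>) * u + of_real (sin \<alpha>) * v))\<^sup>2 \<le> (sin (\<alpha> + \<beta>))\<^sup>2" .
  then have le: "cmod (of_real (sin \<beta>) * u + of_real (sin \<alpha>) * v) \<le> sin (\<alpha> + \<beta>)"
    using s(3) by (rule power2_le_imp_le)
  have "cos \<alpha> < Re (z * cnj u)" "cos \<beta> < Re (z * cnj v)"
    using z by (simp_all add: cap_height_def \<alpha>_def \<beta>_def u_def v_def)
  then have "sin \<beta> * cos \<alpha> + sin \<alpha> * cos \<beta> < sin \<beta> * Re (z * cnj u) + sin \<alpha> * Re (z * cnj v)"
    using s by (intro add_strict_mono mult_strict_left_mono) auto
  also have "\<dots> = Re (z * cnj (of_real (sin \<beta>) * u + of_real (sin \<alpha>) * v))"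
    by (simp add: algebra_simps)
  also have "\<dots> \<le> sin (\<alpha> + \<beta>)"
    using Re_mult_cnj_le[OF z(1)] le by (rule order_trans)
  finally show False
    by (simp add: sin_add mult.commute[of "sin \<beta>"])
qed

lemma circ_surj:
  assumes "n \<ge> 1" "cmod z = 1"
  obtains v where "a \<le> v" "v < a + real n" "z = circ n v"
proof -
  obtain t where t: "z = cis t"
    using assms(2) by (metis cmod_unit_one is_Arg_def mult_1 of_real_1 rcis_cmod_Arg rcis_def)
  define v0 where "v0 = - t * n / (2 * pi)"
  define k where "k = \<lfloor>(v0 - a) / n\<rfloor>"
  define v where "v = v0 - n * of_int k"
  have n: "real n > 0" using assms by simp
  have k: "of_int k \<le> (v0 - a) / n" "(v0 - a) / n < of_int k + 1"
    by (simp_all add: k_def)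
  have "a \<le> v" "v < a + real n"
    using k n by (simp_all add: v_def field_simps)
  moreover have "circ n v = z"
  proof -
    have "- 2 * pi * v / n = t + 2 * pi * of_int k"
      using n by (simp add: v_def v0_def field_simps)
    then show ?thesis
      by (simp add: circ_def t cis_mult[symmetric] cis_multiple_2pi)
  qed
  ultimately show ?thesis using that by blast
qed

text \<open>The chord of a full turn, from v to v + n, is the tangent at \<open>circ n v\<close>;
  its \<open>cap_height\<close> vanishes there and is positive at all other points of the
  turn.\<close>

lemma circ_inj:
  assumes n: "n \<ge> 1" and v: "a \<le> v" "v < a + real n" "a \<le> w" "w < a + real n"
    and eq: "circ n v = circ n w"
  shows "v = w"
proof (rule ccontr)
  assume "v \<noteq> w"
  have *: False if vw: "v < w" "w < v + real n" and eq: "circ n v = circ n w" for v w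
  proof -
    have "cap_height n v (v + n) (circ n w) = 0"
      unfolding eq[symmetric] by (subst cap_height_circ[OF n]) simp
    moreover have "cap_height n v (v + n) (circ n w) > 0"
    proof -
      have "0 < sin (pi * (w - v) / n)" "0 < sin (pi * (v + n - w) / n)"
        using n vw by (auto intro!: sin_angle_pos)
      then show ?thesis
        by (subst cap_height_circ[OF n]) simp
    qed
    ultimately show False by simp
  qed
  show False
  proof (cases "v < w")
    case True
    then show False using *[of v w] v eq by linarith
  next
    case False
    then show False using *[of w v] v eq[symmetric] \<open>v \<noteq> w\<close> by linarith
  qed
qed

lemma cap_height_circ':
  assumes "n \<ge> 1"
  shows "cap_height n x y (circ n v) = - 2 * sin (pi * (v - x) / n) * sin (pi * (v - y) / n)"
proof -
  have "sin (pi * (y - v) / n) = - sin (pi * (v - y) / n)"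
    by (metis minus_diff_eq minus_divide_left mult_minus_right sin_minus)
  then show ?thesis using assms by (simp add: cap_height_circ)
qed

lemma cap_height_circ_pos:
  assumes "n \<ge> 1" "x < v" "v < y" "y \<le> x + real n"
  shows "cap_height n x y (circ n v) > 0"
  using assms sin_angle_pos[of "v - x" n] sin_angle_pos[of "y - v" n] by (simp add: cap_height_circ)

lemma cap_height_circ_nonpos:
  assumes "n \<ge> 1" "x \<le> y" "y \<le> v" "v \<le> x + real n"
  shows "cap_height n x y (circ n v) \<le> 0"
  using assms sin_angle_nonneg[of "v - x" n] sin_angle_nonneg[of "v - y" n] by (simp add: cap_height_circ')

lemma cap_height_circ_neg:
  assumes "n \<ge> 1" "x < y" "y < v" "v < x + real n"
  shows "cap_height n x y (circ n v) < 0"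
  using assms sin_angle_pos[of "v - x" n] sin_angle_pos[of "v - y" n] by (simp add: cap_height_circ')

section \<open>The right-hand side of a polygon side\<close>

text \<open>For \<open>\<kappa> = 0\<close> and \<open>\<kappa> = thinness n\<close> this describes the sides of polygons with at least three,
  respectively exactly two vertices.\<close>

locale chord =
  fixes n :: nat and x y \<kappa> :: real
  assumes n: "n \<ge> 1" and xy: "x < y" "y < x + n"
    and k0: "0 \<le> \<kappa>" and k_le: "\<kappa> \<le> thinness n" and k_small: "4 * \<kappa> < 2 * sin (pi * (y - x) / n)"
begin

definition half :: real where "half = pi * (y - x) / n"
definition len :: real where "len = 2 * sin half"

text \<open>Coordinates in which the chord is the real unit interval. The cap over the clockwise arc
  from x to y is where the imaginary part is positive.\<close>

definition pt :: "complex \<Rightarrow> complex" where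
  "pt \<zeta> = circ n x + \<zeta> * (circ n y - circ n x)"

text \<open>The parabola is taken over the whole line and not only over the chord, so that the
  region below it is convex. By \<open>outside_height\<close> its branches beyond the endpoints
  remove nothing from the part of the disk below the chord.\<close>

definition right :: "complex set" where
  "right = cball 0 1 \<inter> pt ` {\<zeta>. Im \<zeta> \<le> \<kappa> * (Re \<zeta> * (1 - Re \<zeta>))}"

definition arc_pt :: "real \<Rightarrow> complex" where
  "arc_pt t = pt (Complex t (\<kappa> * (t * (1 - t))))"

lemma half_bounds: "0 < half" "half < pi"
proof -
  have "pi * (y - x) < pi * n"
    using xy by (intro mult_strict_left_mono) auto
  then show "0 < half" "half < pi"
    using n xy by (auto simp: half_def divide_less_eq)
qed

lemma len_pos: "0 < len"
  using half_bounds by (simp add: len_def sin_gt_zero)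

lemma len_le: "len \<le> 2"
  by (simp add: len_def)

lemma k_len: "4 * \<kappa> < len"
  using k_small by (simp add: len_def half_def)

text \<open>After the centre of the arc is rotated to 1 the chord is vertical, running from
  \<open>cis half\<close> down by \<open>len\<close>; heights and norms become explicit.\<close>

lemma pt_eq: "pt \<zeta> = circ n ((x + y) / 2) * (cis half - \<i> * of_real len * \<zeta>)"
proof -
  have "circ n x = circ n ((x + y) / 2) * cis half" "circ n y = circ n ((x + y) / 2) * cis (- half)"
    using n by (simp_all add: circ_def half_def cis_mult)
      (rule arg_cong[where f = cis], simp add: divide_simps, simp add: algebra_simps)+
  then show ?thesis
    unfolding pt_def len_def
    by (simp add: complex_eq_iff) (simp add: algebra_simps)
qed

lemma cap_height_pt: "cap_height n x y (pt \<zeta>) = len * Im \<zeta>"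
proof -
  have "pt \<zeta> * cnj (circ n ((x + y) / 2)) = cis half - \<i> * of_real len * \<zeta>"
  proof -
    have "circ n ((x + y) / 2) * cnj (circ n ((x + y) / 2)) = 1"
      by (simp add: complex_norm_square[symmetric])
    then show ?thesis
      by (simp add: pt_eq mult.commute mult.left_commute)
  qed
  then show ?thesis
    by (simp add: cap_height_def half_def)
qed

lemma norm_pt: "(cmod (pt \<zeta>))\<^sup>2 = 1 + 2 * len * Im \<zeta> * cos half + len\<^sup>2 * (Im \<zeta>)\<^sup>2 - len\<^sup>2 * (Re \<zeta> * (1 - Re \<zeta>))"
proof -
  have "(cmod (pt \<zeta>))\<^sup>2 = (cmod (cis half - \<i> * of_real len * \<zeta>))\<^sup>2"
    by (simp add: pt_eq norm_mult)
  also have "\<dots> = (cos half + len * Im \<zeta>)\<^sup>2 + (sin half - len * Re \<zeta>)\<^sup>2"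
    by (simp add: cmod_power2)
  also have "\<dots> = ((cos half)\<^sup>2 + (sin half)\<^sup>2) + 2 * len * Im \<zeta> * cos half + len\<^sup>2 * (Im \<zeta>)\<^sup>2
      - len * Re \<zeta> * (2 * sin half) + len\<^sup>2 * (Re \<zeta>)\<^sup>2"
    by (simp add: power2_eq_square algebra_simps)
  also have "\<dots> = 1 + 2 * len * Im \<zeta> * cos half + len\<^sup>2 * (Im \<zeta>)\<^sup>2 - len * Re \<zeta> * len + len\<^sup>2 * (Re \<zeta>)\<^sup>2"
    by (simp add: len_def)
  finally show ?thesis
    by (simp add: power2_eq_square algebra_simps)
qed

lemma pt_inv: "pt ((z - circ n x) / (circ n y - circ n x)) = z"
proof -
  have "circ n x \<noteq> circ n y"
    using circ_inj[OF n, of x x y] xy n by auto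
  then show ?thesis by (simp add: pt_def)
qed

lemma pt_surj: obtains \<zeta> where "z = pt \<zeta>"
  using pt_inv by metis

lemma pt_inj: "pt \<zeta> = pt \<xi> \<longleftrightarrow> \<zeta> = \<xi>"
proof -
  have "circ n x \<noteq> circ n y"
    using circ_inj[OF n, of x x y] xy n by auto
  then show ?thesis by (simp add: pt_def)
qed

lemma mem_right: "pt \<zeta> \<in> right \<longleftrightarrow> cmod (pt \<zeta>) \<le> 1 \<and> Im \<zeta> \<le> \<kappa> * (Re \<zeta> * (1 - Re \<zeta>))"
  by (auto simp: right_def pt_inj image_iff)

lemma right_subset: "right \<subseteq> cball 0 1"
  by (auto simp: right_def)

lemma convex_parabola: "convex {\<zeta>. Im \<zeta> \<le> \<kappa> * (Re \<zeta> * (1 - Re \<zeta>))}"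
proof (rule convexI)
  fix a b :: complex and u v :: real
  assume a: "a \<in> {\<zeta>. Im \<zeta> \<le> \<kappa> * (Re \<zeta> * (1 - Re \<zeta>))}" and b: "b \<in> {\<zeta>. Im \<zeta> \<le> \<kappa> * (Re \<zeta> * (1 - Re \<zeta>))}"
    and uv: "0 \<le> u" "0 \<le> v" "u + v = 1"
  have v: "v = 1 - u" using uv by simp
  have "u * Im a + v * Im b \<le> u * (\<kappa> * (Re a * (1 - Re a))) + v * (\<kappa> * (Re b * (1 - Re b)))"
    using a b uv by (intro add_mono mult_left_mono) auto
  \<comment> \<open>Concavity of t * (1 - t) with its exact defect u * v * (Re a - Re b)^2.\<close>
  moreover have "u * (\<kappa> * (Re a * (1 - Re a))) + v * (\<kappa> * (Re b * (1 - Re b))) + \<kappa> * u * v * (Re a - Re b)\<^sup>2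
      = \<kappa> * ((u * Re a + v * Re b) * (1 - (u * Re a + v * Re b)))"
    unfolding v by (simp add: power2_eq_square algebra_simps)
  moreover have "0 \<le> \<kappa> * u * v * (Re a - Re b)\<^sup>2"
    using k0 uv by simp
  ultimately show "u *\<^sub>R a + v *\<^sub>R b \<in> {\<zeta>. Im \<zeta> \<le> \<kappa> * (Re \<zeta> * (1 - Re \<zeta>))}"
    by simp
qed

lemma convex_right: "convex right"
proof -
  have "pt ` S = (\<lambda>w. circ n x + w) ` ((\<lambda>w. w * (circ n y - circ n x)) ` S)" for S
    by (simp add: image_image pt_def)
  moreover have "linear (\<lambda>w. w * (circ n y - circ n x))"
    by (intro linearI) (simp_all add: algebra_simps)
  ultimately show ?thesis
    unfolding right_def
    by (metis convex_Int convex_cball convex_linear_image convex_parabola convex_translation)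
qed

lemma closed_right: "closed right"
proof -
  have eq: "right = cball 0 1 \<inter> {z. Im ((z - circ n x) / (circ n y - circ n x)) \<le>
      \<kappa> * (Re ((z - circ n x) / (circ n y - circ n x)) * (1 - Re ((z - circ n x) / (circ n y - circ n x))))}"
    (is "_ = _ \<inter> {z. ?P z}")
  proof (rule set_eqI)
    fix z show "z \<in> right \<longleftrightarrow> z \<in> cball 0 1 \<inter> {z. ?P z}"
      using mem_right[of "(z - circ n x) / (circ n y - circ n x)"] by (simp add: pt_inv)
  qed
  have ne: "circ n y - circ n x \<noteq> 0"
    using circ_inj[OF n, of x x y] xy n by auto
  show ?thesis
    unfolding eq using ne by (intro closed_Int closed_cball closed_Collect_le continuous_intros) auto
qed

lemma compact_right: "compact right"
  using closed_right right_subset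
  by (meson bounded_cball bounded_subset compact_eq_bounded_closed)

text \<open>A counterexample lies beyond an endpoint, between the chord and a branch of the
  parabola. There \<open>norm_pt\<close> gives 2 * Im \<zeta> \<le> len * \<tau>: the circle falls
  off faster than the parabola, because 2 * \<kappa> < len.\<close>

lemma outside_height: assumes "cmod (pt \<zeta>) \<le> 1" "Im \<zeta> > \<kappa> * (Re \<zeta> * (1 - Re \<zeta>))" shows "Im \<zeta> > 0"
proof (rule ccontr)
  define \<tau> where "\<tau> = Re \<zeta> * (1 - Re \<zeta>)"
  assume h: "\<not> Im \<zeta> > 0"
  then have "\<kappa> * \<tau> < 0" using assms(2) by (simp add: \<tau>_def)
  then have t: "\<tau> < 0" "\<kappa> > 0" using k0 by (auto simp: mult_less_0_iff)
  have "(cmod (pt \<zeta>))\<^sup>2 \<le> 1" using assms(1) by (simp add: power_le_one)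
  then have "2 * len * Im \<zeta> * cos half + len\<^sup>2 * (Im \<zeta>)\<^sup>2 \<le> len\<^sup>2 * \<tau>"
    by (simp add: norm_pt \<tau>_def)
  moreover have "0 \<le> len\<^sup>2 * (Im \<zeta>)\<^sup>2" by simp
  ultimately have "2 * len * Im \<zeta> * cos half \<le> len\<^sup>2 * \<tau>" by linarith
  moreover have "2 * len * Im \<zeta> * 1 \<le> 2 * len * Im \<zeta> * cos half"
    using h len_pos by (intro mult_left_mono_neg) (auto simp: mult_le_0_iff)
  ultimately have "len * (2 * Im \<zeta>) \<le> len * (len * \<tau>)"
    by (simp add: power2_eq_square algebra_simps)
  then have "2 * Im \<zeta> \<le> len * \<tau>"
    using len_pos by simp
  moreover have "2 * (\<kappa> * \<tau>) < 2 * Im \<zeta>" using assms(2) by (simp add: \<tau>_def)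
  ultimately have "(2 * \<kappa>) * \<tau> < len * \<tau>" by linarith
  then have "2 * \<kappa> > len" using t by (simp add: mult_less_cancel_right)
  then show False using k_len t by linarith
qed

lemma outside_cap: "z \<in> cball 0 1 - right \<Longrightarrow> cap_height n x y z > 0"
proof -
  assume z: "z \<in> cball 0 1 - right"
  obtain \<zeta> where \<zeta>: "z = pt \<zeta>" by (rule pt_surj)
  have "Im \<zeta> > 0"
    using z outside_height[of \<zeta>] by (auto simp: \<zeta> mem_right)
  then show ?thesis
    using len_pos by (simp add: \<zeta> cap_height_pt)
qed

text \<open>On the circle the norm condition becomes the equation len * \<tau> = h * (2 * cos half +
  len * h). The bracket is at most 4, so 4 * \<kappa> < len keeps the parabola strictly below the
  arc.\<close>

lemma right_sphere: assumes "cmod z = 1" shows "z \<in> right \<longleftrightarrow> cap_height n x y z \<le> 0"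
proof -
  obtain \<zeta> where \<zeta>: "z = pt \<zeta>" by (rule pt_surj)
  define h where "h = Im \<zeta>"
  define \<tau> where "\<tau> = Re \<zeta> * (1 - Re \<zeta>)"
  have "h > \<kappa> * \<tau>" if h: "h > 0"
  proof -
    have sq: "(cmod (pt \<zeta>))\<^sup>2 = 1" using assms by (simp add: \<zeta>)
    have "len * (len * \<tau>) = len * (h * (2 * cos half + len * h))"
      using sq unfolding norm_pt \<tau>_def h_def by (simp add: power2_eq_square algebra_simps)
    then have 1: "len * \<tau> = h * (2 * cos half + len * h)"
      using len_pos by simp
    have "len * h \<le> 2"
    proof -
      have "Re (z * cnj (circ n ((x + y) / 2))) \<le> cmod (circ n ((x + y) / 2))"
        using assms by (intro Re_mult_cnj_le) simp
      then have "len * h \<le> 1 - cos half"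
        using cap_height_pt[of \<zeta>] by (simp add: cap_height_def \<zeta> h_def half_def)
      then show ?thesis using cos_ge_minus_one[of half] by linarith
    qed
    then have "2 * cos half + len * h \<le> 4"
      using cos_le_one[of half] by linarith
    then have "\<kappa> * (h * (2 * cos half + len * h)) \<le> \<kappa> * (h * 4)"
      using k0 h by (intro mult_left_mono) auto
    also have "\<dots> = (4 * \<kappa>) * h" by simp
    also have "\<dots> < len * h" using k_len h by (intro mult_strict_right_mono)
    finally have "\<kappa> * (len * \<tau>) < len * h"
      unfolding 1 .
    then have "len * (\<kappa> * \<tau>) < len * h"
      by (simp only: mult.left_commute)
    then show ?thesis using len_pos by simp
  qed
  moreover have "h > 0" if "h > \<kappa> * \<tau>"
    using outside_height[of \<zeta>] that assms by (simp add: \<zeta> h_def \<tau>_def)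
  ultimately have "z \<in> right \<longleftrightarrow> h \<le> 0"
    using assms by (auto simp: \<zeta> mem_right h_def \<tau>_def not_less[symmetric])
  then show ?thesis
    using len_pos by (simp add: \<zeta> cap_height_pt h_def mult_le_0_iff)
qed

text \<open>The bulge k is a free parameter because \<open>arc_pt_limit\<close> uses arcs slightly
  thicker than \<kappa>, and h may have either sign because a digon bulges to both sides of its
  chord.\<close>

lemma arc_in_disk:
  assumes "0 \<le> t" "t \<le> 1" "\<bar>h\<bar> \<le> k * (t * (1 - t))" "0 \<le> k" "4 * k \<le> len"
  shows "cmod (pt (Complex t h)) \<le> 1"
proof -
  define \<tau> where "\<tau> = t * (1 - t)"
  have \<tau>: "0 \<le> \<tau>" "\<tau> \<le> 1"
    using assms mult_le_one[of t "1 - t"] by (auto simp: \<tau>_def)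
  have h1: "\<bar>h\<bar> \<le> k * \<tau>" using assms by (simp add: \<tau>_def)
  have "2 * len * h * cos half \<le> 2 * len * (k * \<tau>)"
  proof -
    have "h * cos half \<le> \<bar>h\<bar> * 1"
      by (metis abs_cos_le_one abs_ge_self abs_ge_zero abs_mult mult_left_mono order_trans)
    then show ?thesis using h1 len_pos by (simp add: mult.assoc)
  qed
  moreover have "h\<^sup>2 \<le> (k * \<tau>)\<^sup>2" using h1 by (simp add: abs_le_square_iff[symmetric])
  then have "len\<^sup>2 * h\<^sup>2 \<le> len\<^sup>2 * (k * \<tau>)\<^sup>2"
    by (intro mult_left_mono) auto
  moreover have "2 * len * (k * \<tau>) + len\<^sup>2 * (k * \<tau>)\<^sup>2 \<le> len\<^sup>2 * \<tau>"
  proof -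
    have k1: "k \<le> 1/2" using assms len_le by linarith
    have "len * (k * (k * \<tau>)) \<le> 2 * (k * (1/2 * 1))"
      using k1 len_le len_pos \<tau> assms by (intro mult_mono) auto
    then have "2 * k + len * (k * (k * \<tau>)) \<le> len" using assms by linarith
    then have "(len * \<tau>) * (2 * k + len * (k * (k * \<tau>))) \<le> (len * \<tau>) * len"
      using len_pos \<tau> by (intro mult_left_mono) auto
    then show ?thesis by (simp add: power2_eq_square algebra_simps)
  qed
  ultimately have "(cmod (pt (Complex t h)))\<^sup>2 \<le> 1"
    by (simp add: norm_pt \<tau>_def)
  then show ?thesis by (simp add: power_le_one_iff abs_square_le_1)
qed

lemma arc_pt_right: "0 \<le> t \<Longrightarrow> t \<le> 1 \<Longrightarrow> arc_pt t \<in> right"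
  using arc_in_disk[of t "\<kappa> * (t * (1 - t))" \<kappa>] k0 k_len
  by (auto simp: arc_pt_def mem_right)

lemma arc_pt_limit:
  assumes t: "0 \<le> t" "t \<le> 1"
  shows "arc_pt t \<in> closure (cball 0 1 - right)"
proof -
  \<comment> \<open>The point is approached along thicker arcs of bulge \<kappa> + e. All arcs meet
    at the endpoints of the chord, so \<open>s e\<close> also pulls the parameter towards 1/2;
    \<open>E\<close> keeps the thicker arcs inside the disk.\<close>
  define s where "s = (\<lambda>e::real. (1 - e) * t + e / 2)"
  define f where "f = (\<lambda>e. pt (Complex (s e) ((\<kappa> + e) * (s e * (1 - s e)))))"
  define E where "E = min 1 (len / 4 - \<kappa>)"
  have E: "E > 0" using k_len by (simp add: E_def)
  have f: "f e \<in> cball 0 1 - right" if e: "0 < e" "e < E" for e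
  proof -
    have 0: "0 < s e" "s e < 1"
    proof -
      have "0 \<le> (1 - e) * t" "(1 - e) * t \<le> 1 - e"
        using e t by (auto simp: E_def mult_left_le)
      then show "0 < s e" "s e < 1" using e by (auto simp: s_def)
    qed
    have "0 < e * (s e * (1 - s e))" using e 0 by simp
    then have 1: "(\<kappa> + e) * (s e * (1 - s e)) > \<kappa> * (s e * (1 - s e))"
      by (simp add: algebra_simps)
    have "cmod (f e) \<le> 1"
      unfolding f_def using 0 e k0 by (intro arc_in_disk[where k = "\<kappa> + e"]) (auto simp: E_def)
    then show ?thesis
      using 1 by (auto simp: f_def mem_right)
  qed
  have "(f \<longlongrightarrow> f 0) (at_right 0)"
    unfolding f_def s_def pt_def Complex_eq by (intro tendsto_eq_intros refl) auto
  moreover have "eventually (\<lambda>e. f e \<in> closure (cball 0 1 - right)) (at_right 0)"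
    using eventually_at_right_real[OF E]
    by eventually_elim (use f closure_subset in force)
  ultimately have "f 0 \<in> closure (cball 0 1 - right)"
    by (intro Lim_in_closed_set[where F = "at_right (0::real)"]) auto
  then show ?thesis
    by (simp add: f_def s_def arc_pt_def)
qed

end

section \<open>Estimates for the thickness of digons and loops\<close>

lemma thinness_bounds: assumes "n \<ge> 1" shows "0 < thinness n" "thinness n \<le> 1/4"
proof -
  show "0 < thinness n" by (simp add: thinness_def)
  have "2 * 2 \<le> (real n + 1) * (real n + 1)" using assms by (intro mult_mono) auto
  then show "thinness n \<le> 1/4" by (simp add: thinness_def power2_eq_square divide_simps)
qed

text \<open>Concavity of sine on [0, pi]; this is Jordan's inequality.\<close>

lemma sin_ge_chord: assumes "0 \<le> t" "t \<le> pi / 2" shows "2 * t / pi \<le> sin t"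
proof -
  have "concave_on {0..pi} sin"
  proof -
    have "convex_on {0..pi} (\<lambda>x. - sin x)"
      by (rule f''_ge0_imp_convex[where f' = "\<lambda>x. - cos x" and f'' = sin])
        (auto intro!: derivative_eq_intros sin_ge_zero)
    then show ?thesis by (simp add: concave_on_def)
  qed
  then have "sin ((1 - 2 * t / pi) *\<^sub>R 0 + (2 * t / pi) *\<^sub>R (pi / 2)) \<ge> (1 - 2 * t / pi) * sin 0 + (2 * t / pi) * sin (pi / 2)"
    using assms by (intro concave_onD) (auto simp: field_simps)
  then show ?thesis by simp
qed

lemma sin_ge_between:
  assumes "0 \<le> e" "e \<le> t" "t \<le> pi - e" shows "sin e \<le> sin t"
proof (cases "t \<le> pi / 2")
  case True
  then show ?thesis using assms by (intro sin_monotone_2pi_le) auto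
next
  case False
  have "sin e \<le> sin (pi - t)"
    using False assms by (intro sin_monotone_2pi_le) auto
  then show ?thesis by simp
qed

lemma thinness_less_sin:
  assumes "n \<ge> 2" "1 \<le> g" "g \<le> real n - 1"
  shows "4 * thinness n < 2 * sin (pi * g / n)"
proof -
  have "2 * (pi * (1 / n)) / pi \<le> sin (pi * (1 / n))"
    using assms by (intro sin_ge_chord) (auto simp: field_simps)
  moreover have "pi * (1 / n) \<le> pi * g / n" "pi * g / n \<le> pi * (real n - 1) / n"
    using assms by (auto intro!: divide_right_mono)
  moreover have "pi * (real n - 1) / n = pi - pi * (1 / n)" "0 \<le> pi * (1 / n)"
    using assms by (auto simp: field_simps)
  ultimately have "2 * (pi * (1 / n)) / pi \<le> sin (pi * g / n)"
    using sin_ge_between[of "pi * (1 / n)" "pi * g / n"] by linarith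
  then have 1: "2 / n \<le> sin (pi * g / n)"
    by simp
  have "4 * thinness n < 4 / n"
    using assms by (simp add: thinness_def divide_simps power2_eq_square) (simp add: algebra_simps add_pos_nonneg)
  then show ?thesis using 1 by simp
qed

text \<open>With e half of pi / n the difference is 2 * sin (\<phi> + e) * sin e, hence at least 2 *
  (sin e)^2, and sin e is at least 1 / n. This is the estimate that requires a thickness quadratic
  in 1 / n.\<close>

lemma cos_gap:
  assumes n: "n \<ge> 1" and p: "0 \<le> \<phi>" "\<phi> \<le> pi - pi / n"
  shows "2 * thinness n < cos \<phi> - cos (\<phi> + pi / n)"
proof -
  define e where "e = pi / (2 * n)"
  have e: "0 < e" "e \<le> pi / 2" "\<phi> + 2 * e \<le> pi"
    using n p by (auto simp: e_def field_simps)
  have 1: "sin e \<le> sin (\<phi> + e)"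
    using p e by (intro sin_ge_between) auto
  have "2 * e / pi \<le> sin e"
    using e by (intro sin_ge_chord) auto
  then have 2: "1 / n \<le> sin e"
    by (simp add: e_def)
  have "(1 / n) * (1 / n) \<le> sin (\<phi> + e) * sin e"
    using 1 2 by (intro mult_mono) (auto intro: order_trans[of 0 "1 / real n"])
  moreover have "thinness n < (1 / n) * (1 / n)"
    using n by (simp add: thinness_def power2_eq_square divide_simps) (simp add: algebra_simps)
  moreover have "cos \<phi> - cos (\<phi> + pi / n) = 2 * (sin (\<phi> + e) * sin e)"
  proof -
    have "\<phi> + pi / n = (\<phi> + e) + e" "\<phi> = (\<phi> + e) - e"
      using n by (auto simp: e_def field_simps)
    then have "cos (\<phi> + pi / n) = cos ((\<phi> + e) + e)" "cos \<phi> = cos ((\<phi> + e) - e)"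
      by metis+
    then show ?thesis
      unfolding cos_add[of "\<phi> + e" e] cos_diff[of "\<phi> + e" e] by simp
  qed
  ultimately show ?thesis by linarith
qed

text \<open>Lengthening both ends of an arc by half a step moves the chord of the cap by more than the
  thickness of digons and loops.\<close>

lemma cap_height_widen:
  assumes n: "n \<ge> 1" and xy: "x + 1 \<le> y" "y \<le> x + n"
    and z: "cap_height n y (x + n) z \<ge> - 2 * thinness n"
  shows "cap_height n (y - 1/2) (x + n + 1/2) z > 0"
proof -
  define \<phi> where "\<phi> = pi * (x + n - y) / n"
  have 1: "(y - 1/2 + (x + n + 1/2)) / 2 = (y + (x + n)) / 2"
    by (simp add: field_simps)
  have 2: "pi * (x + n + 1/2 - (y - 1/2)) / n = \<phi> + pi / n"
    using n by (simp add: \<phi>_def field_simps)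
  have "pi * (x + n - y) \<le> pi * (n - 1)"
    using xy by (intro mult_left_mono) auto
  then have "\<phi> \<le> pi * (n - 1) / n"
    using n by (simp add: \<phi>_def divide_right_mono)
  also have "\<dots> = pi - pi / n"
    using n by (simp add: field_simps)
  finally have "2 * thinness n < cos \<phi> - cos (\<phi> + pi / n)"
    using xy n by (intro cos_gap) (auto simp: \<phi>_def)
  then show ?thesis
    using z unfolding cap_height_def 1 2 \<phi>_def by linarith
qed

context chord
begin

lemma right_widen:
  assumes "x + 1 \<le> y" "z \<in> right"
  shows "cap_height n (y - 1/2) (x + n + 1/2) z > 0"
proof (rule cap_height_widen[OF n assms(1)])
  show "y \<le> x + n" using xy by simp
  obtain \<zeta> where \<zeta>: "z = pt \<zeta>" by (rule pt_surj)
  have "Im \<zeta> \<le> \<kappa> * (Re \<zeta> * (1 - Re \<zeta>))"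
    using assms by (simp add: \<zeta> mem_right)
  also have "Re \<zeta> * (1 - Re \<zeta>) \<le> 1/4"
  proof -
    have "0 \<le> (Re \<zeta> - 1/2)\<^sup>2" by simp
    then show ?thesis by (simp add: power2_eq_square algebra_simps)
  qed
  then have "\<kappa> * (Re \<zeta> * (1 - Re \<zeta>)) \<le> thinness n * 1"
  proof (cases "Re \<zeta> * (1 - Re \<zeta>) \<ge> 0")
    case True
    then show ?thesis
      using \<open>Re \<zeta> * (1 - Re \<zeta>) \<le> 1/4\<close> k_le k0 by (intro mult_mono) auto
  next
    case False
    then have "\<kappa> * (Re \<zeta> * (1 - Re \<zeta>)) \<le> 0" using k0 by (simp add: mult_nonneg_nonpos)
    then show ?thesis using k0 k_le by linarith
  qed
  finally have "len * Im \<zeta> \<le> len * thinness n"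
    using len_pos by simp
  also have "\<dots> \<le> 2 * thinness n"
    using len_le by (intro mult_right_mono) (auto simp: thinness_def)
  finally show "- 2 * thinness n \<le> cap_height n y (x + n) z"
    unfolding cap_height_opposite[OF n] by (simp add: \<zeta> cap_height_pt)
qed

end

section \<open>The disks of one-point blocks\<close>

lemma loop_disk_norm:
  assumes n: "n \<ge> 1" and z: "z \<in> cball (of_real (1 - thinness n) * circ n x) (thinness n)"
  shows "cmod z \<le> 1"
proof -
  have "cmod z \<le> cmod (of_real (1 - thinness n) * circ n x) + cmod (z - of_real (1 - thinness n) * circ n x)"
    using norm_triangle_ineq[of "of_real (1 - thinness n) * circ n x" "z - of_real (1 - thinness n) * circ n x"] by simp
  also have "cmod (of_real (1 - thinness n) * circ n x) = 1 - thinness n"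
    using thinness_bounds[OF n] by (simp only: norm_mult norm_of_real norm_circ) simp
  finally show ?thesis
    using z by (simp add: dist_norm norm_minus_commute)
qed

lemma loop_disk_sphere:
  assumes n: "n \<ge> 1" and "cmod z = 1"
  shows "z \<in> cball (of_real (1 - thinness n) * circ n x) (thinness n) \<longleftrightarrow> z = circ n x"
proof
  define \<delta> where "\<delta> = thinness n"
  have \<delta>: "0 < \<delta>" "\<delta> \<le> 1/4" using thinness_bounds[OF n] by (auto simp: \<delta>_def)
  assume "z \<in> cball (of_real (1 - thinness n) * circ n x) (thinness n)"
  then have "cmod (z + of_real (\<delta> - 1) * circ n x) \<le> \<delta>"
    by (simp add: dist_norm norm_minus_commute \<delta>_def algebra_simps)
  then have "(cmod (z + of_real (\<delta> - 1) * circ n x))\<^sup>2 \<le> \<delta>\<^sup>2"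
    by (intro power_mono) auto
  moreover have "(cmod (z + of_real (\<delta> - 1) * circ n x))\<^sup>2 = 1 + (\<delta> - 1)\<^sup>2 + 2 * (\<delta> - 1) * Re (z * cnj (circ n x))"
    unfolding cmod_add_sq using assms(2) by (simp only: norm_mult norm_of_real norm_circ) (simp add: algebra_simps)
  ultimately have "2 * (1 - \<delta>) * (1 - Re (z * cnj (circ n x))) \<le> 0"
    by (simp add: power2_eq_square algebra_simps)
  then have "1 \<le> Re (z * cnj (circ n x))"
    using \<delta> by (simp add: mult_le_0_iff)
  moreover have "(cmod (z + - circ n x))\<^sup>2 = 2 - 2 * Re (z * cnj (circ n x))"
    unfolding cmod_add_sq using assms(2) by simp
  ultimately have "(cmod (z + - circ n x))\<^sup>2 \<le> 0" by linarith
  then show "z = circ n x" by simp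
next
  assume "z = circ n x"
  moreover have "dist (of_real (1 - thinness n) * circ n x) (circ n x) = cmod (of_real (- thinness n) * circ n x)"
    by (simp add: dist_norm algebra_simps)
  ultimately show "z \<in> cball (of_real (1 - thinness n) * circ n x) (thinness n)"
    using thinness_bounds[OF n] by (simp add: norm_mult)
qed

text \<open>The loop lies below the degenerate cap from x + n to x + n, whose chord is the tangent
  at \<open>circ n x\<close>. Its diameter 2 * \<open>thinness n\<close> is exactly the depth that
  \<open>cap_height_widen\<close> admits.\<close>

lemma loop_disk_widen:
  assumes n: "n \<ge> 1" and z: "z \<in> cball (of_real (1 - thinness n) * circ n x) (thinness n)"
  shows "cap_height n (x + n - 1/2) (x + n + 1/2) z > 0"
proof (rule cap_height_widen[OF n])
  define \<delta> where "\<delta> = thinness n"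
  define w where "w = of_real (1 - \<delta>) * circ n x - z"
  have c: "(x + n + (x + n)) / 2 = x + n" by simp
  have one: "circ n x * cnj (circ n x) = 1"
    by (simp add: complex_norm_square[symmetric])
  have "Re (w * cnj (circ n x)) \<le> cmod (w * cnj (circ n x))"
    by (rule complex_Re_le_cmod)
  also have "\<dots> \<le> \<delta>"
    using z by (simp add: norm_mult w_def dist_norm \<delta>_def)
  also have "w * cnj (circ n x) = of_real (1 - \<delta>) * (circ n x * cnj (circ n x)) - z * cnj (circ n x)"
    by (simp add: w_def algebra_simps)
  finally have "1 - 2 * \<delta> \<le> Re (z * cnj (circ n x))"
    unfolding one by simp
  then show "- 2 * thinness n \<le> cap_height n (x + n) (x + n) z"
    unfolding cap_height_def c circ_add_n[OF n] by (simp add: \<delta>_def)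
qed (use n in auto)

text \<open>The point of tangency is a limit along the circle itself. Every other point of the loop
  is in the open disk, where it suffices that it is on the frontier of the closed ball.\<close>

lemma loop_limit:
  assumes n: "n \<ge> 1" and s: "s \<in> sphere (of_real (1 - thinness n) * circ n x) (thinness n)"
  shows "s \<in> closure (cball 0 1 - cball (of_real (1 - thinness n) * circ n x) (thinness n))"
    (is "_ \<in> closure (_ - ?D)")
proof (cases "s = circ n x")
  case True
  have "(circ n \<longlongrightarrow> circ n x) (at_right x)"
    using continuous_on_circ[of UNIV n]
    by (auto simp: continuous_on_def intro: tendsto_within_subset)
  moreover have "eventually (\<lambda>v. circ n v \<in> closure (cball 0 1 - ?D)) (at_right x)"
  proof -
    have "x < x + n" using n by simp
    then show ?thesis
    proof (rule eventually_mono[OF eventually_at_right_real])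
      fix v assume v: "v \<in> {x<..<x + n}"
      then have "circ n v \<noteq> circ n x"
        using circ_inj[OF n, of x v x] by auto
      then have "circ n v \<in> cball 0 1 - ?D"
        using loop_disk_sphere[OF n, of "circ n v" x] by simp
      then show "circ n v \<in> closure (cball 0 1 - ?D)"
        by (rule subsetD[OF closure_subset])
    qed
  qed
  ultimately show ?thesis
    unfolding True by (intro Lim_in_closed_set[where F = "at_right x"]) auto
next
  case False
  have sD: "s \<in> ?D" using s by simp
  have "cmod s < 1"
    using loop_disk_norm[OF n sD] loop_disk_sphere[OF n, of s x] sD False by force
  moreover have "s \<in> closure (- ?D)" using s by (simp add: closure_complement)
  ultimately have "s \<in> closure (ball 0 1 \<inter> - ?D)"
    using open_Int_closure_subset[OF open_ball, of 0 1 "- ?D"] by auto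
  moreover have "ball 0 1 \<inter> - ?D \<subseteq> cball 0 1 - ?D" by auto
  ultimately show ?thesis by (meson closure_mono subsetD)
qed

section \<open>Gaps of blocks\<close>

text \<open>Nothing is known of f outside S. Replacing it there by the identity gives a permutation
  with the same orbits inside S.\<close>

lemma self_in_orbit:
  assumes "finite S" "inj_on f S" "f ` S \<subseteq> S" "s \<in> S"
  shows "s \<in> orbit f s"
proof -
  define g where "g = (\<lambda>x. if x \<in> S then f x else x)"
  have "bij_betw g S S"
  proof -
    have "inj_on g S" using assms(2) by (simp add: g_def inj_on_def)
    moreover have "g ` S \<subseteq> S" using assms(3) by (auto simp: g_def)
    ultimately show ?thesis using assms(1) by (simp add: bij_betw_def endo_inj_surj)
  qed
  then have "g permutes S"
    by (rule bij_imp_permutes) (simp add: g_def)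
  then have "s \<in> orbit g s"
    using assms(1) by (intro permutation_self_in_orbit) (auto simp: permutation_permutes)
  moreover have "orbit g s \<subseteq> orbit f s"
  proof
    fix y assume "y \<in> orbit g s"
    then have "y \<in> orbit f s \<and> y \<in> S"
    proof induction
      case base
      then show ?case using assms(3,4) by (auto simp: g_def intro: orbit.base)
    next
      case (step y)
      then show ?case using assms(3) by (auto simp: g_def intro: orbit.step)
    qed
    then show "y \<in> orbit f s" by simp
  qed
  ultimately show ?thesis by blast
qed

lemma orbit_subset_closed:
  assumes "f ` S \<subseteq> S" "s \<in> S"
  shows "orbit f s \<subseteq> S"
proof
  fix y assume "y \<in> orbit f s"
  then show "y \<in> S" by induction (use assms in auto)
qed

text \<open>Moving up without overshooting reaches every larger element. A smaller y is reached as
  well: y reaches s and itself, so its cycle passes through s and returns.\<close>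

lemma cyclic_on_nat_setI:
  fixes S :: "nat set"
  assumes "finite S" "S \<noteq> {}" "inj_on f S" "f ` S \<subseteq> S"
    and step: "\<And>i j. i \<in> S \<Longrightarrow> j \<in> S \<Longrightarrow> i < j \<Longrightarrow> i < f i \<and> f i \<le> j"
  shows "cyclic_on f S"
proof -
  have up: "j \<in> orbit f i" if "i \<in> S" "j \<in> S" "i < j" for i j
    using that
  proof (induction "j - i" arbitrary: i rule: less_induct)
    case less
    note st = step[OF less.prems]
    have "f i \<in> S" using less.prems assms(4) by blast
    then have "j \<in> orbit f (f i)" if "f i \<noteq> j"
      using less.hyps[of "f i"] st that less.prems by auto
    then show ?case using orbit.base[of f i] orbit_subset[of j f i] by auto
  qed
  obtain s where s: "s \<in> S" using assms(2) by auto
  have self: "x \<in> orbit f x" if "x \<in> S" for x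
    using self_in_orbit[OF assms(1,3,4) that] .
  have "y \<in> orbit f s" if y: "y \<in> S" for y
  proof (cases s y rule: linorder_cases)
    case greater
    then have "s \<in> orbit f y" using up y s by blast
    then show ?thesis using orbit_swap[OF self[OF y]] by blast
  qed (use self up y s in auto)
  then have "S = orbit f s"
    using orbit_subset_closed[OF assms(4) s] by blast
  then show ?thesis using s by (auto simp: cyclic_on_def)
qed

section \<open>The cyclic successor within a block and the gaps of a block\<close>

lemma cyc_next_in:
  assumes "finite B" "i \<in> B" shows "cyc_next B i \<in> B"
proof (cases "\<exists>j\<in>B. i < j")
  case True
  then have "Min {j \<in> B. i < j} \<in> {j \<in> B. i < j}"
    using assms by (intro Min_in) auto
  then show ?thesis using True by (simp add: cyc_next_def)
next
  case False
  then show ?thesis using assms by (auto simp: cyc_next_def intro: Min_in)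
qed

lemma cyc_next_upper:
  assumes "finite B" "b \<in> B" "i < b" shows "i < cyc_next B i" "cyc_next B i \<le> b"
proof -
  have "Min {j \<in> B. i < j} \<in> {j \<in> B. i < j}"
    using assms by (intro Min_in) auto
  moreover have "Min {j \<in> B. i < j} \<le> b"
    using assms by (intro Min_le) auto
  ultimately show "i < cyc_next B i" "cyc_next B i \<le> b"
    using assms by (auto simp: cyc_next_def)
qed

lemma cyc_next_lower:
  assumes "finite B" "i \<in> B" "b \<in> B" "cyc_next B i \<le> i" shows "cyc_next B i \<le> b" "b \<le> i"
proof -
  show "b \<le> i" using cyc_next_upper(1)[OF assms(1,3), of i] assms(4) by linarith
  have "\<not> (\<exists>j\<in>B. i < j)"
    using cyc_next_upper(1)[OF assms(1), of _ i] assms(4) by fastforce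
  then show "cyc_next B i \<le> b"
    using assms by (simp add: cyc_next_def)
qed

lemma inj_on_cyc_next:
  assumes "finite B" shows "inj_on (cyc_next B) B"
proof -
  have "cyc_next B i \<noteq> cyc_next B j" if "i \<in> B" "j \<in> B" "i < j" for i j
  proof (cases "cyc_next B j \<le> j")
    case True
    then show ?thesis
      using cyc_next_lower(1)[OF assms, of j i] cyc_next_upper[OF assms, of j i] that by linarith
  next
    case False
    then show ?thesis
      using cyc_next_upper[OF assms, of j i] that by linarith
  qed
  then show ?thesis
    by (metis inj_on_def linorder_neqE_nat)
qed

lemma cyclic_on_cyc_next:
  assumes "finite B" "B \<noteq> {}" shows "cyclic_on (cyc_next B) B"
proof (rule cyclic_on_nat_setI[OF assms inj_on_cyc_next[OF assms(1)]])
  show "cyc_next B ` B \<subseteq> B" using cyc_next_in[OF assms(1)] by auto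
qed (use cyc_next_upper[OF assms(1)] in blast)

text \<open>The end of the gap of \<open>B\<close> following \<open>i\<close>, unrolled to lie in \<open>{i<..i + n}\<close>.\<close>

definition gap_end :: "nat \<Rightarrow> nat set \<Rightarrow> nat \<Rightarrow> nat" where
  "gap_end n B i = (if i < cyc_next B i then cyc_next B i else cyc_next B i + n)"

lemma gap_end_bounds:
  assumes "B \<subseteq> {1..n}" "i \<in> B" shows "i < gap_end n B i" "gap_end n B i \<le> i + n"
proof -
  have "finite B" using assms(1) finite_subset by blast
  then have "cyc_next B i \<in> {1..n}" using assms cyc_next_in by blast
  then show "i < gap_end n B i" "gap_end n B i \<le> i + n"
    using assms by (auto simp: gap_end_def)
qed

lemma gap_end_le:
  assumes "B \<subseteq> {1..n}" "i \<in> B" "b \<in> B"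
  shows "i < b \<Longrightarrow> gap_end n B i \<le> b" "gap_end n B i \<le> b + n"
proof -
  have f: "finite B" using assms(1) finite_subset by blast
  show "i < b \<Longrightarrow> gap_end n B i \<le> b"
    using cyc_next_upper[OF f assms(3)] by (auto simp: gap_end_def)
  have "cyc_next B i \<in> {1..n}" using assms cyc_next_in f by blast
  then show "gap_end n B i \<le> b + n"
    using cyc_next_lower(1)[OF f assms(2,3)] by (auto simp: gap_end_def)
qed

lemma gap_end_single: assumes "B \<subseteq> {1..n}" "i \<in> B" shows "gap_end n B i = i + n \<longleftrightarrow> card B = 1"
proof
  have f: "finite B" using assms(1) finite_subset by blast
  assume g: "gap_end n B i = i + n"
  then have "cyc_next B i = i"
    using cyc_next_in[OF f assms(2)] assms subsetD[OF assms(1), of "i + n"]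
    by (auto simp: gap_end_def split: if_splits)
  then have "B \<subseteq> {i}"
    using cyc_next_lower[OF f assms(2)] by fastforce
  then have "B = {i}" using assms by blast
  then show "card B = 1" by simp
next
  assume "card B = 1"
  then have "B = {i}" using assms(2) by (auto simp: card_1_singleton_iff)
  then show "gap_end n B i = i + n"
    by (simp add: gap_end_def cyc_next_def)
qed

lemma rot_in: "n \<ge> 1 \<Longrightarrow> rot n i \<in> {1..n}"
  by (auto simp: rot_def Suc_le_eq)

lemma rot_eq: "i \<in> {1..n} \<Longrightarrow> rot n i = (if i = n then 1 else i + 1)"
  by (auto simp: rot_def)

lemma inj_on_rot: "inj_on (rot n) {1..n}"
  by (auto simp: inj_on_def rot_eq split: if_splits)

section \<open>Combinatorics of a noncrossing partition and its Kreweras complement\<close>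

locale nc_partition =
  fixes n :: nat and \<pi> :: "nat set set"
  assumes n: "n \<ge> 1" and part: "partition_on {1..n} \<pi>" and nc: "noncrossing \<pi>"
begin

abbreviation blk :: "nat \<Rightarrow> nat set" where "blk \<equiv> block_of \<pi>"
abbreviation nxt :: "nat \<Rightarrow> nat" where "nxt \<equiv> side_end \<pi>"

definition ge :: "nat \<Rightarrow> nat" where "ge i = gap_end n (blk i) i"

lemma block_sub: "A \<in> \<pi> \<Longrightarrow> A \<subseteq> {1..n}"
  using part by (auto simp: partition_on_def)

lemma block_fin: "A \<in> \<pi> \<Longrightarrow> finite A"
  using block_sub finite_subset by blast

lemma block_ne: "A \<in> \<pi> \<Longrightarrow> A \<noteq> {}"
  using part by (auto simp: partition_on_def)

lemma block_disj: "A \<in> \<pi> \<Longrightarrow> B \<in> \<pi> \<Longrightarrow> x \<in> A \<Longrightarrow> x \<in> B \<Longrightarrow> A = B"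
  using part by (auto simp: partition_on_def disjoint_def)

lemma blk_eq: "A \<in> \<pi> \<Longrightarrow> i \<in> A \<Longrightarrow> blk i = A"
  unfolding block_of_def by (rule the_equality) (auto dest: block_disj)

lemma blk: assumes "i \<in> {1..n}" shows "blk i \<in> \<pi>" "i \<in> blk i"
proof -
  have "i \<in> \<Union> \<pi>" using part assms by (simp add: partition_on_def)
  then obtain A where "A \<in> \<pi>" "i \<in> A" by blast
  then show "blk i \<in> \<pi>" "i \<in> blk i" by (auto simp: blk_eq)
qed

lemma crossing:
  "A \<in> \<pi> \<Longrightarrow> B \<in> \<pi> \<Longrightarrow> A \<noteq> B \<Longrightarrow> a < b \<Longrightarrow> b < c \<Longrightarrow> c < d \<Longrightarrow> a \<in> A \<Longrightarrow> c \<in> A \<Longrightarrow> b \<in> B \<Longrightarrow> d \<in> B \<Longrightarrow> False"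
  using nc unfolding noncrossing_def by blast

lemma nxt_cyc: "A \<in> \<pi> \<Longrightarrow> i \<in> A \<Longrightarrow> nxt i = cyc_next A i"
  by (simp add: side_end_def blk_eq)

lemma nxt_in: "A \<in> \<pi> \<Longrightarrow> i \<in> A \<Longrightarrow> nxt i \<in> A"
  by (simp add: nxt_cyc cyc_next_in block_fin)

lemma nxt_range: "i \<in> {1..n} \<Longrightarrow> nxt i \<in> {1..n}"
  using nxt_in[OF blk] block_sub[OF blk(1)] by blast

lemma nxt_upper: "A \<in> \<pi> \<Longrightarrow> i \<in> A \<Longrightarrow> b \<in> A \<Longrightarrow> i < b \<Longrightarrow> i < nxt i \<and> nxt i \<le> b"
  using cyc_next_upper[of A b i] by (simp add: nxt_cyc block_fin)

lemma nxt_lower: "A \<in> \<pi> \<Longrightarrow> i \<in> A \<Longrightarrow> b \<in> A \<Longrightarrow> nxt i \<le> i \<Longrightarrow> nxt i \<le> b \<and> b \<le> i"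
  using cyc_next_lower[of A i b] by (simp add: nxt_cyc block_fin)

lemma ge_eq: "ge i = (if i < nxt i then nxt i else nxt i + n)"
  by (simp add: ge_def gap_end_def side_end_def)

lemma ge_gap_end: "A \<in> \<pi> \<Longrightarrow> i \<in> A \<Longrightarrow> ge i = gap_end n A i"
  by (simp add: ge_def blk_eq)

lemma ge_bounds: "i \<in> {1..n} \<Longrightarrow> i < ge i \<and> ge i \<le> i + n"
  using gap_end_bounds[OF block_sub[OF blk(1)] blk(2)] by (simp add: ge_def)

lemma ge_le:
  assumes "A \<in> \<pi>" "i \<in> A" "b \<in> A" shows "i < b \<Longrightarrow> ge i \<le> b" "ge i \<le> b + n"
  using gap_end_le[OF block_sub[OF assms(1)] assms(2,3)] assms by (auto simp: ge_gap_end)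

lemma inj_on_nxt: "inj_on nxt {1..n}"
proof (rule inj_onI)
  fix i j assume ij: "i \<in> {1..n}" "j \<in> {1..n}" and eq: "nxt i = nxt j"
  have "blk i = blk j"
    using nxt_in[OF blk[OF ij(1)]] nxt_in[OF blk[OF ij(2)]] blk ij eq by (metis block_disj)
  then show "i = j"
    using inj_onD[OF inj_on_cyc_next[OF block_fin[OF blk(1)[OF ij(1)]]], of i j] eq
      blk(2)[OF ij(1)] blk(2)[OF ij(2)]
    by (simp add: side_end_def)
qed

lemma bij_nxt: "bij_betw nxt {1..n} {1..n}"
proof -
  have "nxt ` {1..n} \<subseteq> {1..n}" using nxt_range by blast
  then show ?thesis
    using inj_on_nxt by (simp add: bij_betw_def endo_inj_surj)
qed

lemma cyclic_on_nxt: "A \<in> \<pi> \<Longrightarrow> cyclic_on nxt A"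
  using cyclic_on_cyc_next[OF block_fin block_ne] cyclic_cong[of A "nxt" "cyc_next A"] by (simp add: nxt_cyc)

definition wht :: "nat \<Rightarrow> nat" where
  "wht i = (THE j. j \<in> {1..n} \<and> nxt j = rot n i)"

lemma wht_props: "wht i \<in> {1..n} \<and> nxt (wht i) = rot n i"
proof -
  have "rot n i \<in> nxt ` {1..n}"
    using bij_betw_imp_surj_on[OF bij_nxt] rot_in[OF n, of i] by blast
  then obtain j where j: "j \<in> {1..n}" "nxt j = rot n i" by (metis imageE)
  have "\<exists>!j. j \<in> {1..n} \<and> nxt j = rot n i"
  proof (rule ex1I[of _ j])
    fix k assume "k \<in> {1..n} \<and> nxt k = rot n i"
    then show "k = j" using inj_onD[OF inj_on_nxt, of k j] j by simp
  qed (use j in simp)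
  then show ?thesis unfolding wht_def by (rule theI')
qed

lemma inj_on_wht: "inj_on wht {1..n}"
  using wht_props inj_on_rot by (metis inj_on_def)

text \<open>The arcs following \<open>i\<close> and \<open>j\<close> border the same white region: no block has points on both of
  the two arcs into which they split the circle.\<close>

definition weq :: "nat \<Rightarrow> nat \<Rightarrow> bool" where
  "weq i j \<longleftrightarrow> (\<forall>A\<in>\<pi>. \<forall>x\<in>A. \<forall>y\<in>A. ((x \<le> i) = (x \<le> j)) = ((y \<le> i) = (y \<le> j)))"

lemma weq_refl: "weq i i" by (simp add: weq_def)

lemma weq_sym: "weq i j \<Longrightarrow> weq j i" unfolding weq_def by blast

lemma weqE: "weq i j \<Longrightarrow> A \<in> \<pi> \<Longrightarrow> x \<in> A \<Longrightarrow> y \<in> A \<Longrightarrow> ((x \<le> i) = (x \<le> j)) = ((y \<le> i) = (y \<le> j))"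
  by (erule weq_def[THEN iffD1, THEN bspec, THEN bspec, THEN bspec])

lemma weq_trans: assumes "weq i j" "weq j k" shows "weq i k"
  unfolding weq_def
proof (intro ballI)
  fix A x y assume "A \<in> \<pi>" "x \<in> A" "y \<in> A"
  then show "((x \<le> i) = (x \<le> k)) = ((y \<le> i) = (y \<le> k))"
    using weqE[OF assms(1), of A x y] weqE[OF assms(2), of A x y] by (cases "x \<le> i"; cases "x \<le> j"; cases "x \<le> k"; simp)
qed

lemma weqD: "weq i j \<Longrightarrow> A \<in> \<pi> \<Longrightarrow> x \<in> A \<Longrightarrow> y \<in> A \<Longrightarrow> i < x \<Longrightarrow> x \<le> j \<Longrightarrow> i < y \<and> y \<le> j"
  using weqE[of i j A x y] by auto

text \<open>For i \<le> j the truth values of x \<le> i and x \<le> j differ exactly on {i<..j}, so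
  the relation says that this interval is a union of blocks. The symmetric form in the definition
  makes symmetry and transitivity purely propositional.\<close>

lemma weqI:
  assumes "i \<le> j" "\<And>A x y. A \<in> \<pi> \<Longrightarrow> x \<in> A \<Longrightarrow> y \<in> A \<Longrightarrow> i < x \<Longrightarrow> x \<le> j \<Longrightarrow> i < y \<and> y \<le> j"
  shows "weq i j"
proof -
  have *: "(x \<le> i) = (x \<le> j) \<longleftrightarrow> \<not> (i < x \<and> x \<le> j)" for x using assms(1) by auto
  show ?thesis unfolding weq_def *
  proof (intro ballI)
    fix A x y assume "A \<in> \<pi>" "x \<in> A" "y \<in> A"
    then show "(\<not> (i < x \<and> x \<le> j)) = (\<not> (i < y \<and> y \<le> j))"
      using assms(2)[of A x y] assms(2)[of A y x] by blast
  qed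
qed

text \<open>The block of j lies inside {i<..j} and the block of i outside, so the gap after either
  point contains the whole block of the other. The unrolled inequalities are those that
  \<open>F_disjoint\<close> asks for.\<close>

lemma weq_gap:
  assumes ij: "i \<in> {1..n}" "j \<in> {1..n}" "i < j" "weq i j"
  shows "j < ge i" "i + n < ge j"
proof -
  have "i < nxt j \<and> nxt j \<le> j"
    using weqD[OF ij(4) blk(1)[OF ij(2)] blk(2)[OF ij(2)] nxt_in[OF blk[OF ij(2)]]] ij by simp
  then show "i + n < ge j" by (auto simp: ge_eq)
  have "\<not> (i < nxt i \<and> nxt i \<le> j)"
    using weqD[OF ij(4) blk(1)[OF ij(1)] nxt_in[OF blk[OF ij(1)]] blk(2)[OF ij(1)]] by auto
  then show "j < ge i"
    using ij nxt_range[OF ij(1)] by (auto simp: ge_eq)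
qed

text \<open>Take for a the last point of A before B begins and for b the last point of B. The next
  point of A cannot precede b without a crossing, and the gap after b wraps around beyond a.\<close>

lemma blocks_separated_aux:
  assumes A: "A \<in> \<pi>" and B: "B \<in> \<pi>" "A \<noteq> B" and less: "Min A < Min B"
  shows "\<exists>a\<in>A. \<exists>b\<in>B. a < b \<and> b < ge a \<and> a + n < ge b"
proof -
  define m where "m = Min B"
  define b where "b = Max B"
  define a where "a = Max {x \<in> A. x < m}"
  have mB: "m \<in> B" "b \<in> B" "m \<le> b"
    using block_fin[OF B(1)] block_ne[OF B(1)] by (auto simp: m_def b_def)
  have "Min A \<in> {x \<in> A. x < m}"
    using block_fin[OF A] block_ne[OF A] less by (simp add: m_def)
  then have "a \<in> {x \<in> A. x < m}"
    unfolding a_def using block_fin[OF A] by (intro Max_in) auto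
  then have a: "a \<in> A" "a < m" by auto
  have amax: "x \<le> a" if "x \<in> A" "x < m" for x
    unfolding a_def using block_fin[OF A] that by (intro Max_ge) auto
  have "nxt b \<le> b" unfolding b_def
    using nxt_in[OF B(1) mB(2)] block_fin[OF B(1)] by (simp add: b_def)
  moreover have "m \<le> nxt b"
    using nxt_in[OF B(1) mB(2)] block_fin[OF B(1)] by (simp add: m_def)
  ultimately have geb: "a + n < ge b" using a by (auto simp: ge_eq)
  have "b < ge a"
  proof (cases "a < nxt a")
    case True
    have na: "nxt a \<in> A" using nxt_in[OF A a(1)] .
    have "m < nxt a"
      using amax[OF na] True mB(1) block_disj[OF A B(1) na] B(2) by (metis leD linorder_neqE_nat)
    moreover have "nxt a \<noteq> b" using block_disj[OF A B(1) na] B(2) mB by auto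
    moreover have "\<not> nxt a < b"
      using crossing[OF A B(1) B(2) a(2) \<open>m < nxt a\<close> _ a(1) na mB(1,2)] by blast
    ultimately have "b < nxt a" by linarith
    then show ?thesis using True by (simp add: ge_eq)
  next
    case False
    have "b \<le> n" using mB block_sub[OF B(1)] by auto
    moreover have "nxt a \<ge> 1" using nxt_in[OF A a(1)] block_sub[OF A] by auto
    ultimately show ?thesis using False by (simp add: ge_eq)
  qed
  moreover have "a < b" using a mB by simp
  ultimately show ?thesis using a(1) mB(2) geb by blast
qed

lemma blocks_separated:
  assumes A: "A \<in> \<pi>" and B: "B \<in> \<pi>" "A \<noteq> B"
  obtains a b where "a \<in> A" "b \<in> B"
    "(a < b \<and> b < ge a \<and> a + n < ge b) \<or> (b < a \<and> a < ge b \<and> b + n < ge a)"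
proof (cases "Min A" "Min B" rule: linorder_cases)
  case less
  then show ?thesis using blocks_separated_aux[OF assms] that by blast
next
  case greater
  then show ?thesis using blocks_separated_aux[OF B(1) A] B(2) that by blast
next
  case equal
  then have "Min A \<in> A" "Min A \<in> B"
    using block_fin block_ne A B by (metis Min_in)+
  then show ?thesis using block_disj A B by blast
qed

text \<open>The second disjunct concerns the copy of the arc one turn later. This differs from
  \<open>point_in_gap\<close> only at k = a: the arc after a lies in the gap, the point a does not.
  That difference is what makes a a cut edge of the tree.\<close>

definition arc_in_gap :: "nat \<Rightarrow> nat \<Rightarrow> bool" where
  "arc_in_gap a k \<longleftrightarrow> (a \<le> k \<and> k < ge a) \<or> k + n < ge a"

definition point_in_gap :: "nat \<Rightarrow> nat \<Rightarrow> bool" where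
  "point_in_gap a k \<longleftrightarrow> (a < k \<and> k < ge a) \<or> k + n < ge a"

text \<open>The gap is bounded by a and \<open>nxt a\<close>, two points of one block, and no block
  is separated by the arcs i and j.\<close>

lemma arc_in_gap_weq:
  assumes a: "a \<in> {1..n}" and ij: "i \<in> {1..n}" "j \<in> {1..n}" and w: "weq i j"
  shows "arc_in_gap a i \<longleftrightarrow> arc_in_gap a j"
proof -
  have "((a \<le> i) = (a \<le> j)) = ((nxt a \<le> i) = (nxt a \<le> j))"
    by (rule weqE[OF w blk[OF a] nxt_in[OF blk[OF a]]])
  then show ?thesis
    using ij a nxt_range[OF a] unfolding arc_in_gap_def ge_eq by auto
qed

text \<open>A block with points inside and outside the gap would cross the pair a,
  \<open>nxt a\<close>.\<close>

lemma point_in_gap_block: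
  assumes a: "a \<in> {1..n}" and C: "C \<in> \<pi>" "x \<in> C" "y \<in> C" "point_in_gap a x"
  shows "point_in_gap a y"
proof -
  note A = blk[OF a]
  have na: "nxt a \<in> blk a" using nxt_in[OF A] .
  have xy: "x \<in> {1..n}" "y \<in> {1..n}" using block_sub[OF C(1)] C by auto
  have CA: "C \<noteq> blk a"
    using ge_le[OF A(1,2), of x] C unfolding point_in_gap_def by auto
  then have ne: "y \<noteq> a" "y \<noteq> nxt a" "x \<noteq> a" "x \<noteq> nxt a"
    using block_disj[OF A(1) C(1)] A na C by auto
  note cr = crossing[OF A(1) C(1) CA[symmetric]] crossing[OF C(1) A(1) CA]
  show ?thesis
  proof (cases "a < nxt a")
    case True
    then have "a < x" "x < nxt a" using C(4) xy nxt_range[OF a] by (auto simp: point_in_gap_def ge_eq)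
    then have "a < y \<and> y < nxt a"
      using cr(1)[of a x "nxt a" y] cr(2)[of y a x "nxt a"] A na C ne by (meson linorder_neqE_nat)
    then show ?thesis using True by (simp add: point_in_gap_def ge_eq)
  next
    case False
    then have "a < x \<or> x < nxt a" using C(4) xy nxt_range[OF a] by (auto simp: point_in_gap_def ge_eq)
    then have "a < y \<or> y < nxt a"
      using cr(1)[of "nxt a" y a x] cr(2)[of x "nxt a" y a] A na C ne False by (meson linorder_neqE_nat)
    then show ?thesis using False xy nxt_range[OF a] by (auto simp: point_in_gap_def ge_eq)
  qed
qed

lemma weq_wht:
  assumes i: "i \<in> {1..n}" shows "weq i (wht i)"
proof -
  define j where "j = wht i"
  have j: "j \<in> {1..n}" "nxt j = rot n i" using wht_props by (auto simp: j_def)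
  \<comment> \<open>The gap after j ends at \<open>rot n i\<close>. So the points between i and j
    are those of the gap if j \<le> i, and those outside it otherwise; in both cases they form a
    union of blocks.\<close>
  have key: "(x \<le> i) = (x \<le> j) \<longleftrightarrow> point_in_gap j x \<noteq> (j \<le> i)" if "x \<in> {1..n}" for x
    using that i j(1) j(2) by (auto simp: point_in_gap_def ge_eq rot_eq split: if_splits)
  show ?thesis
    unfolding weq_def j_def[symmetric]
  proof (intro ballI)
    fix A x y assume A: "A \<in> \<pi>" "x \<in> A" "y \<in> A"
    then have "x \<in> {1..n}" "y \<in> {1..n}" using block_sub by blast+
    moreover have "point_in_gap j x \<longleftrightarrow> point_in_gap j y"
      using point_in_gap_block[OF j(1)] A by blast
    ultimately show "((x \<le> i) = (x \<le> j)) = ((y \<le> i) = (y \<le> j))"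
      using key by simp
  qed
qed

text \<open>For k < j in the class, {k<..j} is a union of blocks containing k + 1, hence it contains
  \<open>wht k\<close>, the predecessor of k + 1 in its block. So \<open>wht\<close> moves up
  without overshooting.\<close>

lemma cyclic_on_wht:
  assumes i: "i \<in> {1..n}" shows "cyclic_on wht {j \<in> {1..n}. weq i j}" (is "cyclic_on _ ?V")
proof (rule cyclic_on_nat_setI)
  show "?V \<noteq> {}" using i weq_refl by auto
  show "inj_on wht ?V" using inj_on_wht by (rule inj_on_subset) auto
  show "wht ` ?V \<subseteq> ?V" using wht_props weq_wht weq_trans by blast
  fix k j assume kj: "k \<in> ?V" "j \<in> ?V" "k < j"
  then have "weq k j" using weq_sym weq_trans by blast
  moreover have "wht k \<in> {1..n}" "nxt (wht k) = k + 1" using wht_props[of k] kj by (auto simp: rot_eq)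
  ultimately show "k < wht k \<and> wht k \<le> j"
    using weqD[OF _ blk(1) nxt_in[OF blk] blk(2)] kj by auto
qed auto

text \<open>Around a white region its arcs alternate with the pieces of the circle behind its sides,
  and every point belongs to one of these pieces. If v is the last arc of the region before m,
  cyclically, then m is behind the side \<open>wht v\<close>.\<close>

lemma block_avoids_gap:
  assumes i0: "i0 \<in> {1..n}" and A: "A \<in> \<pi>" and m: "m = Min A"
  obtains i where "i \<in> {1..n}" "weq i0 i" "\<not> (i < m \<and> m < ge i)" "\<not> m + n < ge i"
proof -
  define V where "V = {j \<in> {1..n}. weq i0 j}"
  have V: "finite V" "i0 \<in> V" "V \<subseteq> {1..n}" using i0 weq_refl by (auto simp: V_def)
  have mA: "m \<in> {1..n}"
    using block_fin[OF A] block_ne[OF A] block_sub[OF A] Min_in m by blast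
  have wV: "wht v \<in> V" if "v \<in> V" for v
    using that wht_props weq_wht weq_trans by (auto simp: V_def)
  have "\<exists>i\<in>V. \<not> (i < m \<and> m < ge i) \<and> \<not> m + n < ge i"
  proof (cases "\<exists>v\<in>V. v < m")
    case True
    define v where "v = Max {v \<in> V. v < m}"
    have "v \<in> {v \<in> V. v < m}" unfolding v_def using V True by (intro Max_in) auto
    then have v: "v \<in> V" "v < m" by auto
    have vmax: "x \<le> v" if "x \<in> V" "x < m" for x
      unfolding v_def using V that by (intro Max_ge) auto
    have "nxt (wht v) = v + 1" using wht_props[of v] v V mA by (auto simp: rot_eq)
    then show ?thesis
      using wV[OF v(1)] vmax[OF wV[OF v(1)]] v by (intro bexI[of _ "wht v"]) (auto simp: ge_eq)
  next
    case False
    define v where "v = Max V"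
    have v: "v \<in> V" unfolding v_def using V by (intro Max_in) auto
    have "wht v \<le> v" unfolding v_def using V wV[OF v] by (intro Max_ge) (auto simp: v_def)
    moreover have "nxt (wht v) = (if v = n then 1 else v + 1)"
      using wht_props[of v] v V by (auto simp: rot_eq)
    moreover have "v \<le> n" "1 \<le> m" using v V mA by auto
    moreover have "\<not> wht v < m" using False wV[OF v] by auto
    ultimately show ?thesis
      using wV[OF v] by (intro bexI[of _ "wht v"]) (auto simp: ge_eq split: if_splits)
  qed
  then show ?thesis using that by (auto simp: V_def)
qed

text \<open>The gap after b lies in the arc from \<open>ge i\<close> to i + n behind the side i, and
  that arc is strictly contained in the gap after a, up to a full turn. This drives the minimality
  argument in \<open>white_area_cover\<close>.\<close>

lemma gap_shorter:
  assumes ij: "i \<in> {1..n}" "a \<in> {1..n}" "weq a i" "i \<noteq> a" and b: "b \<in> blk i" "b \<noteq> i"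
  shows "ge b - b < ge a - a"
proof -
  note B = blk[OF ij(1)]
  have 1: "ge b - b \<le> i + n - ge i"
    using ge_le[OF B(1) b(1) B(2)] ge_le[OF B(1) B(2) b(1)] ge_bounds[OF ij(1)] b by (cases "b < i") auto
  have "i + n - ge i < ge a - a"
  proof (cases "i < a")
    case True
    then show ?thesis
      using weq_gap[OF ij(1,2) True weq_sym[OF ij(3)]] ge_bounds[OF ij(1)] ge_bounds[OF ij(2)] by linarith
  next
    case False
    then have "a < i" using ij by simp
    then show ?thesis
      using weq_gap[OF ij(2,1) _ ij(3)] ge_bounds[OF ij(1)] ge_bounds[OF ij(2)] by linarith
  qed
  then show ?thesis using 1 by linarith
qed

text \<open>If one gap of A contains both arcs, then all points of A are on the same one of the two
  pieces into which the arcs split the circle. \<open>connected_weq\<close> supplies such gaps from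
  the topology.\<close>

lemma weq_if_same_gaps:
  assumes ij: "i \<in> {1..n}" "j \<in> {1..n}" "i < j"
    and gaps: "\<And>A. A \<in> \<pi> \<Longrightarrow> \<exists>a\<in>A. arc_in_gap a i \<and> arc_in_gap a j"
  shows "weq i j"
proof (rule weqI)
  show "i \<le> j" using ij by simp
  fix A x y assume A: "A \<in> \<pi>" "x \<in> A" "y \<in> A" "i < x" "x \<le> j"
  obtain a where a: "a \<in> A" "arc_in_gap a i" "arc_in_gap a j" using gaps[OF A(1)] by blast
  have an: "a \<in> {1..n}" using a A block_sub by blast
  have g: "a < x \<longrightarrow> ge a \<le> x" "ge a \<le> x + n" "a < y \<longrightarrow> ge a \<le> y" "ge a \<le> y + n" "ge a \<le> a + n"
    using ge_le[OF A(1) a(1) A(2)] ge_le[OF A(1) a(1) A(3)] ge_bounds[OF an] by auto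
  have "y \<le> n" using subsetD[OF block_sub[OF A(1)] A(3)] by simp
  from a(2,3) show "i < y \<and> y \<le> j"
    unfolding arc_in_gap_def
  proof (elim disjE conjE)
    assume "a \<le> i" "j < ge a"
    then show ?thesis using A(4,5) g(1) by linarith
  next
    assume "a \<le> i" "j + n < ge a"
    then show ?thesis using ij(3) g(5) by linarith
  next
    assume *: "i + n < ge a" "a \<le> j" "j < ge a"
    have "i < y" using * g(4) by linarith
    moreover have "y \<le> j" using * g(3) \<open>y \<le> n\<close> by linarith
    ultimately show ?thesis ..
  next
    assume "j + n < ge a"
    then show ?thesis using A(5) g(2) by linarith
  qed
qed

end

section \<open>Sides and polygons\<close>

context nc_partition
begin

definition thick :: "nat \<Rightarrow> real" where
  "thick i = (if card (blk i) = 2 then thinness n else 0)"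

text \<open>The part of the disk that the side from \<open>i\<close> cuts off on the side of its polygon.\<close>

definition F :: "nat \<Rightarrow> complex set" where
  "F i = (if card (blk i) = 1 then cball (of_real (1 - thinness n) * circ n i) (thinness n)
          else chord.right n i (ge i) (thick i))"

lemma chordI:
  assumes i: "i \<in> {1..n}" and c: "card (blk i) \<noteq> 1"
  shows "chord n i (ge i) (thick i)"
proof
  have b: "i < ge i" "ge i \<le> i + n" "ge i \<noteq> i + n"
    using ge_bounds[OF i] gap_end_single[OF block_sub[OF blk(1)] blk(2), OF i i] c by (auto simp: ge_def)
  then have n2: "n \<ge> 2" by linarith
  show "n \<ge> 1" by (rule n)
  show "real i < real (ge i)" "real (ge i) < real i + real n" using b by auto
  show "0 \<le> thick i" "thick i \<le> thinness n" using thinness_bounds[OF n] by (auto simp: thick_def)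
  have "4 * thinness n < 2 * sin (pi * (real (ge i) - real i) / real n)"
    using b n2 by (intro thinness_less_sin) auto
  moreover have "thick i \<le> thinness n" using thinness_bounds[OF n] by (auto simp: thick_def)
  ultimately show "4 * thick i < 2 * sin (pi * (real (ge i) - real i) / real n)" by linarith
qed

lemma circ_ge: "circ n (ge i) = point n (nxt i)"
proof (cases "i < nxt i")
  case False
  then have "circ n (ge i) = circ n (real (nxt i) + real n)" by (simp add: ge_eq)
  then show ?thesis using circ_add_n[OF n] by (simp add: circ_of_nat)
qed (simp add: ge_eq circ_of_nat)

lemma ge_single: "i \<in> {1..n} \<Longrightarrow> card (blk i) = 1 \<Longrightarrow> ge i = i + n"
  using gap_end_single[OF block_sub[OF blk(1)] blk(2)] by (simp add: ge_def)

lemma F_single: "card (blk i) = 1 \<Longrightarrow> F i = cball (of_real (1 - thinness n) * circ n i) (thinness n)"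
  by (simp add: F_def)

lemma F_chord: "card (blk i) \<noteq> 1 \<Longrightarrow> F i = chord.right n i (ge i) (thick i)"
  by (simp add: F_def)

lemma compact_F: "i \<in> {1..n} \<Longrightarrow> compact (F i)"
  using chord.compact_right[OF chordI] by (cases "card (blk i) = 1") (auto simp: F_single F_chord)

lemma convex_F: "i \<in> {1..n} \<Longrightarrow> convex (F i)"
  using chord.convex_right[OF chordI] by (cases "card (blk i) = 1") (auto simp: F_single F_chord)

lemma F_disk: "i \<in> {1..n} \<Longrightarrow> F i \<subseteq> cball 0 1"
  using chord.right_subset[OF chordI] loop_disk_norm[OF n]
  by (cases "card (blk i) = 1") (auto simp: F_single F_chord)

text \<open>Together with \<open>F_circ\<close> this treats all sizes of blocks alike; for a loop
  the arc from \<open>ge i\<close> to i + n shrinks to a point.\<close>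

lemma F_widen:
  assumes i: "i \<in> {1..n}" and z: "z \<in> F i"
  shows "cap_height n (real (ge i) - 1/2) (real i + real n + 1/2) z > 0"
proof (cases "card (blk i) = 1")
  case True
  then show ?thesis
    using loop_disk_widen[OF n, of z "real i"] z ge_single[OF i True] by (simp add: F_single)
next
  case False
  have "real i + 1 \<le> real (ge i)" using ge_bounds[OF i] by simp
  then show ?thesis
    using chord.right_widen[OF chordI[OF i False]] z by (simp add: F_chord[OF False])
qed

lemma F_outside:
  "i \<in> {1..n} \<Longrightarrow> card (blk i) \<noteq> 1 \<Longrightarrow> z \<in> cball 0 1 - F i \<Longrightarrow> cap_height n i (ge i) z > 0"
  using chord.outside_cap[OF chordI] by (simp add: F_chord)

lemma F_circ:
  assumes i: "i \<in> {1..n}" and v: "real i \<le> v" "v \<le> real i + real n"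
  shows "circ n v \<in> F i \<longleftrightarrow> \<not> (real i < v \<and> v < real (ge i))"
proof -
  have ge: "real i < real (ge i)" "real (ge i) \<le> real i + real n" using ge_bounds[OF i] by auto
  show ?thesis
  proof (cases "card (blk i) = 1")
    case True
    have "circ n v \<in> F i \<longleftrightarrow> circ n v = circ n i"
      using loop_disk_sphere[OF n, of "circ n v" "real i"] by (simp add: F_single True)
    also have "\<dots> \<longleftrightarrow> v = real i \<or> v = real i + n"
      using circ_inj[OF n, of "real i" v "real i"] v n circ_add_n[OF n, of "real i"] by auto
    finally show ?thesis using v ge_single[OF i True] n by auto
  next
    case False
    have 1: "circ n v \<in> F i \<longleftrightarrow> cap_height n i (ge i) (circ n v) \<le> 0"
      using chord.right_sphere[OF chordI[OF i False], of "circ n v"] by (simp add: F_chord[OF False])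
    show ?thesis
    proof (cases "real i < v \<and> v < real (ge i)")
      case True
      then show ?thesis
        using cap_height_circ_pos[OF n, of "real i" v "real (ge i)"] ge 1 by auto
    next
      case out: False
      have "cap_height n i (ge i) (circ n v) \<le> 0"
      proof (cases "v = real i")
        case True
        have "circ n v = circ n (real i + real n)" using circ_add_n[OF n] True by simp
        then show ?thesis
          using cap_height_circ_nonpos[OF n, of "real i" "real (ge i)" "real i + real n"] ge by simp
      next
        case False
        then show ?thesis
          using cap_height_circ_nonpos[OF n, of "real i" "real (ge i)" v] ge v out by simp
      qed
      then show ?thesis using 1 out by simp
    qed
  qed
qed

lemma point_F:
  assumes i: "i \<in> {1..n}" and k: "k \<in> {1..n}"
  shows "point n k \<in> F i \<longleftrightarrow> \<not> point_in_gap i k"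
proof (cases "i \<le> k")
  case True
  then show ?thesis
    using F_circ[OF i, of "real k"] ge_bounds[OF i] k by (auto simp: circ_of_nat point_in_gap_def)
next
  case False
  then show ?thesis
    using F_circ[OF i, of "real k + real n"] ge_bounds[OF i] k i circ_add_n[OF n, of "real k"]
    by (auto simp: circ_of_nat point_in_gap_def)
qed

text \<open>A base point for the white region along the arc after k; the labelled points themselves
  belong to polygons.\<close>

definition mid :: "nat \<Rightarrow> complex" where "mid k = circ n (real k + 1/2)"

lemma norm_mid [simp]: "cmod (mid k) = 1" by (simp add: mid_def)

lemma mid_F:
  assumes i: "i \<in> {1..n}" and k: "k \<in> {1..n}"
  shows "mid k \<in> F i \<longleftrightarrow> \<not> arc_in_gap i k"
proof (cases "i \<le> k")
  case True
  then show ?thesis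
    using F_circ[OF i, of "real k + 1/2"] ge_bounds[OF i] k i by (auto simp: mid_def arc_in_gap_def)
next
  case False
  have "circ n (real k + 1/2 + real n) = mid k"
    using circ_add_n[OF n] by (simp add: mid_def)
  then show ?thesis
    using F_circ[OF i, of "real k + 1/2 + real n"] ge_bounds[OF i] k i False
    by (auto simp: arc_in_gap_def)
qed

lemma F_sphere:
  assumes i: "i \<in> {1..n}" shows "F i \<inter> sphere 0 1 = circ n ` {real (ge i)..real i + real n}"
proof -
  have ge: "real i < real (ge i)" "real (ge i) \<le> real i + real n" using ge_bounds[OF i] by auto
  show ?thesis
  proof (intro equalityI subsetI)
    fix z assume z: "z \<in> F i \<inter> sphere 0 1"
    obtain v where v: "real i \<le> v" "v < real i + real n" "z = circ n v"
      using circ_surj[OF n, of z "real i"] z by auto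
    show "z \<in> circ n ` {real (ge i)..real i + real n}"
    proof (cases "v = real i")
      case True
      then show ?thesis using v ge circ_add_n[OF n, of v] by (intro image_eqI[of _ _ "v + n"]) auto
    next
      case False
      then show ?thesis using F_circ[OF i, of v] v z by (intro image_eqI[of _ _ v]) auto
    qed
  next
    fix z assume "z \<in> circ n ` {real (ge i)..real i + real n}"
    then obtain v where "z = circ n v" "v \<in> {real (ge i)..real i + real n}" by blast
    then show "z \<in> F i \<inter> sphere 0 1" using F_circ[OF i, of v] ge by auto
  qed
qed

lemma connected_F_sphere: "i \<in> {1..n} \<Longrightarrow> connected (F i \<inter> sphere 0 1)"
  by (simp only: F_sphere) (intro connected_continuous_image continuous_on_circ connected_Icc)

lemma F_disjoint:
  assumes ij: "i \<in> {1..n}" "j \<in> {1..n}" and g: "i < j" "j < ge i" "i + n < ge j"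
  shows "F i \<inter> F j = {}"
proof (rule ccontr)
  assume "F i \<inter> F j \<noteq> {}"
  then obtain z where z: "z \<in> F i" "z \<in> F j" by blast
  \<comment> \<open>Strict inequalities between integers leave a full step at either end, just
    enough for both arcs to be widened by half a step.\<close>
  have r: "real i + real n + 1 \<le> real (ge j)" "real j + 1 \<le> real (ge i)"
    using g by linarith+
  have "cmod z \<le> 1" using F_disk[OF ij(1)] z by auto
  then show False
    using r ge_bounds[OF ij(1)] ge_bounds[OF ij(2)]
    by (intro caps_disjoint[OF n _ _ _ _ _ F_widen[OF ij(1) z(1)] F_widen[OF ij(2) z(2)]]) auto
qed

lemma F_disjoint_weq:
  assumes "i \<in> {1..n}" "j \<in> {1..n}" "weq i j" "i \<noteq> j"
  shows "F i \<inter> F j = {}"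
proof (cases "i < j")
  case True
  then show ?thesis using F_disjoint[of i j] weq_gap[of i j] assms by blast
next
  case False
  then show ?thesis using F_disjoint[of j i] weq_gap[of j i] weq_sym assms by auto
qed

text \<open>What \<open>F a\<close> and \<open>F b\<close> leave out lies in the caps over two gaps
  of the same block, and these do not overlap.\<close>

lemma F_cover:
  assumes B: "B \<in> \<pi>" "a \<in> B" "b \<in> B" "a \<noteq> b"
  shows "cball 0 1 \<subseteq> F a \<union> F b"
proof -
  have *: "cball 0 1 \<subseteq> F a \<union> F b" if ab: "a \<in> B" "b \<in> B" "a < b" for a b
  proof
    fix z :: complex assume z: "z \<in> cball 0 1"
    have an: "a \<in> {1..n}" "b \<in> {1..n}" using block_sub B(1) ab by blast+
    have c: "card (blk a) \<noteq> 1" "card (blk b) \<noteq> 1"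
      using ab by (auto simp: blk_eq[OF B(1)] card_1_singleton_iff)
    show "z \<in> F a \<union> F b"
    proof (rule ccontr)
      assume "z \<notin> F a \<union> F b"
      then have h: "cap_height n a (ge a) z > 0" "cap_height n b (ge b) z > 0"
        using F_outside[OF an(1) c(1)] F_outside[OF an(2) c(2)] z by auto
      show False
        using ge_le[OF B(1) ab(1,2)] ge_le[OF B(1) ab(2,1)] ab(3) ge_bounds[OF an(1)] ge_bounds[OF an(2)] z
        by (intro caps_disjoint[OF n _ _ _ _ _ h]) auto
    qed
  qed
  show ?thesis
  proof (cases "a < b")
    case True
    then show ?thesis using * B by blast
  next
    case False
    then show ?thesis using *[of b a] B by auto
  qed
qed

lemma side_chord:
  assumes i: "i \<in> {1..n}" and c: "card (blk i) \<noteq> 1"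
  shows "side_from n \<pi> i = chord.arc_pt n i (ge i) (thick i) ` {0..1}"
proof -
  interpret chord n "real i" "real (ge i)" "thick i" by (rule chordI[OF assms])
  define p q where "p = point n i" and "q = point n (nxt i)"
  have arc: "arc_pt t = p + of_real t * (q - p) + of_real (thick i * t * (1 - t)) * \<i> * (q - p)" for t
    unfolding arc_pt_def pt_def circ_ge by (simp add: circ_of_nat p_def q_def Complex_eq algebra_simps)
  show ?thesis
  proof (cases "card (blk i) = 2")
    case True
    have "side_from n \<pi> i = {p + of_real t * (q - p) + of_real (thick i * t * (1 - t)) * \<i> * (q - p) | t. 0 \<le> t \<and> t \<le> 1}"
      using True by (simp add: side_from_def side_def Let_def p_def q_def side_end_def thick_def)
    also have "\<dots> = arc_pt ` {0..1}"
      unfolding arc[symmetric] by auto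
    finally show ?thesis .
  next
    case False
    have "side_from n \<pi> i = closed_segment p q"
      using False c by (simp add: side_from_def side_def Let_def p_def q_def side_end_def)
    also have "\<dots> = (\<lambda>t. p + of_real t * (q - p)) ` {0..1}"
      by (auto simp: closed_segment_image_interval scaleR_conv_of_real algebra_simps intro!: image_cong)
    also have "\<dots> = arc_pt ` {0..1}"
      unfolding arc using False by (intro image_cong) (simp_all add: thick_def)
    finally show ?thesis .
  qed
qed

lemma side_single:
  assumes i: "i \<in> {1..n}" and c: "card (blk i) = 1"
  shows "side_from n \<pi> i = sphere (of_real (1 - thinness n) * circ n i) (thinness n)"
  using c by (simp add: side_from_def side_def Let_def circ_of_nat)

lemma side_F: "i \<in> {1..n} \<Longrightarrow> side_from n \<pi> i \<subseteq> F i"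
proof (cases "card (blk i) = 1")
  case False
  assume i: "i \<in> {1..n}"
  interpret chord n "real i" "real (ge i)" "thick i" by (rule chordI[OF i False])
  show ?thesis
    using arc_pt_right by (auto simp: side_chord[OF i False] F_chord[OF False])
qed (auto simp: side_single F_single)

lemma side_limit: "i \<in> {1..n} \<Longrightarrow> side_from n \<pi> i \<subseteq> closure (cball 0 1 - F i)"
proof (cases "card (blk i) = 1")
  case True
  assume i: "i \<in> {1..n}"
  show ?thesis
    using loop_limit[OF n] by (auto simp only: side_single[OF i True] F_single[OF True])
next
  case False
  assume i: "i \<in> {1..n}"
  interpret chord n "real i" "real (ge i)" "thick i" by (rule chordI[OF i False])
  show ?thesis
    using arc_pt_limit by (auto simp: side_chord[OF i False] F_chord[OF False])
qed

text \<open>An endpoint of a chord would not do, since it also lies on a neighbouring side, so the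
  midpoint of the side is taken. In a digon the bulge moves it off the common chord; in larger
  blocks it is the average of two vertices of which at least one is strictly below the chord of b.
  For a loop the condition is vacuous.\<close>

lemma side_point:
  assumes i: "i \<in> {1..n}"
  obtains s where "s \<in> side_from n \<pi> i" "\<And>b. b \<in> blk i \<Longrightarrow> b \<noteq> i \<Longrightarrow> cap_height n b (ge b) s < 0"
proof (cases "card (blk i) = 1")
  case True
  then have B: "blk i = {i}" using blk(2)[OF i] by (auto simp: card_1_singleton_iff)
  have "point n i \<in> closure (sphere (of_real (1 - thinness n) * circ n i) (thinness n))"
  proof -
    have "of_real (1 - thinness n) * circ n i - circ n i = - (of_real (thinness n) * circ n i)"
      by (simp add: algebra_simps)
    then show ?thesis using thinness_bounds[OF n] by (simp add: dist_norm circ_of_nat norm_mult flip: circ_of_nat)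
  qed
  then show ?thesis
    using that[of "point n i"] B by (simp add: side_single[OF i True])
next
  case False
  note B = blk[OF i]
  interpret chord n "real i" "real (ge i)" "thick i" by (rule chordI[OF i False])
  define s where "s = arc_pt (1/2)"
  have s: "s \<in> side_from n \<pi> i" by (auto simp: side_chord[OF i False] s_def)
  have "cap_height n b (ge b) s < 0" if b: "b \<in> blk i" "b \<noteq> i" for b
  proof (cases "card (blk i) = 2")
    case True
    have Bi: "blk i = {b, i}"
    proof (rule card_seteq[symmetric])
      show "finite (blk i)" using block_fin B by simp
    qed (use b B True in auto)
    have bn: "b \<in> {1..n}" using block_sub B b by blast
    have cb: "card (blk b) \<noteq> 1" using blk_eq[OF B(1) b(1)] True by simp
    have nx: "nxt i = b" "nxt b = i"
    proof -
      have "ge i \<noteq> i + n" "ge b \<noteq> b + n"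
        using chordI[OF i False] chordI[OF bn cb] by (auto simp: chord_def)
      then show "nxt i = b" "nxt b = i"
        using nxt_in[OF B] nxt_in[OF B(1) b(1)] Bi by (auto simp: ge_eq split: if_splits)
    qed
    have "cap_height n b (ge b) s = - cap_height n i (ge i) s"
    proof (cases "i < b")
      case True
      then show ?thesis using cap_height_opposite[OF n, of b i s] by (simp add: ge_eq nx)
    next
      case False
      then have "b < i" using b by simp
      then show ?thesis using cap_height_opposite[OF n, of i b s] by (simp add: ge_eq nx)
    qed
    moreover have "cap_height n i (ge i) s > 0"
      using True thinness_bounds[OF n] len_pos unfolding s_def arc_pt_def cap_height_pt by (simp add: thick_def)
    ultimately show ?thesis by simp
  next
    case c2: False
    have bn: "b \<in> {1..n}" using block_sub B b by blast
    have neg: "cap_height n b (ge b) (point n k) \<le> 0 \<and>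
        (k \<noteq> b \<longrightarrow> k \<noteq> nxt b \<longrightarrow> cap_height n b (ge b) (point n k) < 0)" if k: "k \<in> blk i" for k
    proof -
      have kn: "k \<in> {1..n}" using block_sub B k by blast
      define v where "v = (if b < k then k else k + n)"
      have v: "circ n v = point n k"
        using circ_add_n[OF n, of "real k"] circ_of_nat[of n k] by (auto simp: v_def simp del: circ_of_nat)
      have le: "ge b \<le> v" "v \<le> b + n"
        using ge_le[OF B(1) b(1) k] kn by (auto simp: v_def)
      have lt: "ge b < v \<and> v < b + n" if "k \<noteq> b" "k \<noteq> nxt b"
        using le that kn nxt_range[OF bn] bn by (auto simp: v_def ge_eq split: if_splits)
      show ?thesis
        using cap_height_circ_nonpos[OF n, of "real b" "real (ge b)" "real v"]
          cap_height_circ_neg[OF n, of "real b" "real (ge b)" "real v"]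
          le lt ge_bounds[OF bn] by (auto simp: v)
    qed
    have "s = (point n i + point n (nxt i)) / 2"
      using c2 unfolding s_def arc_pt_def pt_def circ_ge by (simp add: circ_of_nat thick_def Complex_eq field_simps)
    then have "cap_height n b (ge b) s
        = (cap_height n b (ge b) (point n i) + cap_height n b (ge b) (point n (nxt i))) / 2"
      by (simp add: cap_height_def add_divide_distrib distrib_right)
    moreover have "nxt i \<noteq> nxt b" using inj_onD[OF inj_on_nxt _ i bn] b by auto
    \<comment> \<open>Otherwise the block would be the two-element cycle of i and b, and blocks of
      size two are excluded here.\<close>
    moreover have "\<not> (nxt b = i \<and> nxt i = b)"
    proof
      assume a: "nxt b = i \<and> nxt i = b"
      have "blk i = orbit nxt i"
        using orbit_cyclic_eq3[OF cyclic_on_nxt[OF B(1)] B(2)] by simp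
      also have "\<dots> \<subseteq> {i, b}" using a by (intro orbit_subset_closed) auto
      finally have "card (blk i) \<le> card {i, b}" by (intro card_mono) auto
      moreover have "card (blk i) > 0" using B block_fin by (auto simp: card_gt_0_iff)
      ultimately show False using False c2 b by simp
    qed
    ultimately show ?thesis
      using neg[OF B(2)] neg[OF nxt_in[OF B]] b by (cases "nxt b = i") auto
  qed
  then show ?thesis using that s by blast
qed

end

text \<open>Twice the signed area of the triangle p, q, z.\<close>

definition cross :: "complex \<Rightarrow> complex \<Rightarrow> complex \<Rightarrow> real" where
  "cross p q z = Im (cnj (q - p) * (z - p))"

lemma cross_cap_height:
  assumes n: "n \<ge> 1" and xy: "x < y" "y < x + real n"
  shows "\<exists>c>0. cross (circ n x) (circ n y) z = c * cap_height n x y z"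
proof -
  interpret chord n x y 0
  proof
    show "4 * 0 < 2 * sin (pi * (y - x) / real n)"
      using sin_angle_pos[of "y - x" n] xy by simp
  qed (use assms thinness_bounds[OF n] in auto)
  obtain \<zeta> where \<zeta>: "z = pt \<zeta>" by (rule pt_surj)
  define w where "w = circ n y - circ n x"
  have "w \<noteq> 0"
    using circ_inj[OF n, of x x y] xy n by (auto simp: w_def)
  have "cross (circ n x) (circ n y) z = Im ((w * cnj w) * \<zeta>)"
    by (simp add: cross_def \<zeta> pt_def w_def algebra_simps)
  also have "\<dots> = (cmod w)\<^sup>2 * Im \<zeta>"
    by (simp only: complex_norm_square[symmetric]) simp
  also have "\<dots> = ((cmod w)\<^sup>2 / len) * cap_height n x y z"
    using len_pos by (simp add: \<zeta> cap_height_pt)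
  finally show ?thesis
    using \<open>w \<noteq> 0\<close> len_pos by (intro exI[of _ "(cmod w)\<^sup>2 / len"]) auto
qed

text \<open>The signed areas of the three subtriangles at z are its unnormalised barycentric
  coordinates.\<close>

lemma cross_barycentric:
  "cross q r z + cross r p z + cross p q z = cross p q r"
  "of_real (cross q r z) * p + of_real (cross r p z) * q + of_real (cross p q z) * r = of_real (cross p q r) * z"
  by (simp_all add: cross_def complex_eq_iff algebra_simps)

lemma cross_swap: "cross r p z = - cross p r z"
  by (simp add: cross_def algebra_simps)

text \<open>A clockwise triangle has negative area, and the hypotheses make the areas of the three
  subtriangles nonpositive; so the barycentric coordinates of z are nonnegative.\<close>

lemma mem_circ_triangle:
  assumes n: "n \<ge> 1" and o: "x < y" "y < v" "v < x + real n"
    and z: "cap_height n x y z \<le> 0" "cap_height n y v z \<le> 0" "cap_height n x v z \<ge> 0"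
  shows "z \<in> convex hull {circ n x, circ n y, circ n v}"
proof -
  define p q r where "p = circ n x" and "q = circ n y" and "r = circ n v"
  obtain c1 where c1: "c1 > 0" "cross p q z = c1 * cap_height n x y z"
    using cross_cap_height[OF n, of x y z] o by (auto simp: p_def q_def)
  obtain c2 where c2: "c2 > 0" "cross q r z = c2 * cap_height n y v z"
    using cross_cap_height[OF n, of y v z] o by (auto simp: r_def q_def)
  obtain c3 where c3: "c3 > 0" "cross p r z = c3 * cap_height n x v z"
    using cross_cap_height[OF n, of x v z] o by (auto simp: r_def p_def)
  obtain c4 where c4: "c4 > 0" "cross p q r = c4 * cap_height n x y r"
    using cross_cap_height[OF n, of x y r] o by (auto simp: q_def p_def)
  have T: "cross p q r < 0"
    using c4 cap_height_circ_neg[OF n o] by (simp add: r_def mult_pos_neg)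
  have a: "cross q r z \<le> 0" "cross r p z \<le> 0" "cross p q z \<le> 0"
    using c1 c2 c3 z by (simp_all add: cross_swap[of r p] mult_le_0_iff)
  define \<alpha> \<beta> \<gamma> where "\<alpha> = cross q r z / cross p q r" and "\<beta> = cross r p z / cross p q r"
    and "\<gamma> = cross p q z / cross p q r"
  have "0 \<le> \<alpha>" "0 \<le> \<beta>" "0 \<le> \<gamma>"
    using a T by (auto simp: \<alpha>_def \<beta>_def \<gamma>_def intro: divide_nonpos_neg)
  moreover have "\<alpha> + \<beta> + \<gamma> = 1"
    using cross_barycentric(1)[of q r z p] T
    by (simp add: \<alpha>_def \<beta>_def \<gamma>_def add_divide_distrib[symmetric])
  moreover have "z = \<alpha> *\<^sub>R p + \<beta> *\<^sub>R q + \<gamma> *\<^sub>R r"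
  proof -
    have "of_real (cross p q r) * (\<alpha> *\<^sub>R p + \<beta> *\<^sub>R q + \<gamma> *\<^sub>R r)
        = of_real (cross q r z) * p + of_real (cross r p z) * q + of_real (cross p q z) * r"
      using T by (simp add: \<alpha>_def \<beta>_def \<gamma>_def scaleR_conv_of_real distrib_left)
    also have "\<dots> = of_real (cross p q r) * z" by (rule cross_barycentric)
    finally show ?thesis using T by simp
  qed
  ultimately show ?thesis
    unfolding convex_hull_3 p_def q_def r_def by blast
qed

lemma convex_hull_sphere_eq:
  fixes c :: complex assumes "r > 0" shows "convex hull (sphere c r) = cball c r"
proof -
  have "cball c r = convex hull (frontier (cball c r))"
    by (rule Krein_Milman_frontier) auto
  then show ?thesis using assms by simp
qed

context nc_partition
begin

lemma F_big:
  assumes i: "i \<in> {1..n}" and c: "card (blk i) \<ge> 3"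
  shows "z \<in> F i \<longleftrightarrow> cmod z \<le> 1 \<and> cap_height n i (ge i) z \<le> 0"
proof -
  have c1: "card (blk i) \<noteq> 1" "thick i = 0" using c by (auto simp: thick_def)
  interpret chord n "real i" "real (ge i)" 0 using chordI[OF i c1(1)] c1 by simp
  obtain \<zeta> where \<zeta>: "z = pt \<zeta>" by (rule pt_surj)
  have "F i = right" using F_chord[OF c1(1)] c1 by simp
  then show ?thesis
    using len_pos by (simp add: \<zeta> mem_right cap_height_pt mult_le_0_iff)
qed

lemma block_points_F:
  assumes A: "A \<in> \<pi>" "a \<in> A" "k \<in> A"
  shows "point n k \<in> F a"
proof -
  have r: "a \<in> {1..n}" "k \<in> {1..n}" using block_sub A by blast+
  have "\<not> point_in_gap a k"
    using ge_le[OF A] unfolding point_in_gap_def by auto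
  then show ?thesis using point_F[OF r] by simp
qed

text \<open>One inclusion is convexity. For the other the polygon is triangulated as a fan from its
  least vertex a0: if k' is the first vertex whose diagonal from a0 has z on the side of the arc
  from a0 to k', then z lies in the triangle of a0, k' and the vertex k before k'.\<close>

lemma polygon_eq_big:
  assumes A: "A \<in> \<pi>" and c: "card A \<ge> 3"
  shows "polygon n A = (\<Inter>a\<in>A. F a)"
proof
  have side: "side n A i = closed_segment (point n i) (point n (nxt i))" if "i \<in> A" for i
    using c that A by (simp add: side_def Let_def nxt_cyc)
  have "side n A i \<subseteq> F a" if "i \<in> A" "a \<in> A" for i a
    unfolding side[OF that(1)]
    using block_points_F[OF A that(2)] nxt_in[OF A] convex_F[of a] block_sub[OF A] that
    by (intro closed_segment_subset) auto
  then show "polygon n A \<subseteq> (\<Inter>a\<in>A. F a)"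
    unfolding polygon_def using convex_F block_sub[OF A]
    by (intro hull_minimal convex_INT) (auto intro: subsetD)
  show "(\<Inter>a\<in>A. F a) \<subseteq> polygon n A"
  proof
    fix z assume z: "z \<in> (\<Inter>a\<in>A. F a)"
    have bl: "a \<in> {1..n}" "blk a = A" if "a \<in> A" for a
      using block_sub[OF A] A that by (auto simp: blk_eq)
    have zc: "cap_height n a (ge a) z \<le> 0" if "a \<in> A" for a
      using z that F_big[OF bl(1)[OF that]] bl(2)[OF that] c by auto
    note fin = block_fin[OF A] and ne = block_ne[OF A]
    define a0 where "a0 = Min A"
    define aM where "aM = Max A"
    have a0: "a0 \<in> A" "\<And>x. x \<in> A \<Longrightarrow> a0 \<le> x" using fin ne by (auto simp: a0_def)
    have aM: "aM \<in> A" "\<And>x. x \<in> A \<Longrightarrow> x \<le> aM" using fin ne by (auto simp: aM_def)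
    define a1 where "a1 = nxt a0"
    have "\<not> A \<subseteq> {a0, a1}"
    proof
      assume "A \<subseteq> {a0, a1}"
      then have "card A \<le> card {a0, a1}" by (intro card_mono) auto
      also have "\<dots> \<le> 2" by (simp add: card_insert_if)
      finally show False using c by simp
    qed
    then obtain x where x: "x \<in> A" "x \<noteq> a0" "x \<noteq> a1" by blast
    then have "a0 < x" using a0(2)[OF x(1)] by simp
    then have a1: "a1 \<in> A" "a0 < a1" "a1 < x"
      using nxt_in[OF A a0(1)] nxt_upper[OF A a0(1) x(1)] x by (auto simp: a1_def)
    define S where "S = {x \<in> A. a1 < x \<and> cap_height n a0 x z \<ge> 0}"
    \<comment> \<open>The diagonal to the last vertex is itself a side, traversed backwards, so the
      search for k' succeeds.\<close>
    have "aM \<in> S"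
    proof -
      have nM: "nxt aM \<le> aM" using aM nxt_in[OF A aM(1)] by simp
      then have "nxt aM = a0"
        using nxt_lower[OF A aM(1) a0(1) nM] a0(2)[OF nxt_in[OF A aM(1)]] by simp
      then have "ge aM = a0 + n" using nM by (simp add: ge_eq)
      then have "cap_height n aM (real a0 + real n) z \<le> 0" using zc[OF aM(1)] by simp
      then show ?thesis
        using cap_height_opposite[OF n, of "real aM" "real a0" z] aM a1 x
        by (auto simp: S_def intro: less_le_trans)
    qed
    define k' where "k' = Min S"
    have "k' \<in> S" unfolding k'_def using \<open>aM \<in> S\<close> fin by (intro Min_in) (auto simp: S_def)
    then have k': "k' \<in> A" "a1 < k'" "cap_height n a0 (real k') z \<ge> 0" by (auto simp: S_def)
    have kmin: "k' \<le> y" if "y \<in> S" for y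
      unfolding k'_def using that fin by (intro Min_le) (auto simp: S_def)
    define k where "k = Max {x \<in> A. x < k'}"
    have "k \<in> {x \<in> A. x < k'}" unfolding k_def using fin a1 k' by (intro Max_in) auto
    then have k: "k \<in> A" "k < k'" by auto
    have kmax: "y \<le> k" if "y \<in> A" "y < k'" for y
      unfolding k_def using that fin by (intro Max_ge) auto
    have "a1 \<le> k" using kmax a1 k' by auto
    have "ge k = k'"
    proof -
      have "k < nxt k" "nxt k \<le> k'" using nxt_upper[OF A k(1) k'(1) k(2)] by auto
      moreover from this have "nxt k = k'"
        using kmax[OF nxt_in[OF A k(1)]] by (cases "nxt k = k'") auto
      ultimately show ?thesis by (simp add: ge_eq)
    qed
    then have 1: "cap_height n k (real k') z \<le> 0" using zc[OF k(1)] by simp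
    have 2: "cap_height n a0 k z \<le> 0"
    proof (cases "k = a1")
      case True
      have "ge a0 = a1" using a1 by (simp add: ge_eq a1_def)
      then show ?thesis using zc[OF a0(1)] True by simp
    next
      case False
      then have "k \<notin> S" using kmin k by (metis leD)
      then show ?thesis using False \<open>a1 \<le> k\<close> k by (auto simp: S_def)
    qed
    have "k' < a0 + n" using bl(1)[OF k'(1)] bl(1)[OF a0(1)] by simp
    then have "real k' < real a0 + real n" by linarith
    then have "z \<in> convex hull {circ n a0, circ n k, circ n (real k')}"
      using 1 2 k'(3) a1 \<open>a1 \<le> k\<close> k by (intro mem_circ_triangle[OF n]) auto
    also have "\<dots> \<subseteq> convex hull (\<Union>i\<in>A. side n A i)"
      using a0(1) k(1) k'(1) by (intro hull_mono) (auto simp: circ_of_nat side)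
    finally show "z \<in> polygon n A" by (simp add: polygon_def)
  qed
qed

text \<open>The coordinates of the two chords differ by \<zeta> being replaced by 1 - \<zeta>. So
  the intersection is a lens, symmetric about the chord, and each of its points lies on a segment
  across the lens from one arc to the other.\<close>

lemma polygon_eq_digon:
  assumes A: "A \<in> \<pi>" and c: "card A = 2"
  shows "polygon n A = (\<Inter>a\<in>A. F a)"
proof -
  obtain a b where ab: "A = {a, b}" "a < b"
    using c by (metis card_2_iff insert_commute linorder_neqE_nat)
  have bl: "i \<in> {1..n}" "blk i = A" if "i \<in> A" for i
    using block_sub[OF A] A that by (auto simp: blk_eq)
  have nx: "nxt a = b" "nxt b = a"
    using ab A by (auto simp: nxt_cyc cyc_next_def intro!: Min_eqI)
  have ge: "ge a = b" "ge b = a + n" using nx ab by (auto simp: ge_eq)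
  have th: "thick a = thinness n" "thick b = thinness n" using bl ab c by (auto simp: thick_def)
  have cn1: "card (blk a) \<noteq> 1" "card (blk b) \<noteq> 1" using bl ab c by auto
  interpret X: chord n "real a" "real b" "thinness n"
    using chordI[of a] bl ab cn1 ge th by auto
  interpret Y: chord n "real b" "real a + real n" "thinness n"
    using chordI[of b] bl ab cn1 ge th by auto
  have Y: "Y.pt \<zeta> = X.pt (1 - \<zeta>)" for \<zeta>
    unfolding X.pt_def Y.pt_def using circ_add_n[OF n, of "real a"] by (simp add: algebra_simps)
  have Fa: "F a = X.right" using F_chord[OF cn1(1)] ge th by simp
  have Fb: "F b = Y.right" using F_chord[OF cn1(2)] ge th by simp
  have Fab: "X.pt \<zeta> \<in> F a \<inter> F b \<longleftrightarrow> cmod (X.pt \<zeta>) \<le> 1 \<and> \<bar>Im \<zeta>\<bar> \<le> thinness n * (Re \<zeta> * (1 - Re \<zeta>))" for \<zeta>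
    using Y.mem_right[of "1 - \<zeta>"] by (auto simp: Fa Fb X.mem_right Y mult.commute)
  have sa: "side n A a = X.arc_pt ` {0..1}"
    using side_chord[of a] bl ab ge th c by (simp add: side_from_def)
  have sb: "side n A b = Y.arc_pt ` {0..1}"
    using side_chord[of b] bl ab ge th c by (simp add: side_from_def)
  have Yarc: "Y.arc_pt t = X.pt (Complex (1 - t) (- thinness n * (t * (1 - t))))" for t
    unfolding Y.arc_pt_def Y by (rule arg_cong[where f = X.pt]) (simp add: complex_eq_iff)
  have "X.arc_pt t \<in> F a \<inter> F b" "Y.arc_pt t \<in> F a \<inter> F b" if "0 \<le> t" "t \<le> 1" for t
  proof -
    have d: "cmod (X.pt (Complex s h)) \<le> 1" if "0 \<le> s" "s \<le> 1" "\<bar>h\<bar> \<le> thinness n * (s * (1 - s))" for s h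
      using X.arc_in_disk[OF that] X.k0 X.k_len by simp
    have "0 \<le> thinness n * (t * (1 - t))" using that X.k0 by simp
    then show "X.arc_pt t \<in> F a \<inter> F b" "Y.arc_pt t \<in> F a \<inter> F b"
      using that d[of t] d[of "1 - t"] unfolding Yarc X.arc_pt_def Fab
      by (auto simp: mult.commute)
  qed
  then have "side n A a \<union> side n A b \<subseteq> F a \<inter> F b"
    by (auto simp: sa sb)
  moreover have "(\<Union>i\<in>{a, b}. side n A i) = side n A a \<union> side n A b" by simp
  ultimately have "(\<Union>i\<in>A. side n A i) \<subseteq> F a \<inter> F b"
    unfolding ab(1)[symmetric] by simp
  then have sub: "polygon n A \<subseteq> F a \<inter> F b"
    unfolding polygon_def using convex_F bl ab by (intro hull_minimal convex_Int) auto
  have "z \<in> polygon n A" if z: "z \<in> F a \<inter> F b" for z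
  proof -
    obtain \<zeta> where \<zeta>: "z = X.pt \<zeta>" by (rule X.pt_surj)
    define t where "t = Re \<zeta>"
    define h where "h = Im \<zeta>"
    define k where "k = thinness n * (t * (1 - t))"
    have zeta: "\<zeta> = Complex t h" by (simp add: t_def h_def)
    have hk: "\<bar>h\<bar> \<le> k" using z Fab[of \<zeta>] by (simp add: \<zeta> h_def t_def k_def)
    then have "0 \<le> k" by simp
    then have "0 \<le> t * (1 - t)" using thinness_bounds[OF n] by (simp add: k_def zero_le_mult_iff)
    then have t: "0 \<le> t" "t \<le> 1" by (auto simp: zero_le_mult_iff)
    have p1: "X.pt (Complex t k) \<in> polygon n A"
    proof -
      have "X.arc_pt t \<in> side n A a" using t by (auto simp: sa)
      then show ?thesis
        unfolding polygon_def k_def X.arc_pt_def[symmetric] using ab by (intro hull_inc) auto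
    qed
    have p2: "X.pt (Complex t (- k)) \<in> polygon n A"
    proof -
      have "Y.arc_pt (1 - t) \<in> side n A b" using t by (auto simp: sb)
      moreover have "Y.arc_pt (1 - t) = X.pt (Complex t (- k))"
        unfolding Yarc k_def by (simp add: mult.commute)
      ultimately show ?thesis
        unfolding polygon_def using ab by (intro hull_inc) auto
    qed
    show ?thesis
    proof (cases "k = 0")
      case True
      then show ?thesis using p1 hk by (simp add: \<zeta> zeta)
    next
      case False
      define u where "u = (h + k) / (2 * k)"
      have u: "0 \<le> u" "u \<le> 1" using hk False \<open>0 \<le> k\<close> by (auto simp: u_def divide_simps)
      have "z = (1 - u) *\<^sub>R X.pt (Complex t (- k)) + u *\<^sub>R X.pt (Complex t k)"
      proof -
        have "h = (1 - u) * (- k) + u * k" using False by (simp add: u_def field_simps)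
        then have eq: "Complex t h = (1 - u) *\<^sub>R Complex t (- k) + u *\<^sub>R Complex t k"
          by (simp add: complex_eq_iff algebra_simps)
        show ?thesis
          unfolding \<zeta> zeta eq X.pt_def by (simp add: scaleR_conv_of_real algebra_simps)
      qed
      moreover have "convex (polygon n A)" by (simp add: polygon_def)
      ultimately show ?thesis using p1 p2 u by (simp add: convexD_alt)
    qed
  qed
  then show ?thesis using sub ab by auto
qed

lemma polygon_eq:
  assumes A: "A \<in> \<pi>" shows "polygon n A = (\<Inter>a\<in>A. F a)"
proof -
  have "card A > 0" using block_fin[OF A] block_ne[OF A] by (simp add: card_gt_0_iff)
  then consider "card A = 1" | "card A = 2" | "card A \<ge> 3" by linarith
  then show ?thesis
  proof cases
    case 1
    then obtain i where i: "A = {i}" by (auto simp: card_1_singleton_iff)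
    then have "blk i = A" using blk_eq A by blast
    then show ?thesis
      using convex_hull_sphere_eq[OF thinness_bounds(1)[OF n]] 1 i
      by (simp add: polygon_def side_def Let_def F_single circ_of_nat)
  qed (use polygon_eq_digon polygon_eq_big A in auto)
qed

end

section \<open>The white regions\<close>

context nc_partition
begin

lemma block_range: "A \<in> \<pi> \<Longrightarrow> i \<in> A \<Longrightarrow> i \<in> {1..n}"
  using block_sub by blast

lemma closed_F: "i \<in> {1..n} \<Longrightarrow> closed (F i)"
  using compact_F by (rule compact_imp_closed)

definition white_area :: "complex set" where
  "white_area = cball 0 1 - \<Union> (yellow_regions n \<pi>)"

definition wclass :: "nat \<Rightarrow> nat set" where
  "wclass i = {j \<in> {1..n}. weq i j}"

definition wregion :: "nat \<Rightarrow> complex set" where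
  "wregion i = cball 0 1 - (\<Union>j\<in>wclass i. F j)"

lemma wclass_cong: "weq i j \<Longrightarrow> wclass i = wclass j"
  unfolding wclass_def using weq_trans weq_sym by blast

lemma finite_wclass: "finite (wclass i)"
  by (simp add: wclass_def)

lemma polygon_sub_F: "A \<in> \<pi> \<Longrightarrow> a \<in> A \<Longrightarrow> polygon n A \<subseteq> F a"
  by (auto simp: polygon_eq)

lemma separated_F:
  assumes "A \<in> \<pi>" "B \<in> \<pi>" "A \<noteq> B"
  obtains a b where "a \<in> A" "b \<in> B" "F a \<inter> F b = {}"
proof -
  obtain a b where ab: "a \<in> A" "b \<in> B"
    "(a < b \<and> b < ge a \<and> a + n < ge b) \<or> (b < a \<and> a < ge b \<and> b + n < ge a)"
    by (rule blocks_separated[OF assms])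
  have "F a \<inter> F b = {}"
    using ab(3) F_disjoint[OF block_range block_range, of A a B b]
      F_disjoint[OF block_range block_range, of B b A a] assms ab by blast
  then show ?thesis using that ab by blast
qed

lemma polygons_disjoint:
  assumes "A \<in> \<pi>" "B \<in> \<pi>" "A \<noteq> B" shows "polygon n A \<inter> polygon n B = {}"
proof -
  obtain a b where ab: "a \<in> A" "b \<in> B" "F a \<inter> F b = {}" by (rule separated_F[OF assms])
  then show ?thesis using polygon_sub_F[OF assms(1) ab(1)] polygon_sub_F[OF assms(2) ab(2)] by blast
qed

text \<open>Every polygon A lies in \<open>F k\<close> for some side k of the region, namely the k
  of \<open>block_avoids_gap\<close>. If A is not the block of k, separate the two blocks by
  disjoint \<open>F a\<close> and \<open>F b\<close>. The least point of A lies in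
  \<open>F a\<close> and \<open>F k\<close>, so b differs from k; then \<open>F b\<close> and
  \<open>F k\<close> cover the disk, and \<open>F a\<close> \<subseteq> \<open>F k\<close>.\<close>

lemma wregion_sub: "i \<in> {1..n} \<Longrightarrow> wregion i \<subseteq> white_area"
proof -
  assume i: "i \<in> {1..n}"
  have "\<exists>k\<in>wclass i. polygon n A \<subseteq> F k" if A: "A \<in> \<pi>" for A
  proof -
    define m where "m = Min A"
    have m: "m \<in> A" using block_fin[OF A] block_ne[OF A] by (simp add: m_def)
    obtain k where k: "k \<in> {1..n}" "weq i k" "\<not> (k < m \<and> m < ge k)" "\<not> m + n < ge k"
      using block_avoids_gap[OF i A m_def] by blast
    have mk: "point n m \<in> F k"
      using point_F[OF k(1) block_range[OF A m]] k by (simp add: point_in_gap_def)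
    have "polygon n A \<subseteq> F k"
    proof (cases "A = blk k")
      case True
      then show ?thesis using polygon_sub_F[OF A] blk(2)[OF k(1)] by blast
    next
      case False
      obtain a b where ab: "a \<in> A" "b \<in> blk k" "F a \<inter> F b = {}"
        by (rule separated_F[OF A blk(1)[OF k(1)] False])
      have "point n m \<in> F a" using block_points_F[OF A ab(1) m] .
      then have "b \<noteq> k" using mk ab by blast
      then have "cball 0 1 \<subseteq> F b \<union> F k"
        using F_cover[OF blk(1)[OF k(1)] ab(2) blk(2)[OF k(1)]] by simp
      moreover have "F a \<subseteq> cball 0 1" using F_disk[OF block_range[OF A ab(1)]] .
      ultimately show ?thesis using polygon_sub_F[OF A ab(1)] ab(3) by blast
    qed
    then show ?thesis using k by (auto simp: wclass_def)
  qed
  then show ?thesis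
    unfolding wregion_def white_area_def yellow_regions_def by blast
qed

text \<open>Each \<open>F j\<close> is convex and meets the complement of the open disk, together with the other
  \<open>F k\<close>, in a circular arc; so Janiszewski's theorem allows the removal of one \<open>F j\<close> after the
  other.\<close>

lemma connected_wregion:
  assumes i: "i \<in> {1..n}" shows "connected (wregion i)"
proof -
  have step: "connected_component (- (- ball 0 1 \<union> (\<Union>j\<in>J. F j))) a b"
    if "finite J" "J \<subseteq> wclass i" "a \<in> ball 0 1 - (\<Union>j\<in>J. F j)" "b \<in> ball 0 1 - (\<Union>j\<in>J. F j)"
    for J a b
    using that
  proof (induction J rule: finite_induct)
    case empty
    then show ?case
      using connected_iff_connected_component[of "ball (0::complex) 1"] by auto
  next
    case (insert j J)
    have jn: "j \<in> {1..n}" and Jn: "J \<subseteq> {1..n}" using insert.prems by (auto simp: wclass_def)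
    define T where "T = - ball 0 1 \<union> (\<Union>k\<in>J. F k)"
    have T: "closed T"
      unfolding T_def using insert.hyps(1) Jn closed_F
      by (intro closed_Un closed_UN) auto
    have dj: "F j \<inter> F k = {}" if "k \<in> J" for k
      using that insert.hyps insert.prems(1) jn Jn weq_trans[OF weq_sym, of i j k]
      by (intro F_disjoint_weq) (auto simp: wclass_def)
    have "F j \<inter> T = F j \<inter> sphere 0 1"
      using dj F_disk[OF jn] by (auto simp: T_def)
    then have con: "connected (F j \<inter> T)" using connected_F_sphere[OF jn] by simp
    have "connected (- F j)"
      using compact_F[OF jn] convex_F[OF jn]
      by (intro connected_complement_bounded_convex) (auto simp: compact_imp_bounded)
    then have 1: "connected_component (- F j) a b"
      using insert.prems connected_iff_connected_component by auto
    have 2: "connected_component (- T) a b"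
      using insert unfolding T_def by auto
    have "connected_component (- (F j \<union> T)) a b"
      by (rule Janiszewski[OF compact_F[OF jn] T con 1 2])
    moreover have "F j \<union> T = - ball 0 1 \<union> (\<Union>k\<in>insert j J. F k)"
      by (auto simp: T_def)
    ultimately show ?case by simp
  qed
  define N where "N = - (\<Union>j\<in>wclass i. F j)"
  have "closed (\<Union>j\<in>wclass i. F j)"
    using finite_wclass closed_F by (intro closed_UN) (auto simp: wclass_def)
  then have N: "open N" unfolding N_def by (rule open_Compl)
  have "N \<inter> ball 0 1 = - (- ball 0 1 \<union> (\<Union>j\<in>wclass i. F j))" by (auto simp: N_def)
  then have "connected (N \<inter> ball 0 1)"
    using step[OF finite_wclass order_refl] by (auto simp: connected_iff_connected_component N_def)
  moreover have "N \<inter> ball 0 1 \<subseteq> wregion i" by (auto simp: wregion_def N_def)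
  \<comment> \<open>Connectedness has been obtained in the open disk only; the points of the region
    on the circle are limits of it.\<close>
  moreover have "wregion i \<subseteq> closure (N \<inter> ball 0 1)"
  proof -
    have "wregion i = N \<inter> closure (ball 0 1)" by (auto simp: wregion_def N_def)
    then show ?thesis using open_Int_closure_subset[OF N, of "ball 0 1"] by (simp only:)
  qed
  ultimately show ?thesis by (rule connected_intermediate_closure)
qed

text \<open>Among the gaps containing \<open>z\<close>, one for each block, choose a shortest one.\<close>

lemma white_area_cover:
  assumes z: "z \<in> white_area" shows "\<exists>i\<in>{1..n}. z \<in> wregion i"
proof -
  have zd: "z \<in> cball 0 1" using z by (simp add: white_area_def)
  have ex: "\<exists>a\<in>A. z \<notin> F a" if "A \<in> \<pi>" for A
    using z that by (auto simp: white_area_def yellow_regions_def polygon_eq)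
  define S where "S = {a \<in> {1..n}. z \<notin> F a}"
  have one: "1 \<in> {1..n}" using n by simp
  obtain b where "b \<in> blk 1" "z \<notin> F b" using ex[OF blk(1)[OF one]] by blast
  then have "b \<in> S" using block_range[OF blk(1)[OF one]] by (simp add: S_def)
  then obtain a where a: "a \<in> S" and amin: "\<And>b. b \<in> S \<Longrightarrow> ge a - a \<le> ge b - b"
    using ex_has_least_nat[of "\<lambda>a. a \<in> S" b "\<lambda>a. ge a - a"] by blast
  have an: "a \<in> {1..n}" using a by (simp add: S_def)
  have "z \<notin> F i" if i: "i \<in> wclass a" for i
  proof
    assume zi: "z \<in> F i"
    have i': "i \<in> {1..n}" "weq a i" "i \<noteq> a" using i zi a by (auto simp: wclass_def S_def)
    obtain b where b: "b \<in> blk i" "z \<notin> F b" using ex[OF blk(1)[OF i'(1)]] by blast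
    have "b \<in> S" using b block_range[OF blk(1)[OF i'(1)]] by (simp add: S_def)
    then show False
      using gap_shorter[OF i'(1) an i'(2,3) b(1)] amin[OF \<open>b \<in> S\<close>] b zi by (cases "b = i") auto
  qed
  then have "z \<in> wregion a" using zd by (auto simp: wregion_def)
  then show ?thesis using an by blast
qed

lemma mid_wregion: "i \<in> {1..n} \<Longrightarrow> mid i \<in> wregion i"
proof -
  assume i: "i \<in> {1..n}"
  have "mid i \<notin> F j" if j: "j \<in> wclass i" for j
  proof -
    have jn: "j \<in> {1..n}" and w: "weq i j" using j by (auto simp: wclass_def)
    have "arc_in_gap j j" using ge_bounds[OF jn] by (simp add: arc_in_gap_def)
    then have "arc_in_gap j i" using arc_in_gap_weq[OF jn i jn w] by simp
    then show ?thesis using mid_F[OF jn i] by simp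
  qed
  then show ?thesis by (auto simp: wregion_def)
qed

text \<open>The complements of \<open>F a\<close> and of the intersection of the other parts are
  open; they cover S because S avoids the polygon, and they are disjoint on the disk by
  \<open>F_cover\<close>.\<close>

lemma connected_in_one_gap:
  assumes S: "connected S" "S \<subseteq> white_area" and A: "A \<in> \<pi>" "a \<in> A" and x: "x \<in> S" "x \<notin> F a"
  shows "S \<inter> F a = {}"
proof -
  define R where "R = (\<Inter>b\<in>A - {a}. F b)"
  have "S \<inter> polygon n A = {}" using S A by (auto simp: white_area_def yellow_regions_def)
  moreover have "polygon n A = F a \<inter> R" using A by (auto simp: polygon_eq R_def)
  ultimately have 1: "S \<inter> (F a \<inter> R) = {}" by simp
  have "closed (F a)" "closed R"
    using closed_F[OF block_range[OF A(1)]] A(2) by (auto simp: R_def)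
  then have op: "open (- F a)" "open (- R)" by auto
  have "- F a \<inter> - R \<inter> S = {}"
    using F_cover[OF A] S(2) by (auto simp: R_def white_area_def)
  then have "- F a \<inter> S = {} \<or> - R \<inter> S = {}"
    using 1 by (intro connectedD[OF S(1) op]) auto
  then show ?thesis using x 1 by blast
qed

lemma connected_weq:
  assumes S: "connected S" "S \<subseteq> white_area" and ij: "i \<in> {1..n}" "j \<in> {1..n}" "mid i \<in> S" "mid j \<in> S"
  shows "weq i j"
proof -
  have *: "weq i j" if ij: "i \<in> {1..n}" "j \<in> {1..n}" "mid i \<in> S" "mid j \<in> S" "i < j" for i j
  proof (rule weq_if_same_gaps[OF ij(1,2,5)])
    fix A assume A: "A \<in> \<pi>"
    have "mid i \<notin> polygon n A" using ij S A by (auto simp: white_area_def yellow_regions_def)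
    then obtain a where a: "a \<in> A" "mid i \<notin> F a" using A by (auto simp: polygon_eq)
    then have "mid j \<notin> F a" using connected_in_one_gap[OF S A a(1) ij(3) a(2)] ij by blast
    then show "\<exists>a\<in>A. arc_in_gap a i \<and> arc_in_gap a j"
      using a mid_F[OF block_range[OF A a(1)]] ij by blast
  qed
  show ?thesis
  proof (cases i j rule: linorder_cases)
    case less
    then show ?thesis using *[of i j] ij by blast
  next
    case equal
    then show ?thesis by (simp add: weq_refl)
  next
    case greater
    then show ?thesis using *[of j i] ij weq_sym by blast
  qed
qed

lemma wregion_eq_component:
  assumes i: "i \<in> {1..n}" shows "wregion i = connected_component_set white_area (mid i)"
proof
  let ?C = "connected_component_set white_area (mid i)"
  show "wregion i \<subseteq> ?C"
    using mid_wregion[OF i] wregion_sub[OF i] connected_wregion[OF i]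
    by (intro connected_component_maximal)
  show "?C \<subseteq> wregion i"
  proof
    fix z assume z: "z \<in> ?C"
    then have "z \<in> white_area" using connected_component_subset by blast
    then obtain j where j: "j \<in> {1..n}" "z \<in> wregion j" using white_area_cover by blast
    have "connected (?C \<union> wregion j)"
      using z j connected_wregion by (intro connected_Un) auto
    moreover have "mid i \<in> ?C"
      using mid_wregion[OF i] wregion_sub[OF i] by (auto simp: connected_component_refl_eq)
    ultimately have "weq i j"
      using i j mid_wregion[OF j(1)] wregion_sub[OF j(1)] connected_component_subset[of white_area "mid i"]
      by (intro connected_weq[of "?C \<union> wregion j"]) auto
    then show "z \<in> wregion i" using j wclass_cong by (simp add: wregion_def)
  qed
qed

lemma white_regions_eq: "white_regions n \<pi> = wregion ` {1..n}"
proof -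
  have "white_regions n \<pi> = connected_component_set white_area ` white_area"
    by (simp add: white_regions_def white_area_def components_def)
  also have "\<dots> = wregion ` {1..n}"
  proof (intro equalityI subsetI)
    fix X assume "X \<in> connected_component_set white_area ` white_area"
    then obtain z where z: "z \<in> white_area" "X = connected_component_set white_area z" by blast
    obtain i where i: "i \<in> {1..n}" "z \<in> wregion i" using white_area_cover[OF z(1)] by blast
    have "X = wregion i"
      using i z wregion_eq_component[OF i(1)] by (metis connected_component_eq)
    then show "X \<in> wregion ` {1..n}" using i by blast
  next
    fix X assume "X \<in> wregion ` {1..n}"
    then obtain i where "i \<in> {1..n}" "X = wregion i" by blast
    then show "X \<in> connected_component_set white_area ` white_area"
      using wregion_eq_component mid_wregion wregion_sub by blast
  qed
  finally show ?thesis .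
qed

section \<open>Adjacency of regions along sides\<close>

lemma wregion_meet:
  assumes "i \<in> {1..n}" "j \<in> {1..n}" "wregion i \<inter> wregion j \<noteq> {}" shows "weq i j"
  using assms mid_wregion wregion_sub connected_wregion
  by (intro connected_weq[of "wregion i \<union> wregion j"] connected_Un) auto

lemma wregion_eq_iff:
  assumes "i \<in> {1..n}" "j \<in> {1..n}" shows "wregion i = wregion j \<longleftrightarrow> weq i j"
proof
  show "weq i j" if "wregion i = wregion j"
    using wregion_meet[OF assms] mid_wregion[OF assms(1)] that by blast
qed (simp add: wregion_def wclass_cong)

text \<open>The other parts \<open>F k\<close> of the region are closed and disjoint from
  \<open>F i\<close>, so near the side only \<open>F i\<close> matters, and
  \<open>side_limit\<close> applies.\<close>

lemma side_adjacent: assumes i: "i \<in> {1..n}" shows "side_from n \<pi> i \<subseteq> closure (wregion i)"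
proof
  fix s assume s: "s \<in> side_from n \<pi> i"
  define N where "N = - (\<Union>k\<in>wclass i - {i}. F k)"
  have "closed (\<Union>k\<in>wclass i - {i}. F k)"
    using finite_wclass closed_F by (intro closed_UN) (auto simp: wclass_def)
  then have N: "open N" unfolding N_def by (rule open_Compl)
  have "s \<in> F i" using s side_F[OF i] by blast
  then have "s \<in> N" using F_disjoint_weq[OF i] by (auto simp: N_def wclass_def)
  moreover have "s \<in> closure (cball 0 1 - F i)" using s side_limit[OF i] by blast
  ultimately have "s \<in> closure (N \<inter> (cball 0 1 - F i))" using open_Int_closure_subset[OF N] by blast
  moreover have "N \<inter> (cball 0 1 - F i) \<subseteq> wregion i" by (auto simp: N_def wregion_def)
  ultimately show "s \<in> closure (wregion i)" using closure_mono by blast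
qed

text \<open>A point of another region lies in some \<open>F k\<close> with k in the class of i. If k
  = i it is outside the polygon and hence beyond another side b of the block. Replacing these
  possibilities by closed conditions gives a closed set \<open>C\<close> that contains the region
  but not the point from \<open>side_point\<close>.\<close>

lemma side_not_adjacent:
  assumes i: "i \<in> {1..n}" and j: "j \<in> {1..n}" and ij: "\<not> weq i j"
  shows "\<not> side_from n \<pi> i \<subseteq> closure (wregion j)"
proof
  assume sub: "side_from n \<pi> i \<subseteq> closure (wregion j)"
  note B = blk[OF i]
  obtain s where s: "s \<in> side_from n \<pi> i"
    and neg: "\<And>b. b \<in> blk i \<Longrightarrow> b \<noteq> i \<Longrightarrow> cap_height n b (ge b) s < 0"
    using side_point[OF i] by blast
  define C where "C = (\<Union>k\<in>wclass i - {i}. F k) \<union> (\<Union>b\<in>blk i - {i}. {z. cap_height n b (ge b) z \<ge> 0})"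
  have "closed C"
    unfolding C_def
  proof (intro closed_Un closed_UN)
    show "\<forall>k\<in>wclass i - {i}. closed (F k)"
      using closed_F by (auto simp: wclass_def)
    show "\<forall>b\<in>blk i - {i}. closed {z. cap_height n b (ge b) z \<ge> 0}"
      by (intro ballI closed_Collect_le continuous_on_const continuous_on_cap_height)
  qed (use finite_wclass block_fin[OF B(1)] in auto)
  moreover have "wregion j \<subseteq> C"
  proof
    fix z assume z: "z \<in> wregion j"
    then have zd: "z \<in> cball 0 1" by (simp add: wregion_def)
    have "z \<notin> wregion i" using wregion_meet[OF i j] z ij by blast
    then obtain k where k: "k \<in> wclass i" "z \<in> F k" using zd by (auto simp: wregion_def)
    show "z \<in> C"
    proof (cases "k = i")
      case False
      then show ?thesis using k by (auto simp: C_def)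
    next
      case True
      have "z \<notin> polygon n (blk i)"
        using wregion_sub[OF j] z B by (auto simp: white_area_def yellow_regions_def)
      then obtain b where b: "b \<in> blk i" "z \<notin> F b" using B by (auto simp: polygon_eq)
      then have bi: "b \<noteq> i" using k True by auto
      have "card (blk b) \<noteq> 1"
        unfolding blk_eq[OF B(1) b(1)] using b bi B(2) by (metis card_1_singletonE singletonD)
      then have "cap_height n b (ge b) z > 0"
        using F_outside[OF block_range[OF B(1) b(1)]] b zd by blast
      then have "z \<in> {z. cap_height n b (ge b) z \<ge> 0}" by simp
      then show ?thesis using b bi unfolding C_def by blast
    qed
  qed
  ultimately have "closure (wregion j) \<subseteq> C" by (intro closure_minimal)
  then have "s \<in> C" using s sub by blast
  moreover have "s \<notin> F k" if "k \<in> wclass i - {i}" for k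
    using F_disjoint_weq[OF i, of k] that s side_F[OF i] by (auto simp: wclass_def)
  ultimately show False using neg by (auto simp: C_def not_le[symmetric])
qed

lemma closed_polygon: "A \<in> \<pi> \<Longrightarrow> closed (polygon n A)"
  using closed_F[OF block_range] by (auto simp: polygon_eq)

lemma side_polygon: "i \<in> {1..n} \<Longrightarrow> side_from n \<pi> i \<subseteq> polygon n (blk i)"
  using blk(2)[of i] by (auto simp: polygon_def side_from_def intro!: hull_inc)

lemma ends_polygon_tree:
  assumes i: "i \<in> {1..n}"
  shows "ends (polygon_tree n \<pi>) i = {polygon n (blk i), wregion i}"
proof -
  obtain s where s: "s \<in> side_from n \<pi> i" using side_point[OF i] by blast
  have Y: "side_from n \<pi> i \<subseteq> closure (polygon n A) \<longleftrightarrow> A = blk i" if A: "A \<in> \<pi>" for A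
    using closed_polygon[OF A] polygons_disjoint[OF A blk(1)[OF i]] side_polygon[OF i] s by auto
  have W: "side_from n \<pi> i \<subseteq> closure (wregion j) \<longleftrightarrow> wregion j = wregion i" if j: "j \<in> {1..n}" for j
    using side_adjacent[OF i] side_not_adjacent[OF i j] wregion_eq_iff[OF i j] by metis
  have "ends (polygon_tree n \<pi>) i = {X \<in> polygon n ` \<pi> \<union> wregion ` {1..n}. side_from n \<pi> i \<subseteq> closure X}"
    by (simp add: polygon_tree_def yellow_regions_def white_regions_eq)
  also have "\<dots> = {polygon n (blk i), wregion i}"
  proof (intro equalityI subsetI)
    fix X assume "X \<in> {X \<in> polygon n ` \<pi> \<union> wregion ` {1..n}. side_from n \<pi> i \<subseteq> closure X}"
    then show "X \<in> {polygon n (blk i), wregion i}" using Y W by auto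
  next
    fix X assume "X \<in> {polygon n (blk i), wregion i}"
    then show "X \<in> {X \<in> polygon n ` \<pi> \<union> wregion ` {1..n}. side_from n \<pi> i \<subseteq> closure X}"
      using Y[OF blk(1)[OF i]] W[OF i] blk(1)[OF i] i by blast
  qed
  finally show ?thesis .
qed

lemma polygon_ne: "A \<in> \<pi> \<Longrightarrow> polygon n A \<noteq> {}"
  using block_ne[of A] block_points_F by (fastforce simp: polygon_eq)

lemma polygon_eq_iff: "A \<in> \<pi> \<Longrightarrow> B \<in> \<pi> \<Longrightarrow> polygon n A = polygon n B \<longleftrightarrow> A = B"
  using polygons_disjoint[of A B] polygon_ne[of A] by auto

lemma wregion_not_yellow: "i \<in> {1..n} \<Longrightarrow> wregion i \<notin> yellow_regions n \<pi>"
  using wregion_sub[of i] mid_wregion[of i] by (auto simp: white_area_def yellow_regions_def)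

end

section \<open>Bicolored plane graphs as pairs of permutations of their edges\<close>

lemma cyclic_on_inj: assumes "cyclic_on f S" shows "inj_on f S"
proof -
  have "S \<subseteq> f ` S"
  proof
    fix g assume g: "g \<in> S"
    then have "g \<in> orbit f g" using orbit_cyclic_eq3[OF assms g] by simp
    then obtain h where "h = g \<or> h \<in> orbit f g" "g = f h" by (cases rule: orbit.cases) auto
    then show "g \<in> f ` S" using g orbit_cyclic_eq3[OF assms g] by auto
  qed
  then have "f ` S = S" using cyclic_on_inI[OF assms] by auto
  then show ?thesis using finite_cyclic_on[OF assms] by (intro eq_card_imp_inj_on) auto
qed

lemma walk_append: "walk G u es v \<Longrightarrow> walk G v fs x \<Longrightarrow> walk G u (es @ fs) x"
  by (induction es arbitrary: u) auto

text \<open>\<open>Y e\<close> and \<open>W e\<close> are the yellow and the white end of \<open>e\<close>; \<open>y\<close> and \<open>w\<close> rotate the edges around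
  the yellow, respectively white vertices.\<close>

locale bicol =
  fixes G :: "('v, 'e) plane_graph" and Y W :: "'e \<Rightarrow> 'v" and y w :: "'e \<Rightarrow> 'e"
  assumes fin: "finite (edges G)"
    and verts: "vertices G = Y ` edges G \<union> W ` edges G"
    and ends: "e \<in> edges G \<Longrightarrow> ends G e = {Y e, W e}"
    and colY: "e \<in> edges G \<Longrightarrow> color_of G (Y e) = Yellow"
    and colW: "e \<in> edges G \<Longrightarrow> color_of G (W e) = White"
    and nextY: "e \<in> edges G \<Longrightarrow> next_edge G (Y e) e = y e"
    and nextW: "e \<in> edges G \<Longrightarrow> next_edge G (W e) e = w e"
    and cycY: "e \<in> edges G \<Longrightarrow> cyclic_on y {f \<in> edges G. Y f = Y e}"
    and cycW: "e \<in> edges G \<Longrightarrow> cyclic_on w {f \<in> edges G. W f = W e}"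
begin

lemma Y_neq_W: "e \<in> edges G \<Longrightarrow> f \<in> edges G \<Longrightarrow> Y e \<noteq> W f"
  using colY colW by (metis color.distinct(1))

lemma edges_at_Y: "e \<in> edges G \<Longrightarrow> edges_at G (Y e) = {f \<in> edges G. Y f = Y e}"
  using Y_neq_W Y_neq_W[symmetric] by (auto simp: edges_at_def ends)

lemma edges_at_W: "e \<in> edges G \<Longrightarrow> edges_at G (W e) = {f \<in> edges G. W f = W e}"
  using Y_neq_W Y_neq_W[symmetric] by (auto simp: edges_at_def ends)

lemma y_in: "e \<in> edges G \<Longrightarrow> y e \<in> edges G \<and> Y (y e) = Y e"
  using cyclic_on_inI[OF cycY, of e e] by simp

lemma w_in: "e \<in> edges G \<Longrightarrow> w e \<in> edges G \<and> W (w e) = W e"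
  using cyclic_on_inI[OF cycW, of e e] by simp

lemma orbit_y: "e \<in> edges G \<Longrightarrow> orbit y e = {f \<in> edges G. Y f = Y e}"
  using orbit_cyclic_eq3[OF cycY, of e e] by simp

lemma orbit_w: "e \<in> edges G \<Longrightarrow> orbit w e = {f \<in> edges G. W f = W e}"
  using orbit_cyclic_eq3[OF cycW, of e e] by simp

lemma inj_on_y: "inj_on y (edges G)"
proof (rule inj_onI)
  fix e f assume e: "e \<in> edges G" "f \<in> edges G" "y e = y f"
  then have "Y f = Y e" using y_in by metis
  then show "e = f" using inj_onD[OF cyclic_on_inj[OF cycY[OF e(1)]]] e by auto
qed

lemma inj_on_w: "inj_on w (edges G)"
proof (rule inj_onI)
  fix e f assume e: "e \<in> edges G" "f \<in> edges G" "w e = w f"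
  then have "W f = W e" using w_in by metis
  then show "e = f" using inj_onD[OF cyclic_on_inj[OF cycW[OF e(1)]]] e by auto
qed

text \<open>The two hypotheses certify a tree: the single cycle of y after w leads from each yellow
  vertex to every other one, and a vertex set X that only the edge e leaves shows that no closed
  walk with distinct edges passes through e.\<close>

lemma plane_treeI:
  assumes ne: "edges G \<noteq> {}" and cyc: "cyclic_on (\<lambda>e. y (w e)) (edges G)"
    and cut: "\<And>e. e \<in> edges G \<Longrightarrow> \<exists>X. (Y e \<in> X) \<noteq> (W e \<in> X) \<and> (\<forall>f\<in>edges G. f \<noteq> e \<longrightarrow> (Y f \<in> X \<longleftrightarrow> W f \<in> X))"
  shows "bicolored_plane_tree G"
proof -
  have vY: "Y e \<in> vertices G" "W e \<in> vertices G" if "e \<in> edges G" for e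
    using that verts by auto
  have one: "walk G (Y e) [e] (W e)" "walk G (W e) [e] (Y e)" if "e \<in> edges G" for e
    using that vY ends by auto
  have step: "\<exists>es. walk G (Y e) es (Y (y (w e)))" if e: "e \<in> edges G" for e
  proof -
    have "W (w e) = W e" "w e \<in> edges G" "Y (y (w e)) = Y (w e)" using w_in[OF e] y_in by auto
    then have "walk G (W e) [w e] (Y (y (w e)))"
      using one(2)[of "w e"] by metis
    then have "walk G (Y e) ([e] @ [w e]) (Y (y (w e)))"
      by (rule walk_append[OF one(1)[OF e]])
    then show ?thesis by blast
  qed
  have conY: "\<exists>es. walk G (Y e) es (Y f)" if "e \<in> edges G" "f \<in> edges G" for e f
  proof -
    have "f \<in> orbit (\<lambda>e. y (w e)) e" using orbit_cyclic_eq3[OF cyc that(1)] that(2) by simp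
    then show ?thesis
    proof induction
      case base
      then show ?case using step that by blast
    next
      case (step f)
      have "f \<in> edges G" using orbit_cyclic_eq3[OF cyc that(1)] step.hyps by simp
      then show ?case
        using step.IH \<open>\<And>e. e \<in> edges G \<Longrightarrow> \<exists>es. walk G (Y e) es (Y (y (w e)))\<close>[of f] walk_append by meson
    qed
  qed
  have con: "\<exists>es. walk G u es v" if uv: "u \<in> vertices G" "v \<in> vertices G" for u v
  proof -
    obtain e f where e: "e \<in> edges G" "u = Y e \<or> u = W e" and f: "f \<in> edges G" "v = Y f \<or> v = W f"
      using uv verts by auto
    then have "\<exists>es. walk G u es (Y e)" "\<exists>es. walk G (Y f) es v" using one conY by metis+
    then show ?thesis using conY[OF e(1) f(1)] walk_append by meson
  qed
  have "\<not> (\<exists>u es. es \<noteq> [] \<and> distinct es \<and> walk G u es u)"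
  proof (intro notI; elim exE conjE)
    fix u es assume es: "es \<noteq> []" "distinct es" "walk G u es u"
    obtain e fs where ef: "es = e # fs" using es(1) by (cases es) auto
    have e: "e \<in> edges G" "e \<notin> set fs" using es ef by auto
    obtain v where v: "{Y e, W e} = {u, v}" "walk G v fs u"
      using es(3) ef ends[OF e(1)] by auto
    obtain X where X: "(Y e \<in> X) \<noteq> (W e \<in> X)" "\<forall>f\<in>edges G. f \<noteq> e \<longrightarrow> (Y f \<in> X \<longleftrightarrow> W f \<in> X)"
      using cut[OF e(1)] by blast
    have "walk G a gs b \<Longrightarrow> e \<notin> set gs \<Longrightarrow> a \<in> X \<longleftrightarrow> b \<in> X" for a gs b
    proof (induction gs arbitrary: a)
      case (Cons g gs)
      then obtain c where c: "g \<in> edges G" "ends G g = {a, c}" "walk G c gs b" by auto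
      have "{Y g, W g} = {a, c}" using c ends by simp
      then have "a \<in> X \<longleftrightarrow> c \<in> X" using X(2) c(1) Cons.prems(2) by (auto simp: doubleton_eq_iff)
      then show ?case using Cons.IH[OF c(3)] Cons.prems(2) by simp
    qed simp
    from this[OF v(2) e(2)] show False using X(1) v(1) by (auto simp: doubleton_eq_iff)
  qed
  moreover have "cyclic_on (next_edge G v) (edges_at G v)" if "v \<in> vertices G" for v
  proof -
    obtain e where e: "e \<in> edges G" "v = Y e \<or> v = W e" using \<open>v \<in> vertices G\<close> verts by auto
    then show ?thesis
    proof (elim disjE)
      assume v: "v = Y e"
      have "cyclic_on (next_edge G v) {f \<in> edges G. Y f = Y e} = cyclic_on y {f \<in> edges G. Y f = Y e}"
        using nextY unfolding v by (intro cyclic_cong) (metis (mono_tags, lifting) mem_Collect_eq)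
      then show ?thesis using cycY[OF e(1)] edges_at_Y[OF e(1)] v by simp
    next
      assume v: "v = W e"
      have "cyclic_on (next_edge G v) {f \<in> edges G. W f = W e} = cyclic_on w {f \<in> edges G. W f = W e}"
        using nextW unfolding v by (intro cyclic_cong) (metis (mono_tags, lifting) mem_Collect_eq)
      then show ?thesis using cycW[OF e(1)] edges_at_W[OF e(1)] v by simp
    qed
  qed
  moreover have "\<forall>e\<in>edges G. \<exists>u\<in>vertices G. \<exists>v\<in>vertices G. ends G e = {u, v} \<and> color_of G u \<noteq> color_of G v"
    using ends colY colW vY by (metis color.distinct(1))
  ultimately show ?thesis
    using fin ne verts con
    by (auto simp: bicolored_plane_tree_def connected_graph_def acyclic_graph_def)
qed

end

text \<open>Every vertex has to be an end of some edge. This fails for the one-vertex tree, but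
  follows from connectedness once there is an edge.\<close>

lemma plane_tree_bicol:
  assumes T: "bicolored_plane_tree G" and ne: "edges G \<noteq> {}"
  obtains Y W y w where "bicol G Y W y w"
proof -
  have ex: "\<exists>u v. u \<in> vertices G \<and> v \<in> vertices G \<and> ends G e = {u, v} \<and> color_of G u = Yellow \<and> color_of G v = White"
    if e: "e \<in> edges G" for e
  proof -
    obtain u v where uv: "u \<in> vertices G" "v \<in> vertices G" "ends G e = {u, v}" "color_of G u \<noteq> color_of G v"
      using T e unfolding bicolored_plane_tree_def by blast
    then have "color_of G u = Yellow \<and> color_of G v = White \<or> color_of G v = Yellow \<and> color_of G u = White"
      by (cases "color_of G u"; cases "color_of G v") auto
    then show ?thesis using uv by (metis insert_commute)
  qed
  define Y where "Y = (\<lambda>e. SOME u. u \<in> vertices G \<and> u \<in> ends G e \<and> color_of G u = Yellow)"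
  define W where "W = (\<lambda>e. SOME u. u \<in> vertices G \<and> u \<in> ends G e \<and> color_of G u = White)"
  have Y: "Y e \<in> vertices G \<and> Y e \<in> ends G e \<and> color_of G (Y e) = Yellow" if "e \<in> edges G" for e
    unfolding Y_def by (rule someI_ex) (use ex[OF that] in blast)
  have W: "W e \<in> vertices G \<and> W e \<in> ends G e \<and> color_of G (W e) = White" if "e \<in> edges G" for e
    unfolding W_def by (rule someI_ex) (use ex[OF that] in blast)
  have YW: "ends G e = {Y e, W e}" if e: "e \<in> edges G" for e
  proof -
    have "Y e \<noteq> W e" using Y[OF e] W[OF e] by auto
    then show ?thesis using ex[OF e] Y[OF e] W[OF e] by auto
  qed
  have neq: "Y e \<noteq> W f" if "e \<in> edges G" "f \<in> edges G" for e f
    using Y[OF that(1)] W[OF that(2)] by auto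
  have atY: "edges_at G (Y e) = {f \<in> edges G. Y f = Y e}" if "e \<in> edges G" for e
    using YW neq[OF that] by (auto simp: edges_at_def)
  have atW: "edges_at G (W e) = {f \<in> edges G. W f = W e}" if "e \<in> edges G" for e
    using YW neq[OF _ that] neq[OF _ that, symmetric] by (auto simp: edges_at_def)
  have cyc: "cyclic_on (next_edge G v) (edges_at G v)" if "v \<in> vertices G" "edges_at G v \<noteq> {}" for v
    using T that by (auto simp: bicolored_plane_tree_def)
  have "bicol G Y W (\<lambda>e. next_edge G (Y e) e) (\<lambda>e. next_edge G (W e) e)"
  proof
    show "finite (edges G)" using T by (simp add: bicolored_plane_tree_def)
    show "vertices G = Y ` edges G \<union> W ` edges G"
    proof
      show "Y ` edges G \<union> W ` edges G \<subseteq> vertices G" using Y W by auto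
      show "vertices G \<subseteq> Y ` edges G \<union> W ` edges G"
      proof
        fix v assume v: "v \<in> vertices G"
        obtain e where e: "e \<in> edges G" using ne by blast
        obtain es where "walk G v es (Y e)"
          using T v Y[OF e] unfolding bicolored_plane_tree_def connected_graph_def by blast
        then show "v \<in> Y ` edges G \<union> W ` edges G"
        proof (cases es)
          case Nil
          then show ?thesis using \<open>walk G v es (Y e)\<close> e by auto
        next
          case (Cons f fs)
          then obtain u where "f \<in> edges G" "ends G f = {v, u}" using \<open>walk G v es (Y e)\<close> by auto
          then show ?thesis using YW[of f] by (auto simp: doubleton_eq_iff)
        qed
      qed
    qed
    fix e assume e: "e \<in> edges G"
    show "ends G e = {Y e, W e}" using YW[OF e] .
    show "color_of G (Y e) = Yellow" "color_of G (W e) = White" using Y[OF e] W[OF e] by auto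
    have "cyclic_on (next_edge G (Y e)) {f \<in> edges G. Y f = Y e}"
      using cyc[of "Y e"] Y[OF e] atY[OF e] e by auto
    moreover have "cyclic_on (next_edge G (Y e)) {f \<in> edges G. Y f = Y e}
        = cyclic_on (\<lambda>e. next_edge G (Y e) e) {f \<in> edges G. Y f = Y e}"
      by (intro cyclic_cong) auto
    ultimately show "cyclic_on (\<lambda>e. next_edge G (Y e) e) {f \<in> edges G. Y f = Y e}" by simp
    have "cyclic_on (next_edge G (W e)) {f \<in> edges G. W f = W e}"
      using cyc[of "W e"] W[OF e] atW[OF e] e by auto
    moreover have "cyclic_on (next_edge G (W e)) {f \<in> edges G. W f = W e}
        = cyclic_on (\<lambda>e. next_edge G (W e) e) {f \<in> edges G. W f = W e}"
      by (intro cyclic_cong) auto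
    ultimately show "cyclic_on (\<lambda>e. next_edge G (W e) e) {f \<in> edges G. W f = W e}" by simp
  qed auto
  then show ?thesis by (rule that)
qed

section \<open>Plane isomorphisms as conjugations of edge permutations\<close>

definition edge_iso :: "'e set \<Rightarrow> ('e \<Rightarrow> 'e) \<Rightarrow> ('e \<Rightarrow> 'e) \<Rightarrow> 'f set \<Rightarrow> ('f \<Rightarrow> 'f) \<Rightarrow> ('f \<Rightarrow> 'f) \<Rightarrow> ('e \<Rightarrow> 'f) \<Rightarrow> bool" where
  "edge_iso E y w E' y' w' \<psi> \<longleftrightarrow>
     bij_betw \<psi> E E' \<and> (\<forall>e\<in>E. \<psi> (y e) = y' (\<psi> e) \<and> \<psi> (w e) = w' (\<psi> e))"

lemma edge_iso_trans:
  "edge_iso E y w E' y' w' \<psi> \<Longrightarrow> edge_iso E' y' w' E'' y'' w'' \<psi>' \<Longrightarrow> edge_iso E y w E'' y'' w'' (\<psi>' \<circ> \<psi>)"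
  by (auto simp: edge_iso_def bij_betw_trans dest: bij_betwE)

lemma edge_iso_sym:
  assumes "edge_iso E y w E' y' w' \<psi>" "y ` E \<subseteq> E" "w ` E \<subseteq> E"
  shows "edge_iso E' y' w' E y w (inv_into E \<psi>)"
proof -
  have b: "bij_betw \<psi> E E'" and c: "\<And>e. e \<in> E \<Longrightarrow> \<psi> (y e) = y' (\<psi> e) \<and> \<psi> (w e) = w' (\<psi> e)"
    using assms(1) by (auto simp: edge_iso_def)
  have "inv_into E \<psi> (y' f) = y (inv_into E \<psi> f) \<and> inv_into E \<psi> (w' f) = w (inv_into E \<psi> f)" if f: "f \<in> E'" for f
  proof -
    obtain e where e: "e \<in> E" "f = \<psi> e" using b f by (auto simp: bij_betw_def)
    have "y e \<in> E" "w e \<in> E" using assms(2,3) e by auto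
    then show ?thesis
      using c[OF e(1)] e bij_betw_inv_into_left[OF b] by metis
  qed
  then show ?thesis using bij_betw_inv_into[OF b] by (simp add: edge_iso_def)
qed

text \<open>The edges at a vertex form one orbit of the rotation, and conjugation carries orbits to
  orbits. Hence an edge map induces a well-defined injective map of vertices.\<close>

lemma conjugate_fibres:
  assumes E: "\<And>e. e \<in> E \<Longrightarrow> cyclic_on y {f \<in> E. Y f = Y e}"
    and E': "\<And>e. e \<in> E' \<Longrightarrow> cyclic_on y' {f \<in> E'. Y' f = Y' e}"
    and \<psi>: "bij_betw \<psi> E E'" "\<And>e. e \<in> E \<Longrightarrow> \<psi> (y e) = y' (\<psi> e)" and e: "e \<in> E" "f \<in> E"
  shows "Y' (\<psi> e) = Y' (\<psi> f) \<longleftrightarrow> Y e = Y f"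
proof -
  have h: "\<psi> e \<in> E'" "\<psi> f \<in> E'" using \<psi>(1) e by (auto simp: bij_betw_def)
  have "cyclic_on y' (\<psi> ` {g \<in> E. Y g = Y e})"
    using \<psi>(2) by (intro cyclic_on_image[OF E[OF e(1)]]) auto
  then have "\<psi> ` {g \<in> E. Y g = Y e} = orbit y' (\<psi> e)"
    by (rule orbit_cyclic_eq3[symmetric]) (use e in auto)
  also have "\<dots> = {g \<in> E'. Y' g = Y' (\<psi> e)}"
    by (rule orbit_cyclic_eq3[OF E'[OF h(1)]]) (use h in simp)
  finally have "\<psi> f \<in> {g \<in> E'. Y' g = Y' (\<psi> e)} \<longleftrightarrow> f \<in> {g \<in> E. Y g = Y e}"
    using \<psi>(1) e by (auto simp: bij_betw_def inj_on_def)
  then show ?thesis using e h by auto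
qed

text \<open>Preservation of colours makes \<phi> send the yellow end of an edge to the yellow end of
  its image, so \<psi> commutes with both rotations. Conversely \<phi> is read off from \<psi> at an
  arbitrary edge of the vertex, which \<open>conjugate_fibres\<close> justifies.\<close>

lemma plane_iso_iff_edge_iso:
  assumes G: "bicol G Y W y w" and H: "bicol H Y' W' y' w'"
  shows "G \<simeq>\<^sub>p H \<longleftrightarrow> (\<exists>\<psi>. edge_iso (edges G) y w (edges H) y' w' \<psi>)"
proof
  interpret G: bicol G Y W y w by fact
  interpret H: bicol H Y' W' y' w' by fact
  assume "G \<simeq>\<^sub>p H"
  then obtain \<phi> \<psi> where \<phi>: "bij_betw \<phi> (vertices G) (vertices H)" and \<psi>: "bij_betw \<psi> (edges G) (edges H)"
    and en: "\<forall>e\<in>edges G. ends H (\<psi> e) = \<phi> ` ends G e"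
    and co: "\<forall>v\<in>vertices G. color_of H (\<phi> v) = color_of G v"
    and nx: "\<forall>v\<in>vertices G. \<forall>e\<in>edges_at G v. next_edge H (\<phi> v) (\<psi> e) = \<psi> (next_edge G v e)"
    unfolding plane_iso_def by (elim exE conjE) (rule that)
  have "\<psi> (y e) = y' (\<psi> e) \<and> \<psi> (w e) = w' (\<psi> e)" if e: "e \<in> edges G" for e
  proof -
    have h: "\<psi> e \<in> edges H" using \<psi> e by (auto simp: bij_betw_def)
    have v: "Y e \<in> vertices G" "W e \<in> vertices G" using e G.verts by auto
    have s: "{Y' (\<psi> e), W' (\<psi> e)} = {\<phi> (Y e), \<phi> (W e)}" using bspec[OF en e] G.ends[OF e] H.ends[OF h] by simp
    have "color_of H (\<phi> (Y e)) = Yellow" "color_of H (\<phi> (W e)) = White"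
      using co v G.colY[OF e] G.colW[OF e] by auto
    then have "\<phi> (Y e) = Y' (\<psi> e) \<and> \<phi> (W e) = W' (\<psi> e)"
      using s H.colY[OF h] H.colW[OF h] by (auto simp: doubleton_eq_iff)
    moreover have "e \<in> edges_at G (Y e)" "e \<in> edges_at G (W e)"
      using e G.edges_at_Y G.edges_at_W by auto
    ultimately show ?thesis
      using bspec[OF bspec[OF nx v(1)], of e] bspec[OF bspec[OF nx v(2)], of e]
        G.nextY[OF e] G.nextW[OF e] H.nextY[OF h] H.nextW[OF h] by simp
  qed
  then show "\<exists>\<psi>. edge_iso (edges G) y w (edges H) y' w' \<psi>"
    using \<psi> by (auto simp: edge_iso_def)
next
  interpret G: bicol G Y W y w by fact
  interpret H: bicol H Y' W' y' w' by fact
  assume "\<exists>\<psi>. edge_iso (edges G) y w (edges H) y' w' \<psi>"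
  then obtain \<psi> where i: "edge_iso (edges G) y w (edges H) y' w' \<psi>" by blast
  then have \<psi>: "bij_betw \<psi> (edges G) (edges H)"
    and c: "\<And>e. e \<in> edges G \<Longrightarrow> \<psi> (y e) = y' (\<psi> e) \<and> \<psi> (w e) = w' (\<psi> e)"
    by (auto simp: edge_iso_def)
  have h: "\<psi> e \<in> edges H" if "e \<in> edges G" for e using \<psi> that by (auto simp: bij_betw_def)
  have eq: "Y' (\<psi> e) = Y' (\<psi> f) \<longleftrightarrow> Y e = Y f" "W' (\<psi> e) = W' (\<psi> f) \<longleftrightarrow> W e = W f"
    if "e \<in> edges G" "f \<in> edges G" for e f
    using conjugate_fibres[OF G.cycY H.cycY \<psi> _ that] conjugate_fibres[OF G.cycW H.cycW \<psi> _ that] c by auto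
  define \<phi> where "\<phi> = (\<lambda>v. if \<exists>e\<in>edges G. v = Y e then Y' (\<psi> (SOME e. e \<in> edges G \<and> v = Y e))
      else W' (\<psi> (SOME e. e \<in> edges G \<and> v = W e)))"
  have \<phi>Y: "\<phi> (Y e) = Y' (\<psi> e)" if e: "e \<in> edges G" for e
  proof -
    define f where "f = (SOME f. f \<in> edges G \<and> Y e = Y f)"
    have f: "f \<in> edges G \<and> Y e = Y f" unfolding f_def by (rule someI[of _ e]) (use e in simp)
    then have "\<phi> (Y e) = Y' (\<psi> f)" using e by (auto simp: \<phi>_def f_def)
    then show ?thesis using eq(1)[OF e, of f] f by simp
  qed
  have \<phi>W: "\<phi> (W e) = W' (\<psi> e)" if e: "e \<in> edges G" for e
  proof -
    define f where "f = (SOME f. f \<in> edges G \<and> W e = W f)"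
    have f: "f \<in> edges G \<and> W e = W f" unfolding f_def by (rule someI[of _ e]) (use e in simp)
    have "\<not> (\<exists>g\<in>edges G. W e = Y g)" using G.Y_neq_W e by metis
    then have "\<phi> (W e) = W' (\<psi> f)" by (simp add: \<phi>_def f_def)
    then show ?thesis using eq(2)[OF e, of f] f by simp
  qed
  have "bij_betw \<phi> (vertices G) (vertices H)"
  proof (rule bij_betw_imageI)
    show "inj_on \<phi> (vertices G)"
      unfolding G.verts
      using eq \<phi>Y \<phi>W H.Y_neq_W h by (auto simp: inj_on_def) metis+
    have "\<phi> ` vertices G = Y' ` \<psi> ` edges G \<union> W' ` \<psi> ` edges G"
      unfolding G.verts image_Un image_image using \<phi>Y \<phi>W by simp
    then show "\<phi> ` vertices G = vertices H"
      using \<psi> by (simp add: H.verts bij_betw_def)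
  qed
  moreover have "\<forall>e\<in>edges G. ends H (\<psi> e) = \<phi> ` ends G e"
    using G.ends H.ends h \<phi>Y \<phi>W by simp
  moreover have "\<forall>v\<in>vertices G. color_of H (\<phi> v) = color_of G v"
    unfolding G.verts using G.colY G.colW H.colY H.colW h \<phi>Y \<phi>W by auto
  moreover have "\<forall>v\<in>vertices G. \<forall>e\<in>edges_at G v. next_edge H (\<phi> v) (\<psi> e) = \<psi> (next_edge G v e)"
  proof (intro ballI)
    fix v e assume v: "v \<in> vertices G" and e: "e \<in> edges_at G v"
    have eG: "e \<in> edges G" "v = Y e \<or> v = W e" using e G.ends by (auto simp: edges_at_def)
    then show "next_edge H (\<phi> v) (\<psi> e) = \<psi> (next_edge G v e)"
      using \<phi>Y[OF eG(1)] \<phi>W[OF eG(1)] G.nextY[OF eG(1)] G.nextW[OF eG(1)] c[OF eG(1)]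
        H.nextY[OF h[OF eG(1)]] H.nextW[OF h[OF eG(1)]] by auto
  qed
  ultimately show "G \<simeq>\<^sub>p H"
    using \<psi> unfolding plane_iso_def by (intro exI[of _ \<phi>] exI[of _ \<psi>] conjI)
qed

section \<open>From trees to noncrossing partitions\<close>

text \<open>For a = b this is everything except a, as it must be for the gap of a one-point
  block.\<close>

definition cyc_between :: "nat \<Rightarrow> nat \<Rightarrow> nat \<Rightarrow> bool" where
  "cyc_between a b k \<longleftrightarrow> (if a < b then a < k \<and> k < b else a < k \<or> k < b)"

text \<open>Going round the circle, D is switched on by a and off at b and keeps its value
  elsewhere. At b it is off whatever came before, so one turn from b determines it.\<close>

lemma interval_from_recurrence:
  fixes D :: "nat \<Rightarrow> bool"
  assumes ab: "a \<in> {1..n}" "b \<in> {1..n}"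
    and rec: "\<And>k. k \<in> {1..n} \<Longrightarrow> D (rot n k) = (rot n k \<noteq> b \<and> (k = a \<or> D k))"
    and k: "k \<in> {1..n}"
  shows "D k \<longleftrightarrow> cyc_between a b k"
proof -
  have suc: "D (Suc m) \<longleftrightarrow> Suc m \<noteq> b \<and> (m = a \<or> D m)" if "1 \<le> m" "m < n" for m
    using rec[of m] that by (simp add: rot_eq)
  have one: "D 1 \<longleftrightarrow> 1 \<noteq> b \<and> (n = a \<or> D n)"
    using rec[of n] ab by (simp add: rot_eq)
  have up: "D m" if "j \<le> m" "1 \<le> j" "m \<le> n" "D j \<or> (j = a \<and> j < m)" "\<And>i. j < i \<Longrightarrow> i \<le> m \<Longrightarrow> i \<noteq> b" for j m
    using that
  proof (induction m rule: dec_induct)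
    case (step m)
    have "m = a \<or> D m"
      using step by (cases "m = j") auto
    then show ?case using suc[of m] step by auto
  qed auto
  have down: "\<not> D m" if "j \<le> m" "1 \<le> j" "m \<le> n" "\<not> D j" "\<And>i. j \<le> i \<Longrightarrow> i < m \<Longrightarrow> i \<noteq> a" for j m
    using that
  proof (induction m rule: dec_induct)
    case (step m)
    then show ?case using suc[of m] by auto
  qed auto
  have Db: "\<not> D b"
  proof (cases "b = 1")
    case True
    then show ?thesis using one by simp
  next
    case False
    then have b: "b = Suc (b - 1)" "1 \<le> b - 1" using ab by auto
    have "\<not> D (Suc (b - 1))" using suc[of "b - 1"] ab b by simp
    then show ?thesis using b(1) by simp
  qed
  show ?thesis
  proof (cases "a < b")
    case True
    consider "k \<le> a" | "a < k" "k < b" | "b \<le> k" by linarith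
    then show ?thesis
    proof cases
      case 1
      have "\<not> D n" using down[of b n] Db True ab by auto
      then have "\<not> D 1" using one True ab by auto
      then show ?thesis using down[of 1 k] 1 True k by (auto simp: cyc_between_def)
    next
      case 2
      then show ?thesis using up[of a k] True ab k by (auto simp: cyc_between_def)
    next
      case 3
      then show ?thesis using down[of b k] Db True ab k by (auto simp: cyc_between_def)
    qed
  next
    case False
    consider "k < b" | "b \<le> k" "k \<le> a" | "a < k" by linarith
    then show ?thesis
    proof cases
      case 1
      have "n = a \<or> D n" using up[of a n] False ab by (cases "n = a") auto
      then have "D 1" using one 1 k by auto
      then show ?thesis using up[of 1 k] 1 False k by (auto simp: cyc_between_def)
    next
      case 2
      then show ?thesis using down[of b k] Db False ab k by (auto simp: cyc_between_def)
    next
      case 3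
      then show ?thesis using up[of a k] False ab k by (auto simp: cyc_between_def)
    qed
  qed
qed

text \<open>Acyclicity speaks of walks with distinct edges only. If e occurs again, the rest of the
  walk after that occurrence starts at u or at z: either e is dropped altogether, or a single e is
  put in front of that rest.\<close>

lemma walk_distinct:
  "walk G u es v \<Longrightarrow> \<exists>fs. walk G u fs v \<and> distinct fs \<and> set fs \<subseteq> set es"
proof (induction es arbitrary: u)
  case (Cons e es)
  have split: "\<exists>c d. ends G e = {c, d} \<and> walk G d bs v" if "walk G a (as @ e # bs) v" for a as bs
    using that by (induction as arbitrary: a) auto
  obtain z where z: "e \<in> edges G" "ends G e = {u, z}" "walk G z es v" using Cons.prems by auto
  obtain fs where fs: "walk G z fs v" "distinct fs" "set fs \<subseteq> set es" using Cons.IH[OF z(3)] by blast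
  show ?case
  proof (cases "e \<in> set fs")
    case False
    then show ?thesis using fs z by (intro exI[of _ "e # fs"]) auto
  next
    case True
    then obtain as bs where s: "fs = as @ e # bs" by (meson split_list)
    then obtain c d where cd: "ends G e = {c, d}" "walk G d bs v" using split fs(1) by blast
    have "d = u \<or> d = z" using cd(1) z(2) by (auto simp: doubleton_eq_iff)
    then show ?thesis
    proof
      assume "d = u"
      then show ?thesis using cd(2) fs s by (intro exI[of _ bs]) auto
    next
      assume "d = z"
      then show ?thesis using cd(2) fs s z by (intro exI[of _ "e # bs"]) auto
    qed
  qed
qed auto

section \<open>The walk around a bicolored plane tree\<close>

locale bicol_tree = bicol G Y W y w for G :: "('v, 'e) plane_graph" and Y W y w +
  assumes tree: "bicolored_plane_tree G" and ne: "edges G \<noteq> {}"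
begin

definition next_side :: "'e \<Rightarrow> 'e" where "next_side e = y (w e)"

lemma next_side_in: "e \<in> edges G \<Longrightarrow> next_side e \<in> edges G"
  using y_in w_in by (simp add: next_side_def)

lemma inj_on_next_side: "inj_on next_side (edges G)"
  using inj_on_y inj_on_w w_in by (auto simp: inj_on_def next_side_def)

text \<open>X is the component of \<open>W e\<close> after deletion of e; a walk from there to
  \<open>Y e\<close> would close up with e.\<close>

lemma cut:
  assumes e: "e \<in> edges G"
  obtains X where "W e \<in> X" "Y e \<notin> X" "\<And>f. f \<in> edges G \<Longrightarrow> f \<noteq> e \<Longrightarrow> Y f \<in> X \<longleftrightarrow> W f \<in> X"
proof
  define X where "X = {v. \<exists>es. walk G (W e) es v \<and> e \<notin> set es}"
  have vs: "Y f \<in> vertices G" "W f \<in> vertices G" if "f \<in> edges G" for f using that verts by auto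
  have "\<exists>es. walk G (W e) es (W e) \<and> e \<notin> set es" by (rule exI[of _ "[]"]) (use vs[OF e] in simp)
  then show "W e \<in> X" unfolding X_def by simp
  show "Y e \<notin> X"
  proof
    assume "Y e \<in> X"
    then obtain es where es: "walk G (W e) es (Y e)" "e \<notin> set es" by (auto simp: X_def)
    obtain fs where fs: "walk G (W e) fs (Y e)" "distinct fs" "set fs \<subseteq> set es"
      using walk_distinct[OF es(1)] by blast
    have "walk G (Y e) (e # fs) (Y e)" "distinct (e # fs)" "e # fs \<noteq> []"
      using fs es e ends[OF e] by auto
    then show False using tree unfolding bicolored_plane_tree_def acyclic_graph_def by blast
  qed
  fix f assume f: "f \<in> edges G" "f \<noteq> e"
  have ext: "v' \<in> X" if v: "v \<in> X" "walk G v [f] v'" for v v'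
  proof -
    obtain es where "walk G (W e) es v" "e \<notin> set es" using v(1) by (auto simp: X_def)
    then have "walk G (W e) (es @ [f]) v'" "e \<notin> set (es @ [f])"
      using walk_append[OF _ v(2)] f by auto
    then show ?thesis unfolding X_def by blast
  qed
  have "walk G (Y f) [f] (W f)" "walk G (W f) [f] (Y f)"
    using f vs[OF f(1)] ends[OF f(1)] by auto
  then show "Y f \<in> X \<longleftrightarrow> W f \<in> X" using ext by blast
qed

text \<open>Walking around the tree one leaves the white side of \<open>e\<close> only along \<open>e\<close>, and continues with
  \<open>y e\<close>.\<close>

lemma cut_step:
  assumes e: "e \<in> edges G" and f: "f \<in> edges G"
    and X: "W e \<in> X" "Y e \<notin> X" "\<And>f. f \<in> edges G \<Longrightarrow> f \<noteq> e \<Longrightarrow> Y f \<in> X \<longleftrightarrow> W f \<in> X"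
  shows "Y (next_side f) \<in> X \<longleftrightarrow> next_side f \<noteq> y e \<and> (f = e \<or> Y f \<in> X)"
proof -
  have wf: "w f \<in> edges G" "W (w f) = W f" using w_in[OF f] by auto
  have 1: "next_side f = y e \<longleftrightarrow> w f = e"
    using inj_onD[OF inj_on_y _ wf(1) e] by (auto simp: next_side_def)
  have 2: "Y (next_side f) = Y (w f)" using y_in[OF wf(1)] by (simp add: next_side_def)
  show ?thesis
  proof (cases "w f = e")
    case True
    then show ?thesis using 1 2 X by simp
  next
    case False
    then have "Y (next_side f) \<in> X \<longleftrightarrow> W f \<in> X" using 2 X(3)[OF wf(1)] wf by simp
    then show ?thesis using 1 False X f by auto
  qed
qed

text \<open>If the orbit missed \<open>y e\<close>, then from its first step on it would stay in X,
  by \<open>cut_step\<close>; but it returns to e, whose yellow end is outside X.\<close>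

lemma y_in_orbit:
  assumes e: "e \<in> edges G" shows "y e \<in> orbit next_side e"
proof (rule ccontr)
  assume no: "y e \<notin> orbit next_side e"
  obtain X where X: "W e \<in> X" "Y e \<notin> X" "\<And>f. f \<in> edges G \<Longrightarrow> f \<noteq> e \<Longrightarrow> Y f \<in> X \<longleftrightarrow> W f \<in> X"
    using cut[OF e] by blast
  have "f \<in> edges G \<and> Y f \<in> X" if "f \<in> orbit next_side e" for f
    using that
  proof induction
    case base
    have "next_side e \<noteq> y e" using no orbit.base[of next_side e] by auto
    then show ?case using cut_step[OF e e X] next_side_in[OF e] by simp
  next
    case (step f)
    have "next_side f \<noteq> y e" using no orbit.step[OF step.hyps] by auto
    then show ?case using cut_step[OF e _ X, of f] next_side_in step.IH by simp
  qed
  moreover have "e \<in> orbit next_side e"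
    using next_side_in by (intro self_in_orbit[OF fin inj_on_next_side _ e]) auto
  ultimately show False using X(2) by blast
qed

text \<open>By \<open>y_in_orbit\<close> an orbit is closed under y. As y permutes the finite orbit,
  it is closed under w too, so it contains all edges at each vertex it meets, and connectedness
  makes it everything.\<close>

lemma cyclic_on_next_side: "cyclic_on next_side (edges G)"
proof -
  obtain e0 where e0: "e0 \<in> edges G" using ne by blast
  define Q where "Q = orbit next_side e0"
  have Q: "Q \<subseteq> edges G"
    unfolding Q_def using next_side_in e0 by (intro orbit_subset_closed) auto
  have finQ: "finite Q" using Q fin finite_subset by blast
  have e0Q: "e0 \<in> Q"
    unfolding Q_def using next_side_in by (intro self_in_orbit[OF fin inj_on_next_side _ e0]) auto
  have pQ: "next_side e \<in> Q" if "e \<in> Q" for e using that orbit.step unfolding Q_def by metis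
  have yQ: "y e \<in> Q" if "e \<in> Q" for e
    using orbit_trans[OF y_in_orbit] that Q unfolding Q_def by blast
  have wQ: "w e \<in> Q" if e: "e \<in> Q" for e
  proof -
    have "inj_on y Q" using inj_on_y Q by (rule inj_on_subset)
    then have "y ` Q = Q" using yQ finQ by (intro endo_inj_surj) auto
    then obtain z where z: "z \<in> Q" "next_side e = y z" using pQ[OF e] by (metis imageE)
    have "w e = z"
      using inj_onD[OF inj_on_y, of "w e" z] z Q w_in e by (auto simp: next_side_def)
    then show ?thesis using z by simp
  qed
  have closedY: "f \<in> Q" if "e \<in> Q" "f \<in> edges G" "Y f = Y e" for e f
  proof -
    have "f \<in> orbit y e" using orbit_y[of e] that Q by auto
    moreover have "orbit y e \<subseteq> Q" using yQ that by (intro orbit_subset_closed) auto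
    ultimately show ?thesis by blast
  qed
  have closedW: "f \<in> Q" if "e \<in> Q" "f \<in> edges G" "W f = W e" for e f
  proof -
    have "f \<in> orbit w e" using orbit_w[of e] that Q by auto
    moreover have "orbit w e \<subseteq> Q" using wQ that by (intro orbit_subset_closed) auto
    ultimately show ?thesis by blast
  qed
  have reach: "walk G u es v \<Longrightarrow> u \<in> Y ` Q \<union> W ` Q \<Longrightarrow> v \<in> Y ` Q \<union> W ` Q" for u es v
  proof (induction es arbitrary: u)
    case (Cons f fs)
    then obtain z where z: "f \<in> edges G" "ends G f = {u, z}" "walk G z fs v" by auto
    have "u = Y f \<or> u = W f" using z ends[OF z(1)] by (auto simp: doubleton_eq_iff)
    then have "f \<in> Q"
    proof
      assume u: "u = Y f"
      then obtain e where "e \<in> Q" "Y f = Y e" using Cons.prems(2) Y_neq_W[OF z(1)] Q by auto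
      then show ?thesis using closedY z by blast
    next
      assume u: "u = W f"
      then obtain e where "e \<in> Q" "W f = W e"
        using Cons.prems(2) Y_neq_W[OF _ z(1), symmetric] Q by auto
      then show ?thesis using closedW z by blast
    qed
    then have "z \<in> Y ` Q \<union> W ` Q" using z ends[OF z(1)] by (auto simp: doubleton_eq_iff)
    then show ?case using Cons.IH z by blast
  qed simp
  have "f \<in> Q" if f: "f \<in> edges G" for f
  proof -
    have "Y e0 \<in> vertices G" "Y f \<in> vertices G" using e0 f verts by auto
    then obtain es where "walk G (Y e0) es (Y f)"
      using tree unfolding bicolored_plane_tree_def connected_graph_def by blast
    then have "Y f \<in> Y ` Q \<union> W ` Q" using reach e0Q by blast
    then obtain e where "e \<in> Q" "Y f = Y e" using Y_neq_W[OF f] Q by auto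
    then show ?thesis using closedY f by blast
  qed
  then have "edges G = Q" using Q by blast
  then show ?thesis using e0 unfolding Q_def cyclic_on_def by blast
qed

lemma ex_labelling:
  assumes n: "n = card (edges G)"
  obtains \<psi> where "bij_betw \<psi> (edges G) {1..n}" "\<And>e. e \<in> edges G \<Longrightarrow> \<psi> (next_side e) = rot n (\<psi> e)"
proof -
  obtain e0 where e0: "e0 \<in> edges G" using ne by blast
  have orb: "orbit next_side e0 = edges G" using orbit_cyclic_eq3[OF cyclic_on_next_side e0] .
  define d where "d = funpow_dist1 next_side e0 e0"
  define L where "L = (\<lambda>k. (next_side ^^ k) e0)"
  have img: "L ` {0..<d} = edges G"
    using orbit_conv_funpow_dist1[of e0 next_side] orb e0 by (simp add: L_def d_def)
  have inj: "inj_on L {0..<d}"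
    using inj_on_funpow_dist1[of e0 next_side e0] orb e0 by (simp add: L_def d_def)
  have "d = n" using card_image[OF inj] img n by simp
  then have bij: "bij_betw L {0..<n} (edges G)" using img inj by (simp add: bij_betw_def)
  have Ln: "L n = L 0"
    using funpow_dist1_prop[of e0 next_side e0] orb e0 unfolding L_def \<open>d = n\<close>[symmetric] d_def by simp
  define \<psi> where "\<psi> = (\<lambda>e. Suc (inv_into {0..<n} L e))"
  have \<psi>L: "\<psi> (L k) = Suc k" if "k < n" for k
    using bij_betw_inv_into_left[OF bij] that by (simp add: \<psi>_def)
  have "bij_betw \<psi> (edges G) {1..n}"
  proof -
    have "bij_betw Suc {0..<n} {1..n}" by (auto simp: bij_betw_def image_Suc_atLeastLessThan)
    from bij_betw_trans[OF bij_betw_inv_into[OF bij] this] show ?thesis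
      by (simp add: \<psi>_def comp_def)
  qed
  moreover have "\<psi> (next_side e) = rot n (\<psi> e)" if e: "e \<in> edges G" for e
  proof -
    have "e \<in> L ` {0..<n}" using bij e by (simp add: bij_betw_def)
    then obtain k where k: "k < n" "e = L k" by auto
    have "next_side e = L (Suc k)" by (simp add: k L_def)
    then show ?thesis
      using \<psi>L[of k] \<psi>L[of "Suc k"] \<psi>L[of 0] k Ln by (cases "Suc k = n") (auto simp: rot_def)
  qed
  ultimately show ?thesis by (rule that)
qed

text \<open>The edges on the white side of \<open>e\<close> receive the labels strictly between those of \<open>e\<close> and of
  \<open>y e\<close>, in the cyclic order.\<close>

lemma labelled_partition:
  assumes \<psi>: "bij_betw \<psi> (edges G) {1..n}"
    and rot: "\<And>e. e \<in> edges G \<Longrightarrow> \<psi> (next_side e) = rot n (\<psi> e)"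
  defines "\<pi> \<equiv> (\<lambda>e. \<psi> ` {f \<in> edges G. Y f = Y e}) ` edges G"
  shows "\<pi> \<in> noncrossing_partitions n" and "\<And>e. e \<in> edges G \<Longrightarrow> side_end \<pi> (\<psi> e) = \<psi> (y e)"
proof -
  have rng: "\<psi> e \<in> {1..n}" if "e \<in> edges G" for e using \<psi> that by (auto simp: bij_betw_def)
  have inj: "\<psi> e = \<psi> f \<longleftrightarrow> e = f" if "e \<in> edges G" "f \<in> edges G" for e f
    using \<psi> that by (auto simp: bij_betw_def inj_on_def)
  have surj: "\<exists>e\<in>edges G. k = \<psi> e" if "k \<in> {1..n}" for k
    using \<psi> that by (auto simp: bij_betw_def)
  have part: "partition_on {1..n} \<pi>"
  proof (rule partition_onI)
    show "\<Union> \<pi> = {1..n}"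
    proof
      show "\<Union> \<pi> \<subseteq> {1..n}" using rng by (auto simp: \<pi>_def)
      show "{1..n} \<subseteq> \<Union> \<pi>" using surj by (fastforce simp: \<pi>_def)
    qed
    fix A B assume AB: "A \<in> \<pi>" "B \<in> \<pi>" "A \<noteq> B"
    obtain e where e: "e \<in> edges G" "A = \<psi> ` {f \<in> edges G. Y f = Y e}" using AB(1) by (auto simp: \<pi>_def)
    obtain g where g: "g \<in> edges G" "B = \<psi> ` {f \<in> edges G. Y f = Y g}" using AB(2) by (auto simp: \<pi>_def)
    have "Y e \<noteq> Y g" using AB(3) e g by auto
    then show "disjnt A B" using e g inj by (auto simp: disjnt_def)
  next
    show "{} \<notin> \<pi>" by (auto simp: \<pi>_def)
  qed
  have white: "\<exists>X. \<forall>f\<in>edges G. (Y f \<in> X \<longleftrightarrow>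
      cyc_between (\<psi> e) (\<psi> (y e)) (\<psi> f))"
    if e: "e \<in> edges G" for e
  proof -
    obtain X where X: "W e \<in> X" "Y e \<notin> X" "\<And>f. f \<in> edges G \<Longrightarrow> f \<noteq> e \<Longrightarrow> Y f \<in> X \<longleftrightarrow> W f \<in> X"
      using cut[OF e] by blast
    define D where "D = (\<lambda>k. Y (inv_into (edges G) \<psi> k) \<in> X)"
    have D: "D (\<psi> f) \<longleftrightarrow> Y f \<in> X" if "f \<in> edges G" for f
      using bij_betw_inv_into_left[OF \<psi> that] by (simp add: D_def)
    have ye: "y e \<in> edges G" using y_in[OF e] by simp
    have rec: "D (rot n k) = (rot n k \<noteq> \<psi> (y e) \<and> (k = \<psi> e \<or> D k))" if k: "k \<in> {1..n}" for k
    proof -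
      obtain f where f: "f \<in> edges G" "k = \<psi> f" using surj[OF k] by blast
      have "rot n k = \<psi> (next_side f)" using rot f by simp
      then show ?thesis
        using cut_step[OF e f(1) X] D f next_side_in[OF f(1)] inj e ye by simp
    qed
    have "D (\<psi> f) \<longleftrightarrow> cyc_between (\<psi> e) (\<psi> (y e)) (\<psi> f)"
      if f: "f \<in> edges G" for f
      by (rule interval_from_recurrence[OF rng[OF e] rng[OF ye] rec rng[OF f]])
    then show ?thesis using D by (intro exI[of _ X]) auto
  qed
  have block: "\<psi> ` {f \<in> edges G. Y f = Y e} \<in> \<pi>" if "e \<in> edges G" for e using that by (auto simp: \<pi>_def)
  have nxt: "cyc_next (\<psi> ` {f \<in> edges G. Y f = Y e}) (\<psi> e) = \<psi> (y e)" if e: "e \<in> edges G" for e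
  proof -
    let ?B = "\<psi> ` {f \<in> edges G. Y f = Y e}"
    obtain X where X: "\<And>f. f \<in> edges G \<Longrightarrow> (Y f \<in> X \<longleftrightarrow>
        cyc_between (\<psi> e) (\<psi> (y e)) (\<psi> f))"
      using white[OF e] by blast
    have "Y e \<notin> X"
    proof
      assume "Y e \<in> X"
      then have "Y (y e) \<in> X" using y_in[OF e] by simp
      then show False using X[of "y e"] X[OF e] y_in[OF e] \<open>Y e \<in> X\<close> by (auto simp: cyc_between_def split: if_splits)
    qed
    then have out: "\<not> cyc_between (\<psi> e) (\<psi> (y e)) b"
      if b: "b \<in> ?B" for b
    proof -
      obtain f where f: "f \<in> edges G" "Y f = Y e" "b = \<psi> f" using b by blast
      have "Y f \<notin> X" using f \<open>Y e \<notin> X\<close> by simp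
      then show ?thesis unfolding f(3) X[OF f(1)] .
    qed
    have yB: "\<psi> (y e) \<in> ?B" "\<psi> e \<in> ?B" using y_in[OF e] e by auto
    have finB: "finite ?B" using fin by simp
    show ?thesis
    proof (cases "\<psi> e < \<psi> (y e)")
      case True
      have "\<psi> e < cyc_next ?B (\<psi> e)" "cyc_next ?B (\<psi> e) \<le> \<psi> (y e)"
        using cyc_next_upper[OF finB yB(1) True] by auto
      then show ?thesis
        using out[OF cyc_next_in[OF finB yB(2)]] True
        by (cases "cyc_next ?B (\<psi> e) = \<psi> (y e)") (auto simp: cyc_between_def)
    next
      case False
      have "\<not> \<psi> e < cyc_next ?B (\<psi> e)" "\<not> cyc_next ?B (\<psi> e) < \<psi> (y e)"
        using out[OF cyc_next_in[OF finB yB(2)]] False by (auto simp: cyc_between_def)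
      moreover have "cyc_next ?B (\<psi> e) \<le> \<psi> (y e)"
        using cyc_next_lower(1)[OF finB yB(2,1)] calculation by simp
      ultimately show ?thesis by simp
    qed
  qed
  have the_block: "block_of \<pi> (\<psi> e) = \<psi> ` {f \<in> edges G. Y f = Y e}" if e: "e \<in> edges G" for e
  proof -
    have "\<psi> e \<in> \<psi> ` {f \<in> edges G. Y f = Y e}" using e by auto
    moreover have "B = C" if "B \<in> \<pi>" "C \<in> \<pi>" "\<psi> e \<in> B" "\<psi> e \<in> C" for B C
      using part that by (auto simp: partition_on_def disjoint_def)
    ultimately show ?thesis
      unfolding block_of_def using block[OF e] by (intro the_equality) auto
  qed
  show "side_end \<pi> (\<psi> e) = \<psi> (y e)" if "e \<in> edges G" for e
    using nxt[OF that] the_block[OF that] by (simp add: side_end_def)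
  have "noncrossing \<pi>"
    unfolding noncrossing_def
  proof (intro notI; elim exE bexE conjE)
    fix a b c d A B
    assume o: "a < b" "b < c" "c < d" and AB: "A \<in> \<pi>" "B \<in> \<pi>" "A \<noteq> B"
      and mem: "a \<in> A" "c \<in> A" "b \<in> B" "d \<in> B"
    have fA: "finite A" using AB(1) fin by (auto simp: \<pi>_def)
    \<comment> \<open>With e the edge labelled a', b lies between the labels of e and
      \<open>y e\<close>, but d does not. So the edges labelled b and d are on different sides of e,
      although they share their yellow vertex.\<close>
    define a' where "a' = Max {x \<in> A. x < b}"
    have "a' \<in> {x \<in> A. x < b}" unfolding a'_def using fA mem o by (intro Max_in) auto
    then have a': "a' \<in> A" "a' < b" by auto
    have amax: "x \<le> a'" if "x \<in> A" "x < b" for x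
      unfolding a'_def using that fA by (intro Max_ge) auto
    obtain e0 where e0: "e0 \<in> edges G" "A = \<psi> ` {f \<in> edges G. Y f = Y e0}" using AB(1) by (auto simp: \<pi>_def)
    then obtain e where e: "e \<in> edges G" "Y e = Y e0" "\<psi> e = a'" using a'(1) by auto
    have A: "A = \<psi> ` {f \<in> edges G. Y f = Y e}" using e0 e by simp
    obtain g0 where g0: "g0 \<in> edges G" "B = \<psi> ` {f \<in> edges G. Y f = Y g0}" using AB(2) by (auto simp: \<pi>_def)
    obtain fb where fb: "fb \<in> edges G" "Y fb = Y g0" "\<psi> fb = b" using mem g0 by auto
    obtain fd where fd: "fd \<in> edges G" "Y fd = Y g0" "\<psi> fd = d" using mem g0 by auto
    have n: "cyc_next A a' = \<psi> (y e)" using nxt[OF e(1)] A e by simp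
    have "a' < c" using a' o by simp
    have up: "a' < \<psi> (y e)" "\<psi> (y e) \<le> c"
      using cyc_next_upper[OF fA mem(2) \<open>a' < c\<close>] n by auto
    have "\<psi> (y e) \<in> A" using cyc_next_in[OF fA a'(1)] n by simp
    moreover have "b \<notin> A" using part AB mem by (auto simp: partition_on_def disjoint_def)
    ultimately have "b < \<psi> (y e)" using amax up by (metis leD linorder_neqE_nat)
    obtain X where X: "\<And>f. f \<in> edges G \<Longrightarrow> (Y f \<in> X \<longleftrightarrow>
        cyc_between (\<psi> e) (\<psi> (y e)) (\<psi> f))"
      using white[OF e(1)] by blast
    have "Y fb \<in> X" using X[OF fb(1)] up fb e a' \<open>b < \<psi> (y e)\<close> by (simp add: cyc_between_def)
    moreover have "Y fd \<notin> X" using X[OF fd(1)] up fd e o by (simp add: cyc_between_def)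
    ultimately show False using fb fd by simp
  qed
  then show "\<pi> \<in> noncrossing_partitions n" using part by (simp add: noncrossing_partitions_def)
qed

end

section \<open>The tree of a noncrossing partition\<close>

lemma cyclic_on_rot: assumes "n \<ge> 1" shows "cyclic_on (rot n) {1..n}"
proof (rule cyclic_on_nat_setI[OF _ _ inj_on_rot])
  show "rot n ` {1..n} \<subseteq> {1..n}" using rot_in[OF assms] by blast
  fix i j assume "i \<in> {1..n}" "j \<in> {1..n}" "i < j"
  then show "i < rot n i \<and> rot n i \<le> j" by (auto simp: rot_eq)
qed (use assms in auto)

context nc_partition
begin

lemma blocks_eq: "\<pi> = blk ` {1..n}"
proof
  show "\<pi> \<subseteq> blk ` {1..n}"
  proof
    fix A assume A: "A \<in> \<pi>"
    then obtain i where "i \<in> A" using block_ne by blast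
    then show "A \<in> blk ` {1..n}" using A blk_eq block_range by (intro image_eqI[of _ _ i]) auto
  qed
  show "blk ` {1..n} \<subseteq> \<pi>" using blk by blast
qed

lemma same_polygon:
  assumes i: "i \<in> {1..n}"
  shows "{f \<in> {1..n}. polygon n (blk f) = polygon n (blk i)} = blk i"
proof (intro equalityI subsetI)
  fix f assume "f \<in> {f \<in> {1..n}. polygon n (blk f) = polygon n (blk i)}"
  then have f: "f \<in> {1..n}" "polygon n (blk f) = polygon n (blk i)" by auto
  then have "blk f = blk i" using polygon_eq_iff[OF blk(1) blk(1)[OF i]] by blast
  then show "f \<in> blk i" using blk(2)[OF f(1)] by simp
next
  fix f assume f: "f \<in> blk i"
  show "f \<in> {f \<in> {1..n}. polygon n (blk f) = polygon n (blk i)}"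
    using block_range[OF blk(1)[OF i] f] blk_eq[OF blk(1)[OF i] f] by simp
qed

lemma bicol_polygon_tree:
  "bicol (polygon_tree n \<pi>) (\<lambda>i. polygon n (blk i)) wregion nxt wht"
proof
  have E: "edges (polygon_tree n \<pi>) = {1..n}" by (simp add: polygon_tree_def)
  show "finite (edges (polygon_tree n \<pi>))" by (simp add: E)
  have "yellow_regions n \<pi> = (\<lambda>i. polygon n (blk i)) ` {1..n}"
    unfolding yellow_regions_def by (subst blocks_eq) (rule image_image)
  then show "vertices (polygon_tree n \<pi>)
      = (\<lambda>i. polygon n (blk i)) ` edges (polygon_tree n \<pi>) \<union> wregion ` edges (polygon_tree n \<pi>)"
    by (simp add: polygon_tree_def white_regions_eq)
  fix i assume "i \<in> edges (polygon_tree n \<pi>)"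
  then have i: "i \<in> {1..n}" by (simp add: E)
  have Yi: "polygon n (blk i) \<in> yellow_regions n \<pi>" using blk(1)[OF i] by (simp add: yellow_regions_def)
  note Wi = wregion_not_yellow[OF i]
  show "ends (polygon_tree n \<pi>) i = {polygon n (blk i), wregion i}" by (rule ends_polygon_tree[OF i])
  show "color_of (polygon_tree n \<pi>) (polygon n (blk i)) = Yellow"
    "color_of (polygon_tree n \<pi>) (wregion i) = White"
    "next_edge (polygon_tree n \<pi>) (polygon n (blk i)) i = nxt i"
    "next_edge (polygon_tree n \<pi>) (wregion i) i = wht i"
    using Yi Wi by (simp_all add: polygon_tree_def wht_def)
  show "cyclic_on nxt {f \<in> edges (polygon_tree n \<pi>). polygon n (blk f) = polygon n (blk i)}"
    using cyclic_on_nxt[OF blk(1)[OF i]] unfolding E same_polygon[OF i] .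
  have "{f \<in> {1..n}. wregion f = wregion i} = {j \<in> {1..n}. weq i j}"
    using wregion_eq_iff[OF i] by auto
  then show "cyclic_on wht {f \<in> edges (polygon_tree n \<pi>). wregion f = wregion i}"
    using cyclic_on_wht[OF i] by (simp add: E)
qed

lemma edges_polygon_tree: "edges (polygon_tree n \<pi>) = {1..n}"
  by (simp add: polygon_tree_def)

lemma plane_tree_polygon_tree: "bicolored_plane_tree (polygon_tree n \<pi>)"
proof (rule bicol.plane_treeI[OF bicol_polygon_tree])
  show "edges (polygon_tree n \<pi>) \<noteq> {}" using n by (simp add: edges_polygon_tree)
  have "cyclic_on (\<lambda>e. nxt (wht e)) {1..n} = cyclic_on (rot n) {1..n}"
    using wht_props by (intro cyclic_cong) auto
  then show "cyclic_on (\<lambda>e. nxt (wht e)) (edges (polygon_tree n \<pi>))"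
    using cyclic_on_rot[OF n] by (simp add: edges_polygon_tree)
  fix a assume "a \<in> edges (polygon_tree n \<pi>)"
  then have a: "a \<in> {1..n}" by (simp add: edges_polygon_tree)
  \<comment> \<open>The regions beyond the side a. The two membership conditions agree for every k
    other than a, so a is the only edge that leaves X.\<close>
  define X where "X = {polygon n (blk k) | k. k \<in> {1..n} \<and> point_in_gap a k} \<union> {wregion k | k. k \<in> {1..n} \<and> arc_in_gap a k}"
  have neq: "wregion k \<noteq> polygon n (blk l)" if "k \<in> {1..n}" "l \<in> {1..n}" for k l
    using wregion_not_yellow[OF that(1)] blk(1)[OF that(2)] by (auto simp: yellow_regions_def)
  have Y: "polygon n (blk k) \<in> X \<longleftrightarrow> point_in_gap a k" if k: "k \<in> {1..n}" for k
  proof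
    assume "polygon n (blk k) \<in> X"
    then obtain l where l: "l \<in> {1..n}" "point_in_gap a l" "polygon n (blk k) = polygon n (blk l)"
      using neq[OF _ k] unfolding X_def by fastforce
    then have "blk k = blk l" using polygon_eq_iff[OF blk(1)[OF k] blk(1)[OF l(1)]] by simp
    then show "point_in_gap a k"
      using point_in_gap_block[OF a blk(1)[OF l(1)] blk(2)[OF l(1)] _ l(2)] blk(2)[OF k] by simp
  qed (use k in \<open>auto simp: X_def\<close>)
  have W: "wregion k \<in> X \<longleftrightarrow> arc_in_gap a k" if k: "k \<in> {1..n}" for k
  proof
    assume "wregion k \<in> X"
    then obtain l where l: "l \<in> {1..n}" "arc_in_gap a l" "wregion k = wregion l"
      using neq[OF k] unfolding X_def by fastforce
    then show "arc_in_gap a k"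
      using arc_in_gap_weq[OF a k l(1)] wregion_eq_iff[OF k l(1)] by simp
  qed (use k in \<open>auto simp: X_def\<close>)
  have "point_in_gap a k \<longleftrightarrow> arc_in_gap a k" if "k \<noteq> a" for k
    using that by (auto simp: point_in_gap_def arc_in_gap_def)
  moreover have "\<not> point_in_gap a a" "arc_in_gap a a"
    using ge_bounds[OF a] by (auto simp: point_in_gap_def arc_in_gap_def)
  ultimately show "\<exists>X. (polygon n (blk a) \<in> X) \<noteq> (wregion a \<in> X) \<and>
      (\<forall>f\<in>edges (polygon_tree n \<pi>). f \<noteq> a \<longrightarrow> (polygon n (blk f) \<in> X \<longleftrightarrow> wregion f \<in> X))"
    using Y W a by (intro exI[of _ X]) (auto simp: edges_polygon_tree)
qed

lemma bicol_tree_polygon_tree: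
  "bicol_tree (polygon_tree n \<pi>) (\<lambda>i. polygon n (blk i)) wregion nxt wht"
  using bicol_polygon_tree plane_tree_polygon_tree n
  by (auto simp: bicol_tree_def bicol_tree_axioms_def edges_polygon_tree)

end

lemma nc_partitionI: "n \<ge> 1 \<Longrightarrow> \<pi> \<in> noncrossing_partitions n \<Longrightarrow> nc_partition n \<pi>"
  by (simp add: nc_partition_def noncrossing_partitions_def)

text \<open>Compatibility with y comes from \<open>labelled_partition\<close>. Compatibility with w
  then follows by cancellation: both products are \<open>rot n\<close>, and \<open>side_end\<close>
  is injective.\<close>

lemma (in bicol_tree) polygon_tree_of_labelling:
  assumes \<psi>: "bij_betw \<psi> (edges G) {1..n}"
    and rot: "\<And>e. e \<in> edges G \<Longrightarrow> \<psi> (next_side e) = rot n (\<psi> e)"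
  defines "\<pi> \<equiv> (\<lambda>e. \<psi> ` {f \<in> edges G. Y f = Y e}) ` edges G"
  shows "G \<simeq>\<^sub>p polygon_tree n \<pi>"
proof -
  have n1: "n \<ge> 1" using \<psi> ne by (cases n) (auto simp: bij_betw_def)
  have \<pi>: "\<pi> \<in> noncrossing_partitions n" and se: "\<And>e. e \<in> edges G \<Longrightarrow> side_end \<pi> (\<psi> e) = \<psi> (y e)"
    using labelled_partition[OF \<psi> rot] by (auto simp: \<pi>_def)
  interpret P: nc_partition n \<pi> by (rule nc_partitionI[OF n1 \<pi>])
  have rng: "\<psi> e \<in> {1..n}" if "e \<in> edges G" for e using \<psi> that by (auto simp: bij_betw_def)
  have "\<psi> (w e) = P.wht (\<psi> e)" if e: "e \<in> edges G" for e
  proof (rule inj_onD[OF P.inj_on_nxt])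
    have we: "w e \<in> edges G" using w_in[OF e] by simp
    show "side_end \<pi> (\<psi> (w e)) = side_end \<pi> (P.wht (\<psi> e))"
      using se[OF we] rot[OF e] P.wht_props[of "\<psi> e"] by (simp add: next_side_def)
    show "\<psi> (w e) \<in> {1..n}" "P.wht (\<psi> e) \<in> {1..n}" using rng[OF we] P.wht_props by auto
  qed
  then have "edge_iso (edges G) y w (edges (polygon_tree n \<pi>)) (side_end \<pi>) P.wht \<psi>"
    using \<psi> se by (simp add: edge_iso_def P.edges_polygon_tree)
  then show ?thesis
    using plane_iso_iff_edge_iso[OF bicol_axioms P.bicol_polygon_tree] by blast
qed

section \<open>Isomorphism as an equivalence relation, and copies with natural numbers as
  vertices\<close>

lemma plane_iso_sym:
  assumes "bicol G Y W y w" "bicol H Y' W' y' w'" "G \<simeq>\<^sub>p H" shows "H \<simeq>\<^sub>p G"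
proof -
  interpret G: bicol G Y W y w by fact
  obtain \<psi> where "edge_iso (edges G) y w (edges H) y' w' \<psi>"
    using plane_iso_iff_edge_iso[OF assms(1,2)] assms(3) by blast
  then have "edge_iso (edges H) y' w' (edges G) y w (inv_into (edges G) \<psi>)"
    by (rule edge_iso_sym) (use G.y_in G.w_in in auto)
  then show ?thesis using plane_iso_iff_edge_iso[OF assms(2,1)] by blast
qed

lemma plane_iso_trans:
  assumes "bicol G Y W y w" "bicol H Y' W' y' w'" "bicol K Y'' W'' y'' w''" "G \<simeq>\<^sub>p H" "H \<simeq>\<^sub>p K"
  shows "G \<simeq>\<^sub>p K"
  using plane_iso_iff_edge_iso[OF assms(1,2)] plane_iso_iff_edge_iso[OF assms(2,3)]
    plane_iso_iff_edge_iso[OF assms(1,3)] assms(4,5) edge_iso_trans by meson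

lemma plane_iso_edges: "G \<simeq>\<^sub>p H \<Longrightarrow> card (edges H) = card (edges G) \<and> (edges H = {} \<longleftrightarrow> edges G = {})"
  unfolding plane_iso_def by (metis bij_betw_empty1 bij_betw_empty2 bij_betw_same_card)

lemma tree_class_cong:
  assumes G: "bicol G Y W y w" "edges G \<noteq> {}" and H: "bicol H Y' W' y' w'" and iso: "G \<simeq>\<^sub>p H"
  shows "tree_class G = tree_class H"
proof -
  have HG: "H \<simeq>\<^sub>p G" by (rule plane_iso_sym[OF G(1) H iso])
  have neH: "edges H \<noteq> {}" using plane_iso_edges[OF iso] G(2) by simp
  have rep: "\<exists>Y W y w. bicol K Y W y w" if "bicolored_plane_tree K" "G \<simeq>\<^sub>p K \<or> H \<simeq>\<^sub>p K" for K :: "(nat, nat) plane_graph"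
    using plane_tree_bicol[OF that(1)] plane_iso_edges that(2) G(2) neH by metis
  have "G \<simeq>\<^sub>p K \<longleftrightarrow> H \<simeq>\<^sub>p K" if K: "bicolored_plane_tree K" for K :: "(nat, nat) plane_graph"
    using rep[OF K] plane_iso_trans[OF H G(1) _ HG] plane_iso_trans[OF G(1) H _ iso] by blast
  then show ?thesis by (auto simp: tree_class_def)
qed

text \<open>The vertices of \<open>polygon_tree\<close> are subsets of the plane, while
  \<open>tree_class\<close> collects graphs over nat. The copy shows that the class of a polygon
  tree is nonempty and is the class of a tree over nat.\<close>

lemma (in bicol_tree) ex_nat_vertices:
  obtains H :: "(nat, 'e) plane_graph" and Y' W'
  where "bicolored_plane_tree H" "bicol H Y' W' y w" "G \<simeq>\<^sub>p H"
proof -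
  have "finite (vertices G)" using verts fin by simp
  then obtain \<phi> :: "'v \<Rightarrow> nat" where \<phi>: "inj_on \<phi> (vertices G)" using finite_imp_inj_to_nat_seg by metis
  define H :: "(nat, 'e) plane_graph" where
    "H = \<lparr> vertices = \<phi> ` vertices G, edges = edges G, ends = (\<lambda>e. {\<phi> (Y e), \<phi> (W e)}),
           color_of = (\<lambda>v. if v \<in> \<phi> ` Y ` edges G then Yellow else White),
           next_edge = (\<lambda>v e. if v \<in> \<phi> ` Y ` edges G then y e else w e) \<rparr>"
  have \<phi>eq: "\<phi> u = \<phi> v \<longleftrightarrow> u = v" if "u \<in> vertices G" "v \<in> vertices G" for u v
    using \<phi> that by (auto simp: inj_on_def)
  have vs: "Y f \<in> vertices G" "W f \<in> vertices G" if "f \<in> edges G" for f using that verts by auto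
  have notY: "\<phi> (W e) \<notin> \<phi> ` Y ` edges G" if e: "e \<in> edges G" for e
    using \<phi>eq[OF vs(2)[OF e]] vs(1) Y_neq_W[OF _ e] by fastforce
  have EH: "edges H = edges G" by (simp add: H_def)
  have bic: "bicol H (\<lambda>e. \<phi> (Y e)) (\<lambda>e. \<phi> (W e)) y w"
  proof
    show "finite (edges H)" using fin by (simp add: EH)
    show "vertices H = (\<lambda>e. \<phi> (Y e)) ` edges H \<union> (\<lambda>e. \<phi> (W e)) ` edges H"
      by (simp add: H_def verts image_Un image_image)
    fix e assume "e \<in> edges H"
    then have e: "e \<in> edges G" by (simp add: EH)
    show "ends H e = {\<phi> (Y e), \<phi> (W e)}" by (simp add: H_def)
    show "color_of H (\<phi> (Y e)) = Yellow" "color_of H (\<phi> (W e)) = White"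
      "next_edge H (\<phi> (Y e)) e = y e" "next_edge H (\<phi> (W e)) e = w e"
      using e notY[OF e] by (simp_all add: H_def)
    have "{f \<in> edges H. \<phi> (Y f) = \<phi> (Y e)} = {f \<in> edges G. Y f = Y e}"
      "{f \<in> edges H. \<phi> (W f) = \<phi> (W e)} = {f \<in> edges G. W f = W e}"
      using e \<phi>eq vs by (auto simp: EH)
    then show "cyclic_on y {f \<in> edges H. \<phi> (Y f) = \<phi> (Y e)}" "cyclic_on w {f \<in> edges H. \<phi> (W f) = \<phi> (W e)}"
      using cycY[OF e] cycW[OF e] by simp_all
  qed
  have "bicolored_plane_tree H"
  proof (rule bicol.plane_treeI[OF bic])
    show "edges H \<noteq> {}" using ne by (simp add: EH)
    show "cyclic_on (\<lambda>e. y (w e)) (edges H)"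
      using cyclic_on_next_side by (simp add: EH next_side_def[abs_def])
    fix e assume "e \<in> edges H"
    then have e: "e \<in> edges G" by (simp add: EH)
    obtain X where X: "W e \<in> X" "Y e \<notin> X" "\<And>f. f \<in> edges G \<Longrightarrow> f \<noteq> e \<Longrightarrow> Y f \<in> X \<longleftrightarrow> W f \<in> X"
      using cut[OF e] by blast
    have "\<phi> v \<in> \<phi> ` (X \<inter> vertices G) \<longleftrightarrow> v \<in> X" if "v \<in> vertices G" for v
      using \<phi>eq that by auto
    then show "\<exists>X. (\<phi> (Y e) \<in> X) \<noteq> (\<phi> (W e) \<in> X) \<and>
        (\<forall>f\<in>edges H. f \<noteq> e \<longrightarrow> (\<phi> (Y f) \<in> X \<longleftrightarrow> \<phi> (W f) \<in> X))"
      using X e vs by (intro exI[of _ "\<phi> ` (X \<inter> vertices G)"]) (auto simp: EH)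
  qed
  moreover have "edge_iso (edges G) y w (edges H) y w id" by (simp add: edge_iso_def EH)
  then have "G \<simeq>\<^sub>p H" using plane_iso_iff_edge_iso[OF bicol_axioms bic] by blast
  ultimately show ?thesis using that bic by blast
qed

section \<open>Rotation classes and isomorphism classes\<close>

lemma funpow_rotate_partition: "(rotate_partition n ^^ i) \<pi> = (\<lambda>B. (rot n ^^ i) ` B) ` \<pi>"
  by (induction i) (simp_all add: rotate_partition_def image_image)

lemma bij_funpow_rot: assumes "n \<ge> 1" shows "bij_betw (rot n ^^ i) {1..n} {1..n}"
proof -
  have "rot n ` {1..n} \<subseteq> {1..n}" using rot_in[OF assms] by blast
  then have "bij_betw (rot n) {1..n} {1..n}"
    using inj_on_rot by (simp add: bij_betw_def endo_inj_surj)
  then show ?thesis by (rule bij_betw_funpow)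
qed

lemma funpow_rot_eq: "k \<ge> 1 \<Longrightarrow> k + i \<le> n \<Longrightarrow> (rot n ^^ i) k = k + i"
  by (induction i) (auto simp: rot_def)

lemma funpow_rot_n: assumes "k \<in> {1..n}" shows "(rot n ^^ n) k = k"
proof -
  \<comment> \<open>From k it takes n - k steps up to n, one step to 1 and k - 1 steps back to k;
    only the middle one wraps around.\<close>
  have k: "n = (k - 1) + (1 + (n - k))" "1 \<le> k" "k \<le> n" using assms by auto
  have "(rot n ^^ n) k = (rot n ^^ (k - 1)) ((rot n ^^ 1) ((rot n ^^ (n - k)) k))"
    by (subst k(1)) (simp only: funpow_add o_apply)
  also have "\<dots> = k" using k(2,3) by (simp add: funpow_rot_eq rot_def[of n n])
  finally show ?thesis .
qed

lemma rotate_partition_n: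
  assumes "partition_on {1..n} \<pi>" shows "(rotate_partition n ^^ n) \<pi> = \<pi>"
proof -
  have "(rot n ^^ n) ` B = B" if "B \<in> \<pi>" for B
  proof -
    have "B \<subseteq> {1..n}" using that assms by (auto simp: partition_on_def)
    then have "(rot n ^^ n) ` B = (\<lambda>k. k) ` B" using funpow_rot_n by (intro image_cong) auto
    then show ?thesis by simp
  qed
  then show ?thesis by (simp add: funpow_rotate_partition)
qed

lemma rotation_class_rotate:
  assumes n: "n \<ge> 1" and p: "partition_on {1..n} \<pi>"
  shows "rotation_class n ((rotate_partition n ^^ c) \<pi>) = rotation_class n \<pi>"
proof
  let ?R = "rotate_partition n"
  show "rotation_class n ((?R ^^ c) \<pi>) \<subseteq> rotation_class n \<pi>"
  proof
    fix x assume "x \<in> rotation_class n ((?R ^^ c) \<pi>)"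
    then obtain i where "i \<ge> 1" "x = (?R ^^ i) ((?R ^^ c) \<pi>)" by (auto simp: rotation_class_def)
    then have "i + c \<ge> 1" "x = (?R ^^ (i + c)) \<pi>" by (simp_all add: funpow_add)
    then show "x \<in> rotation_class n \<pi>" by (auto simp: rotation_class_def)
  qed
  have per: "(?R ^^ (n * m)) \<pi> = \<pi>" for m
    by (induction m) (simp_all add: funpow_add rotate_partition_n[OF p])
  show "rotation_class n \<pi> \<subseteq> rotation_class n ((?R ^^ c) \<pi>)"
  proof
    fix x assume "x \<in> rotation_class n \<pi>"
    then obtain i where i: "i \<ge> 1" "x = (?R ^^ i) \<pi>" by (auto simp: rotation_class_def)
    have "c \<le> n * c" using n by simp
    \<comment> \<open>Adding n * c, a multiple of the period, makes room to split off the c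
      rotations already performed, with an exponent still at least 1.\<close>
    then have e: "i + n * c = (i + (n * c - c)) + c" by linarith
    have "x = (?R ^^ (i + n * c)) \<pi>" using i per by (simp add: funpow_add)
    also have "\<dots> = (?R ^^ (i + (n * c - c))) ((?R ^^ c) \<pi>)"
      unfolding e by (simp only: funpow_add o_apply)
    finally show "x \<in> rotation_class n ((?R ^^ c) \<pi>)" using i by (auto simp: rotation_class_def)
  qed
qed

text \<open>No geometry is involved: \<open>rot n ^^ i\<close> commutes with \<open>rot n\<close>,
  so it is another admissible labelling of the edges of the same tree, and the partition read off
  from it is the rotated one.\<close>

lemma polygon_tree_rotate:
  assumes n: "n \<ge> 1" and \<pi>: "\<pi> \<in> noncrossing_partitions n"
  shows "polygon_tree n \<pi> \<simeq>\<^sub>p polygon_tree n ((rotate_partition n ^^ i) \<pi>)"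
proof -
  interpret nc_partition n \<pi> by (rule nc_partitionI[OF assms])
  interpret T: bicol_tree "polygon_tree n \<pi>" "\<lambda>i. polygon n (blk i)" wregion nxt wht
    by (rule bicol_tree_polygon_tree)
  have "(rot n ^^ i) (T.next_side e) = rot n ((rot n ^^ i) e)" for e
    using wht_props[of e] by (simp add: T.next_side_def funpow_swap1)
  moreover have "bij_betw (rot n ^^ i) (edges (polygon_tree n \<pi>)) {1..n}"
    using bij_funpow_rot[OF n] by (simp add: edges_polygon_tree)
  moreover have "(\<lambda>e. (rot n ^^ i) ` {f \<in> edges (polygon_tree n \<pi>). polygon n (blk f) = polygon n (blk e)})
      ` edges (polygon_tree n \<pi>) = (rotate_partition n ^^ i) \<pi>"
  proof -
    have "(\<lambda>e. (rot n ^^ i) ` {f \<in> {1..n}. polygon n (blk f) = polygon n (blk e)}) ` {1..n}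
        = (\<lambda>e. (rot n ^^ i) ` blk e) ` {1..n}"
      using same_polygon by (intro image_cong) auto
    also have "\<dots> = (\<lambda>B. (rot n ^^ i) ` B) ` blk ` {1..n}" by (simp add: image_image)
    finally show ?thesis
      unfolding edges_polygon_tree funpow_rotate_partition blocks_eq[symmetric] .
  qed
  ultimately show ?thesis
    using T.polygon_tree_of_labelling[of "rot n ^^ i" n] by simp
qed

lemma polygon_tree_iso_imp_rotation:
  assumes n: "n \<ge> 1" and \<pi>: "\<pi> \<in> noncrossing_partitions n" "\<pi>' \<in> noncrossing_partitions n"
    and iso: "polygon_tree n \<pi> \<simeq>\<^sub>p polygon_tree n \<pi>'"
  shows "rotation_class n \<pi> = rotation_class n \<pi>'"
proof -
  interpret P: nc_partition n \<pi> by (rule nc_partitionI[OF n \<pi>(1)])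
  interpret Q: nc_partition n \<pi>' by (rule nc_partitionI[OF n \<pi>(2)])
  obtain \<psi> where "edge_iso {1..n} (side_end \<pi>) P.wht {1..n} (side_end \<pi>') Q.wht \<psi>"
    using plane_iso_iff_edge_iso[OF P.bicol_polygon_tree Q.bicol_polygon_tree] iso
    by (auto simp: P.edges_polygon_tree Q.edges_polygon_tree)
  then have \<psi>: "bij_betw \<psi> {1..n} {1..n}"
    and c: "\<And>k. k \<in> {1..n} \<Longrightarrow> \<psi> (side_end \<pi> k) = side_end \<pi>' (\<psi> k) \<and> \<psi> (P.wht k) = Q.wht (\<psi> k)"
    by (auto simp: edge_iso_def)
  have rot: "\<psi> (rot n k) = rot n (\<psi> k)" if k: "k \<in> {1..n}" for k
    using c[OF k] c[of "P.wht k"] P.wht_props[of k] Q.wht_props[of "\<psi> k"] by simp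
  \<comment> \<open>Since \<psi> commutes with \<open>rot n\<close>, it is determined by its value
    at 1, which the rotation by m also takes there.\<close>
  define m where "m = \<psi> 1 - 1"
  have one: "1 \<in> {1..n}" using n by simp
  have p1: "\<psi> 1 \<in> {1..n}" using \<psi> one by (auto simp: bij_betw_def)
  have pow: "\<psi> k = (rot n ^^ m) k" if "k \<in> {1..n}" for k
    using that
  proof (induction k)
    case (Suc k)
    show ?case
    proof (cases "k = 0")
      case True
      have "(rot n ^^ m) 1 = 1 + m" using p1 by (intro funpow_rot_eq) (auto simp: m_def)
      then show ?thesis using True p1 by (simp add: m_def)
    next
      case False
      then have k: "k \<in> {1..n}" "rot n k = Suc k" using Suc.prems by (auto simp: rot_eq)
      then show ?thesis using rot[OF k(1)] Suc.IH by (simp add: funpow_swap1)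
    qed
  qed simp
  have img: "\<psi> ` P.blk k = Q.blk (\<psi> k)" if k: "k \<in> {1..n}" for k
  proof -
    have pk: "\<psi> k \<in> {1..n}" using \<psi> k by (auto simp: bij_betw_def)
    have "cyclic_on (side_end \<pi>') (\<psi> ` P.blk k)"
      using P.cyclic_on_nxt[OF P.blk(1)[OF k]] c P.block_range[OF P.blk(1)[OF k]]
      by (intro cyclic_on_image[of "side_end \<pi>"]) auto
    then have "\<psi> ` P.blk k = orbit (side_end \<pi>') (\<psi> k)"
      using orbit_cyclic_eq3 P.blk(2)[OF k] by fastforce
    also have "\<dots> = Q.blk (\<psi> k)"
      using orbit_cyclic_eq3[OF Q.cyclic_on_nxt[OF Q.blk(1)[OF pk]] Q.blk(2)[OF pk]] .
    finally show ?thesis .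
  qed
  have "\<pi>' = Q.blk ` \<psi> ` {1..n}"
    using Q.blocks_eq \<psi> by (simp add: bij_betw_def)
  also have "\<dots> = (\<lambda>k. \<psi> ` P.blk k) ` {1..n}"
    unfolding image_image using img by (intro image_cong) auto
  also have "\<dots> = (\<lambda>k. (rot n ^^ m) ` P.blk k) ` {1..n}"
  proof (intro image_cong refl)
    fix k x assume "k \<in> {1..n}" "x \<in> P.blk k"
    then show "\<psi> x = (rot n ^^ m) x" using pow P.block_range[OF P.blk(1)] by blast
  qed
  also have "\<dots> = (\<lambda>B. (rot n ^^ m) ` B) ` P.blk ` {1..n}" by (simp add: image_image)
  also have "\<dots> = (rotate_partition n ^^ m) \<pi>"
    unfolding funpow_rotate_partition P.blocks_eq[symmetric] ..
  finally show ?thesis using rotation_class_rotate[OF n P.part] by simp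
qed

theorem mainTheorem1:
  fixes n :: nat
  assumes "n \<ge> 1"
  shows "\<exists>f :: nat set set set \<Rightarrow> (nat, nat) plane_graph set.
           (\<forall>\<pi>\<in>noncrossing_partitions n.
              bicolored_plane_tree (polygon_tree n \<pi>) \<and>
              f (rotation_class n \<pi>) = tree_class (polygon_tree n \<pi>)) \<and>
           bij_betw f (rotation_classes n) (bicolored_plane_trees n)"
proof -
  let ?NC = "noncrossing_partitions n"
  have copy: "\<exists>(H :: (nat, nat) plane_graph) Y W y w. bicolored_plane_tree H \<and> bicol H Y W y w \<and> polygon_tree n \<pi> \<simeq>\<^sub>p H"
    if \<pi>: "\<pi> \<in> ?NC" for \<pi>
  proof -
    interpret nc_partition n \<pi> by (rule nc_partitionI[OF assms \<pi>])
    interpret T: bicol_tree "polygon_tree n \<pi>" "\<lambda>i. polygon n (blk i)" wregion nxt wht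
      by (rule bicol_tree_polygon_tree)
    show ?thesis using T.ex_nat_vertices by metis
  qed
  have bic: "\<exists>Y W y w. bicol (polygon_tree n \<pi>) Y W y w" if "\<pi> \<in> ?NC" for \<pi>
    using nc_partition.bicol_polygon_tree[OF nc_partitionI[OF assms that]] by blast
  have ne: "edges (polygon_tree n \<pi>) \<noteq> {}" "card (edges (polygon_tree n \<pi>)) = n" for \<pi>
    using assms by (simp_all add: polygon_tree_def)
  define f :: "nat set set set \<Rightarrow> (nat, nat) plane_graph set" where
    "f = (\<lambda>C. tree_class (polygon_tree n (SOME \<pi>. \<pi> \<in> ?NC \<and> rotation_class n \<pi> = C)))"
  have cong: "tree_class (polygon_tree n \<pi>) = tree_class (polygon_tree n \<pi>')"
    if \<pi>: "\<pi> \<in> ?NC" "\<pi>' \<in> ?NC" and eq: "rotation_class n \<pi> = rotation_class n \<pi>'" for \<pi> \<pi>'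
  proof -
    \<comment> \<open>Exponents in a rotation class start at 1, so a partition belongs to its own
      class by way of the full turn.\<close>
    have "(rotate_partition n ^^ n) \<pi>' \<in> rotation_class n \<pi>'"
      using assms by (auto simp: rotation_class_def)
    then have "\<pi>' \<in> rotation_class n \<pi>"
      using rotate_partition_n[of n \<pi>'] \<pi> eq by (simp add: noncrossing_partitions_def)
    then obtain i where "\<pi>' = (rotate_partition n ^^ i) \<pi>" by (auto simp: rotation_class_def)
    then have "polygon_tree n \<pi> \<simeq>\<^sub>p polygon_tree n \<pi>'" using polygon_tree_rotate[OF assms \<pi>(1)] by simp
    then show ?thesis using bic[OF \<pi>(1)] bic[OF \<pi>(2)] ne tree_class_cong by blast
  qed
  have f: "f (rotation_class n \<pi>) = tree_class (polygon_tree n \<pi>)" if \<pi>: "\<pi> \<in> ?NC" for \<pi>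
  proof -
    define \<rho> where "\<rho> = (SOME \<rho>. \<rho> \<in> ?NC \<and> rotation_class n \<rho> = rotation_class n \<pi>)"
    have "\<rho> \<in> ?NC \<and> rotation_class n \<rho> = rotation_class n \<pi>"
      unfolding \<rho>_def by (rule someI[of _ \<pi>]) (use \<pi> in simp)
    then show ?thesis using cong[of \<rho> \<pi>] \<pi> by (simp add: f_def \<rho>_def)
  qed
  have "inj_on f (rotation_classes n)"
  proof (rule inj_onI)
    fix C C' assume C: "C \<in> rotation_classes n" "C' \<in> rotation_classes n" "f C = f C'"
    obtain \<pi> \<pi>' where \<pi>: "\<pi> \<in> ?NC" "C = rotation_class n \<pi>" "\<pi>' \<in> ?NC" "C' = rotation_class n \<pi>'"
      using C by (auto simp: rotation_classes_def)
    \<comment> \<open>A common member of the two equal classes, through which the polygon trees are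
      compared.\<close>
    obtain H :: "(nat, nat) plane_graph" and Y W y w
      where H: "bicolored_plane_tree H" "bicol H Y W y w" "polygon_tree n \<pi> \<simeq>\<^sub>p H"
      using copy[OF \<pi>(1)] by blast
    have "H \<in> tree_class (polygon_tree n \<pi>)" using H by (simp add: tree_class_def)
    then have "H \<in> tree_class (polygon_tree n \<pi>')" using C(3) f \<pi> by simp
    then have "polygon_tree n \<pi>' \<simeq>\<^sub>p H" by (simp add: tree_class_def)
    then have "polygon_tree n \<pi> \<simeq>\<^sub>p polygon_tree n \<pi>'"
      using bic[OF \<pi>(1)] bic[OF \<pi>(3)] H(2,3) plane_iso_sym plane_iso_trans by meson
    then show "C = C'" using polygon_tree_iso_imp_rotation[OF assms \<pi>(1,3)] \<pi> by simp
  qed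
  moreover have "f ` rotation_classes n = bicolored_plane_trees n"
  proof (intro equalityI subsetI)
    fix c assume "c \<in> f ` rotation_classes n"
    then obtain \<pi> where \<pi>: "\<pi> \<in> ?NC" "c = tree_class (polygon_tree n \<pi>)"
      using f by (auto simp: rotation_classes_def)
    obtain H :: "(nat, nat) plane_graph" and Y W y w
      where H: "bicolored_plane_tree H" "bicol H Y W y w" "polygon_tree n \<pi> \<simeq>\<^sub>p H"
      using copy[OF \<pi>(1)] by blast
    have "c = tree_class H" using bic[OF \<pi>(1)] H ne tree_class_cong \<pi>(2) by blast
    moreover have "card (edges H) = n" using plane_iso_edges[OF H(3)] ne by simp
    ultimately show "c \<in> bicolored_plane_trees n" using H(1) unfolding bicolored_plane_trees_def by blast
  next
    fix c assume "c \<in> bicolored_plane_trees n"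
    then obtain T :: "(nat, nat) plane_graph" where T: "bicolored_plane_tree T" "card (edges T) = n" "c = tree_class T"
      unfolding bicolored_plane_trees_def by blast
    have neT: "edges T \<noteq> {}" using T(2) assms by auto
    obtain Y W y w where "bicol T Y W y w" by (rule plane_tree_bicol[OF T(1) neT])
    then interpret T: bicol_tree T Y W y w
      using T(1) neT by (simp add: bicol_tree_def bicol_tree_axioms_def)
    obtain \<psi> where \<psi>: "bij_betw \<psi> (edges T) {1..n}" "\<And>e. e \<in> edges T \<Longrightarrow> \<psi> (T.next_side e) = rot n (\<psi> e)"
      using T.ex_labelling[OF T(2)[symmetric]] by blast
    define \<pi> where "\<pi> = (\<lambda>e. \<psi> ` {f \<in> edges T. Y f = Y e}) ` edges T"
    have \<pi>: "\<pi> \<in> ?NC" "T \<simeq>\<^sub>p polygon_tree n \<pi>"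
      using T.labelled_partition(1)[OF \<psi>] T.polygon_tree_of_labelling[OF \<psi>] by (simp_all add: \<pi>_def)
    have "c = tree_class (polygon_tree n \<pi>)"
      using bic[OF \<pi>(1)] T.bicol_axioms neT \<pi>(2) tree_class_cong T(3) by blast
    then have "c = f (rotation_class n \<pi>)" using f[OF \<pi>(1)] by simp
    then show "c \<in> f ` rotation_classes n" using \<pi>(1) by (auto simp: rotation_classes_def)
  qed
  ultimately have "bij_betw f (rotation_classes n) (bicolored_plane_trees n)" by (simp add: bij_betw_def)
  moreover have "bicolored_plane_tree (polygon_tree n \<pi>)" if "\<pi> \<in> ?NC" for \<pi>
    using nc_partition.plane_tree_polygon_tree[OF nc_partitionI[OF assms that]] .
  ultimately show ?thesis using f by (intro exI[of _ f]) blast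
qed

end
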